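(* Let $f(n, p, s)$ be a function such that for every $n$-node directed graph $G = (V, E)$, every $S \subseteq V$ and every set $P \subseteq S \times V$ of node pairs, $G$ has a reachability preserver of $G, P$ on at most $f(n, |P|, |S|)$ edges. Then there is a randomized algorithm that, given any such $G=(V,E)$, $S$ and $P \subseteq S \times V$, always outputs a reachability preserver of $G, P$ on $O(f(n, |P|, |S|))$ edges, and terminates in $O(|E| \cdot |S| \log n)$ time with high probability.
   Context: For a directed graph $G=(V,E)$ and a set of node pairs $P \subseteq V \times V$, a reachability preserver of $G,P$ is a subgraph $H=(V,E')$ with $E' \subseteq E$ such that for all $(s,t) \in P$, $H$ contains a directed path from $s$ to $t$ if and only if $G$ does. *)

theory Defs
  imports "HOL-Probability.SPMF"
begin

definition rp_instance :: "'a set \<Rightarrow> 'a rel \<Rightarrow> 'a set \<Rightarrow> ('a \<times> 'a) set \<Rightarrow> bool" where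
  "rp_instance V E S P \<longleftrightarrow> finite V \<and> E \<subseteq> V \<times> V \<and> S \<subseteq> V \<and> P \<subseteq> S \<times> V"

definition reach_preserver :: "'a rel \<Rightarrow> ('a \<times> 'a) set \<Rightarrow> 'a rel \<Rightarrow> bool" where
  "reach_preserver E P E' \<longleftrightarrow> E' \<subseteq> E \<and> (\<forall>(s, t) \<in> P. (s, t) \<in> E'\<^sup>* \<longleftrightarrow> (s, t) \<in> E\<^sup>*)"

text \<open>
  Algorithms are programs for a randomized word RAM.  The machine has registers and arrays, both
  numbered by natural numbers; a program text can mention only finitely many of them.  Everything
  is computed modulo a word bound \<open>W\<close>, which will be polynomial in the number of nodes, so that
  a word has \<open>O(log n)\<close> bits and unit cost arithmetic is legitimate.  The field \<open>time\<close> counts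
  the elementary steps and cannot be read by a program.
\<close>

datatype binop = Plus | Minus | Times | Divide | Modulo | Less | Equal

datatype expr = Num nat | Reg nat | Arr nat expr | Bin binop expr expr

datatype com =
    Skip
  | SetReg nat expr
  | SetArr nat expr expr
  | Rand nat expr
  | Seq com com
  | If expr com com
  | While expr com

record ram =
  regs :: "nat \<Rightarrow> nat"
  arrs :: "nat \<Rightarrow> nat \<Rightarrow> nat"
  time :: nat

text \<open>Subtraction is truncated at \<open>0\<close>, and division by \<open>0\<close> gives \<open>0\<close>.\<close>

fun apply_binop :: "binop \<Rightarrow> nat \<Rightarrow> nat \<Rightarrow> nat" where
  "apply_binop Plus a b = a + b"
| "apply_binop Minus a b = a - b"
| "apply_binop Times a b = a * b"
| "apply_binop Divide a b = a div b"
| "apply_binop Modulo a b = a mod b"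
| "apply_binop Less a b = of_bool (a < b)"
| "apply_binop Equal a b = of_bool (a = b)"

primrec val :: "nat \<Rightarrow> ram \<Rightarrow> expr \<Rightarrow> nat" where
  "val W \<sigma> (Num k) = k mod W"
| "val W \<sigma> (Reg x) = regs \<sigma> x"
| "val W \<sigma> (Arr a e) = arrs \<sigma> a (val W \<sigma> e)"
| "val W \<sigma> (Bin f e1 e2) = apply_binop f (val W \<sigma> e1) (val W \<sigma> e2) mod W"

primrec cost :: "expr \<Rightarrow> nat" where
  "cost (Num k) = 1"
| "cost (Reg x) = 1"
| "cost (Arr a e) = 1 + cost e"
| "cost (Bin f e1 e2) = 1 + cost e1 + cost e2"

definition tick :: "nat \<Rightarrow> ram \<Rightarrow> ram" where
  "tick k \<sigma> = \<sigma>\<lparr>time := time \<sigma> + k\<rparr>"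

definition set_reg :: "nat \<Rightarrow> nat \<Rightarrow> ram \<Rightarrow> ram" where
  "set_reg x v \<sigma> = \<sigma>\<lparr>regs := (regs \<sigma>)(x := v)\<rparr>"

definition set_arr :: "nat \<Rightarrow> nat \<Rightarrow> nat \<Rightarrow> ram \<Rightarrow> ram" where
  "set_arr a i v \<sigma> = \<sigma>\<lparr>arrs := (arrs \<sigma>)(a := (arrs \<sigma> a)(i := v))\<rparr>"

text \<open>Divergence shows up as missing probability mass of the resulting subdistribution.\<close>

partial_function (spmf) loop :: "('s \<Rightarrow> bool) \<Rightarrow> ('s \<Rightarrow> 's spmf) \<Rightarrow> 's \<Rightarrow> 's spmf" where
  "loop g b s = (if g s then bind_spmf (b s) (loop g b) else return_spmf s)"

text \<open>
  \<open>Rand x e\<close> draws a number uniformly from \<open>{0..k}\<close>, where \<open>k\<close> is the value of \<open>e\<close>.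
  In a while loop the first evaluation of the guard is charged on entry and each later one at the
  end of the preceding iteration.
\<close>

primrec exec :: "nat \<Rightarrow> com \<Rightarrow> ram \<Rightarrow> ram spmf" where
  "exec W Skip \<sigma> = return_spmf (tick 1 \<sigma>)"
| "exec W (SetReg x e) \<sigma> = return_spmf (tick (1 + cost e) (set_reg x (val W \<sigma> e) \<sigma>))"
| "exec W (SetArr a i e) \<sigma> =
     return_spmf (tick (1 + cost i + cost e) (set_arr a (val W \<sigma> i) (val W \<sigma> e) \<sigma>))"
| "exec W (Rand x e) \<sigma> =
     map_spmf (\<lambda>r. tick (1 + cost e) (set_reg x r \<sigma>)) (spmf_of_set {0..val W \<sigma> e})"
| "exec W (Seq c1 c2) \<sigma> = bind_spmf (exec W c1 \<sigma>) (exec W c2)"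
| "exec W (If e c1 c2) \<sigma> =
     (if val W \<sigma> e \<noteq> 0 then exec W c1 (tick (1 + cost e) \<sigma>)
      else exec W c2 (tick (1 + cost e) \<sigma>))"
| "exec W (While e c) \<sigma> =
     loop (\<lambda>\<sigma>. val W \<sigma> e \<noteq> 0) (\<lambda>\<sigma>. map_spmf (tick (1 + cost e)) (exec W c \<sigma>))
       (tick (1 + cost e) \<sigma>)"

text \<open>
  The nodes are \<open>0, ..., n - 1\<close>.  The registers \<open>0\<close> to \<open>3\<close> hold \<open>n\<close> and the sizes of \<open>E\<close>,
  \<open>S\<close> and \<open>P\<close>; the arrays \<open>0\<close> and \<open>1\<close> hold the tails and heads of the edges, in arbitrary
  order, array \<open>2\<close> holds the nodes of \<open>S\<close>, and array \<open>3\<close> is the row-major \<open>n\<close> by \<open>n\<close>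
  membership table of \<open>P\<close>.  All other cells are \<open>0\<close>.  A list of the pairs in place of the table
  would not do: when many nodes are isolated, reading \<open>P\<close> can take longer than
  \<open>|E| |S| log n\<close>.
\<close>

definition input_state :: "nat \<Rightarrow> (nat \<times> nat) list \<Rightarrow> nat list \<Rightarrow> (nat \<times> nat) set \<Rightarrow> ram" where
  "input_state n es ss P =
     \<lparr>regs = (\<lambda>_. 0)(0 := n, 1 := length es, 2 := length ss, 3 := card P),
      arrs = (\<lambda>_ _. 0)
        (0 := \<lambda>i. if i < length es then fst (es ! i) else 0,
         1 := \<lambda>i. if i < length es then snd (es ! i) else 0,
         2 := \<lambda>i. if i < length ss then ss ! i else 0,
         3 := \<lambda>j. of_bool ((j div n, j mod n) \<in> P)),
      time = 0\<rparr>"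

text \<open>The output is the set of edges whose positions in the input are marked in array \<open>4\<close>.\<close>

definition marked_edges :: "(nat \<times> nat) list \<Rightarrow> ram \<Rightarrow> (nat \<times> nat) set" where
  "marked_edges es \<sigma> = {es ! i | i. i < length es \<and> arrs \<sigma> 4 i \<noteq> 0}"

definition run :: "nat \<Rightarrow> com \<Rightarrow> nat \<Rightarrow> (nat \<times> nat) list \<Rightarrow> nat list \<Rightarrow> (nat \<times> nat) set \<Rightarrow> ram spmf" where
  "run k prog n es ss P = exec ((n + 2) ^ k) prog (input_state n es ss P)"

text \<open>\<open>es\<close> and \<open>ss\<close> enumerate, without repetitions, the edges and the set \<open>S\<close> of an instance.\<close>

definition rp_input :: "nat \<Rightarrow> (nat \<times> nat) list \<Rightarrow> nat list \<Rightarrow> (nat \<times> nat) set \<Rightarrow> bool" where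
  "rp_input n es ss P \<longleftrightarrow>
     distinct es \<and> distinct ss \<and> rp_instance {..<n} (set es) (set ss) P"

end

theory Submission
  imports Defs
begin

text \<open>
  If a graph \<open>H\<close> is its own only preserver for some set of at most \<open>|P|\<close> pairs with sources in \<open>S\<close>, then
  \<open>|H| \<le> f n |P| |S|\<close>. The algorithm is deterministic and outputs edges of two kinds. Let the level of
  a node be the number of sources that reach it. The level never drops along an edge, and it stays the
  same only if the same sources reach both ends. For the flat edges (those of constant level), spanning
  forests from and into the initial strongly connected components suffice. They have at most \<open>2 n\<close>
  edges, which is affordable because a path needs \<open>n - 1 \<le> f n |P| |S|\<close> edges.

  The rising edges into initial components are selected greedily from high levels to low ones. A
  source enters a component only if it needs it, and through one selected edge only; an edge is
  selected only when it is the last one through which some unserved source can enter. Hence each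
  selected edge has an owner: a source with no other selected way into that component, whichever
  path it takes. Contract, for each source, the tree of its chosen entries to the components where it
  owns an edge. The contracted graph has exactly one edge for each selected edge, and it is its own
  only preserver, so at most \<open>f n |P| |S|\<close> rising edges are selected.
\<close>

section \<open>Greedy selection of rising edges\<close>

text \<open>The bound \<open>f\<close> promises only that small preservers exist, and it is not
  assumed to be monotone. It can therefore be used only through instances with exactly the
  parameters \<open>n\<close>, \<open>|P|\<close> and \<open>|S|\<close>. Testing edges for
  necessity one at a time would yield such instances, but at the price of a search per edge. The
  scanning order makes the test for selection cheap. A need for a component arises from the input or
  from an edge into a strictly higher level, so all needs for a component are known once its own
  level is scanned. Whether an edge is the last one covering a source depends on the graph alone, so
  a table computed beforehand answers it. Once the last covering edge of an owner has been passed,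
  no later selection can offer that owner a second entry. For the running time, each edge is touched
  once per level at constant cost and only once at cost \<open>O(|S|)\<close>. Since
  \<open>n\<close> may far exceed \<open>|E|\<close>, loops run over edges, edge ends, sources or
  newly found nodes, never over all nodes; memory that starts as 0 makes this possible.\<close>

definition reach :: "(nat \<times> nat) list \<Rightarrow> nat list \<Rightarrow> nat \<Rightarrow> nat \<Rightarrow> bool" where
  "reach es ss i v \<longleftrightarrow> i < length ss \<and> (ss ! i, v) \<in> (set es)\<^sup>*"

definition level :: "(nat \<times> nat) list \<Rightarrow> nat list \<Rightarrow> nat \<Rightarrow> nat" where
  "level es ss v = card {i. reach es ss i v}"

definition flat :: "(nat \<times> nat) list \<Rightarrow> nat list \<Rightarrow> nat rel" where
  "flat es ss = {(u, v) \<in> set es. level es ss u = level es ss v}"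

definition ends :: "(nat \<times> nat) list \<Rightarrow> nat set" where
  "ends es = fst ` set es \<union> snd ` set es"

lemma finite_reach: "finite {i. reach es ss i v}"
  by (rule finite_subset[of _ "{..<length ss}"]) (auto simp: reach_def)

lemma reach_trans: "reach es ss i u \<Longrightarrow> (u, v) \<in> (set es)\<^sup>* \<Longrightarrow> reach es ss i v"
  by (auto simp: reach_def)

lemma level_mono: "(u, v) \<in> (set es)\<^sup>* \<Longrightarrow> level es ss u \<le> level es ss v"
  unfolding level_def by (rule card_mono[OF finite_reach]) (auto intro: reach_trans)

lemma level_le: "level es ss v \<le> length ss"
  unfolding level_def using card_mono[of "{..<length ss}" "{i. reach es ss i v}"]
  by (auto simp: reach_def)

text \<open>The sources reaching \<open>u\<close> are among those reaching \<open>v\<close>, and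
  equal finite cardinalities make the two sets equal.\<close>

lemma level_eq_reach:
  assumes "(u, v) \<in> (set es)\<^sup>*" "level es ss u = level es ss v" "reach es ss i v"
  shows "reach es ss i u"
proof -
  have "{i. reach es ss i u} = {i. reach es ss i v}"
    using assms(1,2) by (intro card_subset_eq[OF finite_reach]) (auto intro: reach_trans simp: level_def)
  then show ?thesis using assms(3) by blast
qed

text \<open>
  Node labels are shifted by one, \<open>0\<close> meaning that there is none: \<open>rt v\<close> names the root of the tree of \<open>v\<close>,
  and \<open>cp y\<close> names the root whose strongly connected component in the flat graph contains \<open>y\<close>.
\<close>

locale flat_forest =
  fixes es :: "(nat \<times> nat) list" and ss :: "nat list" and P :: "(nat \<times> nat) set"
    and rt cp :: "nat \<Rightarrow> nat" and F :: "nat set"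
  assumes F_index: "F \<subseteq> {..<length es}"
    and F_flat: "e \<in> F \<Longrightarrow> es ! e \<in> flat es ss"
    and rt_nonzero: "v \<in> ends es \<Longrightarrow> rt v \<noteq> 0"
    and rt_path: "v \<in> ends es \<Longrightarrow> (rt v - 1, v) \<in> ((!) es ` F)\<^sup>*"
    and cp_rt: "v \<in> ends es \<Longrightarrow> cp (rt v - 1) = rt v"
    and cp_path: "cp y \<noteq> 0 \<Longrightarrow> (y, cp y - 1) \<in> ((!) es ` F)\<^sup>*"
    and cp_closed: "(a, b) \<in> flat es ss \<Longrightarrow> cp b \<noteq> 0 \<Longrightarrow> cp a = cp b"
begin

abbreviation "src e \<equiv> fst (es ! e)"
abbreviation "dst e \<equiv> snd (es ! e)"
abbreviation "R \<equiv> reach es ss"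
abbreviation "lev \<equiv> level es ss"
abbreviation "into e \<equiv> cp (dst e)"

definition rising :: "nat \<Rightarrow> bool" where
  "rising e \<longleftrightarrow> e < length es \<and> into e \<noteq> 0 \<and> lev (src e) < lev (dst e)"

definition covers :: "nat \<Rightarrow> nat \<Rightarrow> nat \<Rightarrow> bool" where
  "covers i r e \<longleftrightarrow> rising e \<and> into e = r \<and> R i (src e)"

definition last_cover :: "nat \<Rightarrow> nat \<Rightarrow> nat \<Rightarrow> bool" where
  "last_cover i r e \<longleftrightarrow> covers i r e \<and> (\<forall>e'. covers i r e' \<longrightarrow> e' \<le> e)"

text \<open>A node that is not the head of an edge is reached only from itself, by the empty path,
  and such pairs cost no edge. The restriction to heads lets a loop over the edges find every
  demand.\<close>

definition demand :: "nat \<Rightarrow> nat \<Rightarrow> bool" where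
  "demand i t \<longleftrightarrow> R i t \<and> (ss ! i, t) \<in> P \<and> t \<in> snd ` set es"

lemma demand_ends: "demand i t \<Longrightarrow> t \<in> ends es"
  by (auto simp: demand_def ends_def)

lemma src_ends: "e < length es \<Longrightarrow> src e \<in> ends es"
  and dst_ends: "e < length es \<Longrightarrow> dst e \<in> ends es"
  by (auto simp: ends_def)

lemma F_sub: "(!) es ` F \<subseteq> flat es ss"
  using F_flat by auto

lemma flat_sub: "flat es ss \<subseteq> set es"
  by (auto simp: flat_def)

lemma flat_level: "(u, v) \<in> (flat es ss)\<^sup>* \<Longrightarrow> lev u = lev v"
  by (induction rule: rtrancl_induct) (auto simp: flat_def)

lemma F_path_level: "(u, v) \<in> ((!) es ` F)\<^sup>* \<Longrightarrow> lev u = lev v"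
  using flat_level rtrancl_mono[OF F_sub] by blast

lemma F_path_E: "(u, v) \<in> ((!) es ` F)\<^sup>* \<Longrightarrow> (u, v) \<in> (set es)\<^sup>*"
  using rtrancl_mono[OF subset_trans[OF F_sub flat_sub]] by blast

lemma lev_rt: "v \<in> ends es \<Longrightarrow> lev (rt v - 1) = lev v"
  using rt_path F_path_level by blast

text \<open>Flat paths do not change the set of sources, so needs can be stated for roots instead of
  nodes.\<close>

lemma R_rt: "v \<in> ends es \<Longrightarrow> R i (rt v - 1) \<longleftrightarrow> R i v"
  using rt_path[of v] lev_rt[of v] F_path_E level_eq_reach reach_trans by metis

lemma rising_lev_into: "rising e \<Longrightarrow> lev (into e - 1) = lev (dst e)"
  using cp_path F_path_level unfolding rising_def by metis

text \<open>Follow a path from the source backwards from the root. An edge into the component is not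
  rising, as it would cover the source, so it is flat; and no flat edge enters the component from
  outside. The path therefore never leaves the component.\<close>

lemma uncovered_root:
  assumes "R i (r - 1)" "r \<noteq> 0" "cp (r - 1) = r" "\<And>e. \<not> covers i r e"
  shows "cp (ss ! i) = r"
proof -
  have "(a, r - 1) \<in> (set es)\<^sup>* \<Longrightarrow> R i a \<Longrightarrow> cp a = r" for a
  proof (induction rule: converse_rtrancl_induct)
    case base
    then show ?case using assms(3) by simp
  next
    case (step a b)
    have b: "cp b = r" using step reach_trans by blast
    obtain e where e: "e < length es" "es ! e = (a, b)" using step(1) by (metis in_set_conv_nth)
    have "\<not> lev a < lev b"
      using assms(4)[of e] e b assms(2) step.prems by (auto simp: covers_def rising_def)
    moreover have "lev a \<le> lev b" using level_mono step(1) by blast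
    ultimately have "(a, b) \<in> flat es ss" using step(1) by (auto simp: flat_def)
    then show ?case using cp_closed b assms(2) by metis
  qed
  moreover have "(ss ! i, r - 1) \<in> (set es)\<^sup>*" "R i (ss ! i)" using assms(1) by (auto simp: reach_def)
  ultimately show ?thesis by blast
qed

text \<open>
  The state of the greedy selection. \<open>N i r\<close> is \<open>1\<close> if source \<open>i\<close> still has to be connected to
  root \<open>r\<close>, and \<open>2\<close> if it has been, through the selected edge \<open>pk i r\<close>. Each selected edge is, for
  some source, the only selected way into its component: this is what makes the selection optimal.
\<close>

definition greedy_inv where
  "greedy_inv N K pk D \<longleftrightarrow>
     K \<subseteq> D \<and> D \<subseteq> Collect rising \<and>
     (\<forall>i r. N i r \<in> {0, 1, 2 :: nat}) \<and>
     (\<forall>i r. N i r \<noteq> 0 \<longrightarrow> R i (r - 1) \<and> r \<in> rt ` ends es) \<and>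
     (\<forall>i r. N i r = 2 \<longrightarrow> pk i r \<in> K \<and> covers i r (pk i r) \<and> N i (rt (src (pk i r))) \<noteq> 0) \<and>
     (\<forall>i r. N i r \<noteq> 0 \<longrightarrow>
        (\<exists>t. demand i t \<and> r = rt t) \<or> (\<exists>r'. N i r' = 2 \<and> r = rt (src (pk i r')))) \<and>
     (\<forall>i t. demand i t \<longrightarrow> N i (rt t) \<noteq> 0) \<and>
     (\<forall>i r. N i r = 1 \<longrightarrow> (\<forall>e\<in>K. \<not> covers i r e)) \<and>
     (\<forall>e\<in>K. \<exists>i. N i (into e) = 2 \<and> pk i (into e) = e \<and> last_cover i (into e) e \<and>
        (\<forall>e'\<in>K. covers i (into e) e' \<longrightarrow> e' = e)) \<and>
     (\<forall>i r. N i r = 1 \<longrightarrow> (\<forall>e. last_cover i r e \<longrightarrow> e \<notin> D))"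

lemma greedy_inv_init:
  "greedy_inv (\<lambda>i r. of_bool (\<exists>t. demand i t \<and> rt t = r)) {} pk {}"
proof -
  have "R i (rt t - 1)" "rt t \<in> rt ` ends es" if "demand i t" for i t
    using that R_rt[OF demand_ends[OF that]] demand_ends[OF that] by (auto simp: demand_def)
  then show ?thesis unfolding greedy_inv_def by auto
qed

text \<open>The only clause at risk is the one that keeps the last covering edges of unserved
  sources out of the scanned set.\<close>

lemma greedy_inv_skip:
  assumes inv: "greedy_inv N K pk D" and e: "rising e"
    and no: "\<And>i. N i (into e) = 1 \<Longrightarrow> \<not> last_cover i (into e) e"
  shows "greedy_inv N K pk (insert e D)"
  using inv e no unfolding greedy_inv_def
  by (simp add: subset_insertI2) (metis covers_def last_cover_def)

text \<open>Every unserved source that reaches the tail takes \<open>e\<close>, not only one that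
  forces it, and its need moves on to the root of the tail. In the scanning order that root has not
  been served yet, so writing 1 never undoes a 2.\<close>

definition satisfy :: "nat \<Rightarrow> (nat \<Rightarrow> nat \<Rightarrow> nat) \<Rightarrow> nat \<Rightarrow> nat \<Rightarrow> nat" where
  "satisfy e N = (\<lambda>i r. if N i (into e) = 1 \<and> R i (src e)
      then if r = into e then 2 else if r = rt (src e) then 1 else N i r else N i r)"

text \<open>The scanning order is used twice. All scanned edges enter levels at least that of
  \<open>e\<close>, so nothing has been decided yet about the lower root that becomes needed. And
  selected edges into the component of \<open>e\<close> precede \<open>e\<close>, while their owners
  have no covering edge after them, so \<open>e\<close> spoils no ownership.\<close>

lemma greedy_inv_take:
  assumes inv: "greedy_inv N K pk D" and e: "rising e"
    and forced: "N j (into e) = 1" "last_cover j (into e) e"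
    and order: "\<And>d. d \<in> D \<Longrightarrow> lev (dst e) \<le> lev (dst d)"
      "\<And>d. d \<in> D \<Longrightarrow> into d = into e \<Longrightarrow> d < e"
  shows "greedy_inv (satisfy e N) (insert e K)
    (\<lambda>i r. if N i (into e) = 1 \<and> R i (src e) \<and> r = into e then e else pk i r) (insert e D)"
proof -
  define r0 where "r0 = into e"
  define x0 where "x0 = rt (src e)"
  have em: "e < length es" and r0: "r0 \<noteq> 0" and lv: "lev (src e) < lev (dst e)"
    using e by (auto simp: rising_def r0_def)
  have levr0: "lev (r0 - 1) = lev (dst e)" using rising_lev_into[OF e] r0_def by simp
  have levx0: "lev (x0 - 1) = lev (src e)" using lev_rt[OF src_ends[OF em]] x0_def by simp
  have ne: "x0 \<noteq> r0" using levr0 levx0 lv by auto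
  have x0in: "x0 \<in> rt ` ends es" using src_ends[OF em] x0_def by simp
  have Rx0: "R i (x0 - 1) \<longleftrightarrow> R i (src e)" for i using R_rt[OF src_ends[OF em]] x0_def by simp
  have K: "K \<subseteq> D" "D \<subseteq> Collect rising" and
    N012: "\<And>i r. N i r \<in> {0, 1, 2}" and
    NR: "\<And>i r. N i r \<noteq> 0 \<Longrightarrow> R i (r - 1) \<and> r \<in> rt ` ends es" and
    N2: "\<And>i r. N i r = 2 \<Longrightarrow> pk i r \<in> K \<and> covers i r (pk i r) \<and> N i (rt (src (pk i r))) \<noteq> 0" and
    orig: "\<And>i r. N i r \<noteq> 0 \<Longrightarrow>
        (\<exists>t. demand i t \<and> r = rt t) \<or> (\<exists>r'. N i r' = 2 \<and> r = rt (src (pk i r')))" and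
    dem: "\<And>i t. demand i t \<Longrightarrow> N i (rt t) \<noteq> 0" and
    N1: "\<And>i r e. N i r = 1 \<Longrightarrow> e \<in> K \<Longrightarrow> \<not> covers i r e" and
    forc: "\<And>e. e \<in> K \<Longrightarrow> \<exists>i. N i (into e) = 2 \<and> pk i (into e) = e \<and> last_cover i (into e) e \<and>
        (\<forall>e'\<in>K. covers i (into e) e' \<longrightarrow> e' = e)" and
    prog: "\<And>i r e. N i r = 1 \<Longrightarrow> last_cover i r e \<Longrightarrow> e \<notin> D"
    using inv unfolding greedy_inv_def by auto
  define hit where "hit i \<longleftrightarrow> N i r0 = 1 \<and> R i (src e)" for i
  define N' where "N' = satisfy e N"
  have N': "N' i r = (if hit i \<and> r = r0 then 2 else if hit i \<and> r = x0 then 1 else N i r)" for i r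
    by (auto simp: N'_def satisfy_def hit_def r0_def x0_def)
  define pk' where "pk' = (\<lambda>i r. if N i (into e) = 1 \<and> R i (src e) \<and> r = into e then e else pk i r)"
  have pk': "pk' i r = (if hit i \<and> r = r0 then e else pk i r)" for i r
    by (auto simp: pk'_def hit_def r0_def)
  \<comment> \<open>A need served at \<open>x0\<close> would have used a scanned edge into the level
    of \<open>x0\<close>, which is below everything scanned.\<close>
  have Nx0: "N i x0 \<noteq> 2" for i
  proof
    assume "N i x0 = 2"
    then have "pk i x0 \<in> D" and c: "covers i x0 (pk i x0)" using N2 K by auto
    then have "lev (dst e) \<le> lev (dst (pk i x0))" using order by blast
    also have "\<dots> = lev (x0 - 1)" using c rising_lev_into unfolding covers_def by metis
    finally show False using levx0 lv by simp
  qed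
  have eD: "e \<notin> D" using order(2) by blast
  have cov_e: "covers i r0 e" if "hit i" for i using that e by (auto simp: covers_def hit_def r0_def)
  have N'0: "N' i r \<noteq> 0" if "N i r \<noteq> 0" for i r using that by (auto simp: N')
  have last_low: "f \<notin> insert e D" if "last_cover i x0 f" for i f
  proof -
    have "rising f" "into f = x0" using that by (auto simp: last_cover_def covers_def)
    then have "lev (dst f) = lev (src e)" using rising_lev_into[of f] levx0 by simp
    then show ?thesis using lv order(1)[of f] by auto
  qed
  have "greedy_inv N' (insert e K) pk' (insert e D)"
    unfolding greedy_inv_def
  proof (intro conjI allI impI ballI)
    show "insert e K \<subseteq> insert e D" "insert e D \<subseteq> Collect rising" using K e by auto
    show "N' i r \<in> {0, 1, 2}" for i r using N012[of i r] by (auto simp: N')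
    fix i r
    show "R i (r - 1)" "r \<in> rt ` ends es" if "N' i r \<noteq> 0"
      using that NR[of i r] NR[of i r0] Rx0 x0in by (auto simp: N' hit_def split: if_splits)
    show "pk' i r \<in> insert e K" if "N' i r = 2"
      using that N2 by (auto simp: N' pk' split: if_splits)
    show "covers i r (pk' i r)" if "N' i r = 2"
      using that N2 cov_e by (auto simp: N' pk' split: if_splits)
    show "N' i (rt (src (pk' i r))) \<noteq> 0" if "N' i r = 2"
    proof (cases "hit i \<and> r = r0")
      case True
      then show ?thesis using ne by (simp add: N' pk' flip: x0_def)
    next
      case False
      then have "N i r = 2" using that by (auto simp: N' split: if_splits)
      then show ?thesis using N2 False N'0 by (auto simp: pk')
    qed
    show "(\<exists>t. demand i t \<and> r = rt t) \<or> (\<exists>r'. N' i r' = 2 \<and> r = rt (src (pk' i r')))"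
      if nz: "N' i r \<noteq> 0"
    proof (cases "hit i \<and> r = x0")
      case True
      then have "N' i r0 = 2" "r = rt (src (pk' i r0))" by (auto simp: N' pk' x0_def)
      then show ?thesis by blast
    next
      case False
      then have "N i r \<noteq> 0" using nz by (auto simp: N' hit_def split: if_splits)
      from orig[OF this] show ?thesis
      proof
        assume "\<exists>r'. N i r' = 2 \<and> r = rt (src (pk i r'))"
        then obtain r' where r': "N i r' = 2" "r = rt (src (pk i r'))" by blast
        have "r' \<noteq> x0" "\<not> (hit i \<and> r' = r0)" using r' Nx0 by (auto simp: hit_def)
        then have "N' i r' = 2" "pk' i r' = pk i r'" using r' by (auto simp: N' pk')
        then show ?thesis using r' by metis
      qed blast
    qed
    show "\<not> covers i r f" if N1': "N' i r = 1" and f: "f \<in> insert e K" for f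
    proof
      assume c: "covers i r f"
      show False
      proof (cases "hit i \<and> r = x0")
        case True
        have "rising f" "into f = x0" using c True by (auto simp: covers_def)
        then have "lev (dst f) = lev (src e)" using rising_lev_into[of f] levx0 by simp
        then show False using lv order(1)[of f] f K by auto
      next
        case False
        then have "N i r = 1" "\<not> (hit i \<and> r = r0)" using N1' by (auto simp: N' split: if_splits)
        then show False using c f N1 by (auto simp: covers_def hit_def r0_def)
      qed
    qed
    show "f \<notin> insert e D" if N1': "N' i r = 1" and f: "last_cover i r f" for f
    proof (cases "hit i \<and> r = x0")
      case True
      then show ?thesis using last_low f by blast
    next
      case False
      then have n: "N i r = 1" "\<not> (hit i \<and> r = r0)" using N1' by (auto simp: N' split: if_splits)
      then have "f \<noteq> e" using f by (auto simp: last_cover_def covers_def hit_def r0_def)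
      then show ?thesis using prog n(1) f by auto
    qed
  next
    show "N' i (rt t) \<noteq> 0" if "demand i t" for i t using dem[OF that] N'0 by blast
  next
    fix f assume f: "f \<in> insert e K"
    show "\<exists>i. N' i (into f) = 2 \<and> pk' i (into f) = f \<and> last_cover i (into f) f \<and>
        (\<forall>e'\<in>insert e K. covers i (into f) e' \<longrightarrow> e' = f)"
    proof (cases "f = e")
      case True
      \<comment> \<open>The source \<open>j\<close> that forces \<open>e\<close> becomes its owner:
        its need was open, so no edge selected earlier covers it.\<close>
      have h: "hit j" using forced by (auto simp: hit_def r0_def last_cover_def covers_def)
      have "N' j r0 = 2" "pk' j r0 = e" using h by (auto simp: N' pk')
      moreover have "e' = e" if "e' \<in> insert e K" "covers j r0 e'" for e'
        using that N1[of j r0 e'] forced by (auto simp: r0_def)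
      ultimately show ?thesis using True forced by (auto simp flip: r0_def)
    next
      case False
      then have fK: "f \<in> K" using f by blast
      obtain i where i: "N i (into f) = 2" "pk i (into f) = f" "last_cover i (into f) f"
        "\<forall>e'\<in>K. covers i (into f) e' \<longrightarrow> e' = f" using forc[OF fK] by blast
      have "into f \<noteq> x0" using i(1) Nx0 by metis
      moreover have "\<not> (hit i \<and> into f = r0)" using i(1) by (auto simp: hit_def)
      moreover have "\<not> covers i (into f) e"
      proof
        assume c: "covers i (into f) e"
        then have "e \<le> f" using i(3) by (auto simp: last_cover_def)
        moreover have "f < e" using order(2)[of f] fK K c by (auto simp: covers_def)
        ultimately show False by simp
      qed
      ultimately show ?thesis using i by (auto simp: N' pk' intro!: exI[of _ i])
    qed
  qed
  then show ?thesis by (simp add: N'_def pk'_def)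
qed

end

section \<open>The contracted instance\<close>

text \<open>The climb along \<open>nxt\<close> need not end for arbitrary arguments, so it is a
  relation. Where it is used, each step strictly lowers the level, which gives existence. Labels are
  shifted by one, hence the node \<open>r - 1\<close>.\<close>

inductive anchor :: "nat set \<Rightarrow> (nat \<Rightarrow> nat option) \<Rightarrow> nat \<Rightarrow> nat \<Rightarrow> nat \<Rightarrow> bool"
  for X nxt s where
  here: "r \<in> X \<Longrightarrow> anchor X nxt s r (r - 1)"
| stop: "r \<notin> X \<Longrightarrow> nxt r = None \<Longrightarrow> anchor X nxt s r s"
| up: "r \<notin> X \<Longrightarrow> nxt r = Some r' \<Longrightarrow> anchor X nxt s r' w \<Longrightarrow> anchor X nxt s r w"

lemma anchor_unique: "anchor X nxt s r w \<Longrightarrow> anchor X nxt s r w' \<Longrightarrow> w' = w"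
proof (induction rule: anchor.induct)
  case (here r)
  from here(2,1) show ?case by cases auto
next
  case (stop r)
  from stop(3,1,2) show ?case by cases auto
next
  case (up r r' w)
  from up(5) up(1,2,4) show ?case by cases auto
qed

locale greedy_result = flat_forest +
  fixes n :: nat and N :: "nat \<Rightarrow> nat \<Rightarrow> nat" and K :: "nat set" and pk :: "nat \<Rightarrow> nat \<Rightarrow> nat"
  assumes inv: "greedy_inv N K pk (Collect rising)"
    and input: "rp_input n es ss P"
begin

lemma K_rising: "e \<in> K \<Longrightarrow> rising e"
  and NR: "N i r \<noteq> 0 \<Longrightarrow> R i (r - 1)"
  and N_root: "N i r \<noteq> 0 \<Longrightarrow> r \<in> rt ` ends es"
  and N2: "N i r = 2 \<Longrightarrow> pk i r \<in> K" "N i r = 2 \<Longrightarrow> covers i r (pk i r)"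
    "N i r = 2 \<Longrightarrow> N i (rt (src (pk i r))) \<noteq> 0"
  and N_origin: "N i r \<noteq> 0 \<Longrightarrow>
        (\<exists>t. demand i t \<and> r = rt t) \<or> (\<exists>r'. N i r' = 2 \<and> r = rt (src (pk i r')))"
  and N_demand: "demand i t \<Longrightarrow> N i (rt t) \<noteq> 0"
  and forced: "e \<in> K \<Longrightarrow> \<exists>i. N i (into e) = 2 \<and> pk i (into e) = e \<and>
        (\<forall>e'\<in>K. covers i (into e) e' \<longrightarrow> e' = e)"
  and N1: "N i r = 1 \<Longrightarrow> last_cover i r e \<Longrightarrow> \<not> rising e"
  and N_range: "N i r = 0 \<or> N i r = 1 \<or> N i r = 2"
  using inv unfolding greedy_inv_def by auto

lemma N_cases:
  assumes "N i r \<noteq> 0"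
  obtains "N i r = 1" | "N i r = 2"
using N_range[of i r] assms that by auto

text \<open>All rising edges are scanned, so an open need has no last covering edge. The covering
  edges form a finite set, hence there are none, and the source lies in the component
  itself.\<close>

lemma N1_root:
  assumes "N i r = 1"
  shows "cp (ss ! i) = r" "r \<noteq> 0" "cp (r - 1) = r"
proof -
  obtain v where v: "v \<in> ends es" "r = rt v" using N_root[of i r] assms by auto
  show r: "r \<noteq> 0" "cp (r - 1) = r" using v rt_nonzero cp_rt by auto
  have no: "\<not> covers i r e" for e
  proof
    assume c: "covers i r e"
    have fin: "finite {e. covers i r e}"
      by (rule finite_subset[of _ "{..<length es}"]) (auto simp: covers_def rising_def)
    have m: "covers i r (Max {e. covers i r e})" using Max_in[OF fin] c by blast
    then have "last_cover i r (Max {e. covers i r e})"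
      unfolding last_cover_def using Max_ge[OF fin] by blast
    then show False using N1[OF assms] m by (simp add: covers_def)
  qed
  show "cp (ss ! i) = r"
    using uncovered_root[OF NR r no] assms by simp
qed

lemma pick_edge:
  assumes "N i r = 2"
  shows "pk i r < length es" "R i (src (pk i r))" "into (pk i r) = r" "r \<noteq> 0"
    "lev (rt (src (pk i r)) - 1) < lev (r - 1)"
  using N2[OF assms] rising_lev_into[of "pk i r"] lev_rt[of "src (pk i r)"] src_ends[of "pk i r"]
  by (auto simp: covers_def rising_def)

text \<open>Induction on levels. An open need is met inside the component by the forest into its
  root. A served one goes through the root of the tail of the chosen edge, which is needed too and
  lies on a lower level.\<close>

lemma N_connected: "N i r \<noteq> 0 \<Longrightarrow> (ss ! i, r - 1) \<in> ((!) es ` (F \<union> K))\<^sup>*"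
proof (induction "lev (r - 1)" arbitrary: r rule: less_induct)
  case less
  let ?H = "(!) es ` (F \<union> K)"
  have FH: "(u, v) \<in> ((!) es ` F)\<^sup>* \<Longrightarrow> (u, v) \<in> ?H\<^sup>*" for u v
    using rtrancl_mono[of "(!) es ` F" ?H] by blast
  from less.prems show ?case
  proof (cases rule: N_cases)
    case 1
    then show ?thesis using FH[OF cp_path] N1_root by metis
  next
    case 2
    let ?e = "pk i r"
    have "(ss ! i, rt (src ?e) - 1) \<in> ?H\<^sup>*" using less.hyps pick_edge N2 2 by blast
    also have "(rt (src ?e) - 1, src ?e) \<in> ?H\<^sup>*"
      using FH[OF rt_path] src_ends pick_edge 2 by blast
    also have "(src ?e, dst ?e) \<in> ?H" using N2(1)[OF 2] by (auto intro: rev_image_eqI)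
    also have "(dst ?e, r - 1) \<in> ?H\<^sup>*" using FH[OF cp_path[of "dst ?e"]] pick_edge[OF 2] by simp
    finally show ?thesis .
  qed
qed

lemma is_preserver: "reach_preserver (set es) P ((!) es ` (F \<union> K))"
proof -
  have sub: "(!) es ` (F \<union> K) \<subseteq> set es"
    using F_index K_rising by (auto simp: rising_def)
  have "(s, t) \<in> ((!) es ` (F \<union> K))\<^sup>*" if st: "(s, t) \<in> P" "(s, t) \<in> (set es)\<^sup>*" for s t
  proof (cases "s = t")
    case False
    obtain i where i: "i < length ss" "ss ! i = s"
      using st input unfolding rp_input_def rp_instance_def by (metis in_set_conv_nth mem_Sigma_iff subsetD)
    have "t \<in> snd ` set es" using st(2) False by (metis rtranclE snd_conv image_eqI)
    then have d: "demand i t" using i st by (auto simp: demand_def reach_def)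
    then have "(s, rt t - 1) \<in> ((!) es ` (F \<union> K))\<^sup>*" using N_connected N_demand i by blast
    also have "(rt t - 1, t) \<in> ((!) es ` (F \<union> K))\<^sup>*"
      using rt_path[OF demand_ends[OF d]] rtrancl_mono[of "(!) es ` F" "(!) es ` (F \<union> K)"] by blast
    finally show ?thesis .
  qed simp
  then show ?thesis using sub rtrancl_mono[OF sub] unfolding reach_preserver_def by blast
qed

section \<open>Owners of selected edges\<close>

definition owner :: "nat \<Rightarrow> nat" where
  "owner e = (SOME i. N i (into e) = 2 \<and> pk i (into e) = e \<and>
     (\<forall>e'\<in>K. covers i (into e) e' \<longrightarrow> e' = e))"

lemma owner:
  assumes "e \<in> K"
  shows "N (owner e) (into e) = 2" "pk (owner e) (into e) = e"
    "e' \<in> K \<Longrightarrow> into e' = into e \<Longrightarrow> R (owner e) (src e') \<Longrightarrow> e' = e"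
proof -
  have *: "N (owner e) (into e) = 2 \<and> pk (owner e) (into e) = e \<and>
     (\<forall>e'\<in>K. covers (owner e) (into e) e' \<longrightarrow> e' = e)"
    using someI_ex[OF forced[OF assms]] unfolding owner_def .
  then show "N (owner e) (into e) = 2" "pk (owner e) (into e) = e" by auto
  show "e' \<in> K \<Longrightarrow> into e' = into e \<Longrightarrow> R (owner e) (src e') \<Longrightarrow> e' = e"
    using * K_rising[of e'] by (simp add: covers_def)
qed

definition owned :: "nat \<Rightarrow> nat set" where
  "owned i = into ` {e \<in> K. owner e = i}"

text \<open>Contracting the tree of source \<open>i\<close> to the roots it owns: \<open>top_node i r\<close> is the lowest of them above \<open>r\<close>.\<close>

definition next_root where
  "next_root i r = (if N i r = 2 then Some (rt (src (pk i r))) else None)"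

definition top_node :: "nat \<Rightarrow> nat \<Rightarrow> nat" where
  "top_node i r = (THE w. anchor (owned i) (next_root i) (ss ! i) r w)"

lemma topI: "anchor (owned i) (next_root i) (ss ! i) r w \<Longrightarrow> top_node i r = w"
  unfolding top_node_def by (blast intro: anchor_unique)

lemma anchor_top: "N i r \<noteq> 0 \<Longrightarrow> anchor (owned i) (next_root i) (ss ! i) r (top_node i r)"
proof (induction "lev (r - 1)" arbitrary: r rule: less_induct)
  case less
  have "\<exists>w. anchor (owned i) (next_root i) (ss ! i) r w"
  proof (cases "r \<in> owned i")
    case True
    then show ?thesis by (blast intro: anchor.here)
  next
    case False
    from less.prems show ?thesis
    proof (cases rule: N_cases)
      case 1
      then show ?thesis using anchor.stop[OF False, of "next_root i"] by (auto simp: next_root_def)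
    next
      case 2
      then show ?thesis using anchor.up[OF False] less.hyps[OF _ N2(3)] pick_edge(5)
        by (metis next_root_def)
    qed
  qed
  then show ?case using topI by blast
qed

lemma top_owned: "r \<in> owned i \<Longrightarrow> top_node i r = r - 1"
  by (blast intro: topI anchor.here)

lemma top_stop: "N i r = 1 \<Longrightarrow> top_node i r = ss ! i"
  by (rule topI, rule anchor.stop) (auto simp: next_root_def owned_def owner)

lemma top_up: "N i r = 2 \<Longrightarrow> r \<notin> owned i \<Longrightarrow> top_node i r = top_node i (rt (src (pk i r)))"
  by (rule topI, rule anchor.up) (auto simp: next_root_def intro!: anchor_top N2)

lemma ss_R: "N i r \<noteq> 0 \<Longrightarrow> R i (ss ! i)"
  using NR by (auto simp: reach_def)

lemma pick_path:
  assumes "N i r = 2"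
  shows "(src (pk i r), r - 1) \<in> (set es)\<^sup>*" "(rt (src (pk i r)) - 1, src (pk i r)) \<in> (set es)\<^sup>*"
proof -
  note p = pick_edge[OF assms]
  have "(src (pk i r), dst (pk i r)) \<in> set es" "(dst (pk i r), r - 1) \<in> (set es)\<^sup>*"
    using p F_path_E cp_path[of "dst (pk i r)"] by auto
  then show "(src (pk i r), r - 1) \<in> (set es)\<^sup>*" by (rule converse_rtrancl_into_rtrancl)
  show "(rt (src (pk i r)) - 1, src (pk i r)) \<in> (set es)\<^sup>*"
    using F_path_E rt_path src_ends p by blast
qed

lemma top_path: "N i r \<noteq> 0 \<Longrightarrow> R i (top_node i r) \<and> (top_node i r, r - 1) \<in> (set es)\<^sup>*"
proof (induction "lev (r - 1)" arbitrary: r rule: less_induct)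
  case less
  show ?case
  proof (cases "r \<in> owned i")
    case True
    then show ?thesis using top_owned NR less.prems by simp
  next
    case False
    from less.prems show ?thesis
    proof (cases rule: N_cases)
      case 1
      then show ?thesis using top_stop ss_R NR[of i r] by (auto simp: reach_def)
    next
      case 2
      have "R i (top_node i r) \<and> (top_node i r, rt (src (pk i r)) - 1) \<in> (set es)\<^sup>*"
        using less.hyps[OF pick_edge(5)[OF 2] N2(3)[OF 2]] top_up[OF 2 False] by simp
      then show ?thesis using pick_path[OF 2] by (meson rtrancl_trans)
    qed
  qed
qed

section \<open>The contracted graph is its own only preserver\<close>

definition anc :: "nat \<Rightarrow> nat" where
  "anc e = top_node (owner e) (rt (src e))"

definition cedge :: "nat \<Rightarrow> nat \<times> nat" where
  "cedge e = (anc e, into e - 1)"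

lemma anc:
  assumes "e \<in> K"
  shows "R (owner e) (anc e)" "(anc e, src e) \<in> (set es)\<^sup>*" "(anc e, into e - 1) \<in> (set es)\<^sup>*"
proof -
  have o: "N (owner e) (into e) = 2" "pk (owner e) (into e) = e" using owner assms by auto
  show "R (owner e) (anc e)" and a: "(anc e, src e) \<in> (set es)\<^sup>*"
    using top_path[OF N2(3)[OF o(1)]] pick_path[OF o(1)] unfolding o(2) anc_def
    by (auto dest: rtrancl_trans)
  then show "(anc e, into e - 1) \<in> (set es)\<^sup>*"
    using pick_path[OF o(1)] o(2) by (auto dest: rtrancl_trans)
qed

lemma into_nonzero: "e \<in> K \<Longrightarrow> into e \<noteq> 0"
  using K_rising rising_def by blast

lemma cedge_reach:
  assumes "E'' \<subseteq> cedge ` K" "(u, v) \<in> E''\<^sup>*"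
  shows "(u, v) \<in> (set es)\<^sup>*"
  using assms(2)
proof (induction rule: rtrancl_induct)
  case (step y z)
  then have "(y, z) \<in> (set es)\<^sup>*" using assms(1) anc(3) unfolding cedge_def by auto
  then show ?case using step by (meson rtrancl_trans)
qed simp

text \<open>The start of \<open>cedge e'\<close> reaches the tail of \<open>e'\<close> in the input
  graph. A source at that start can hence enter through \<open>e'\<close> as well, and ownership
  leaves only \<open>e\<close>.\<close>

lemma cedge_same:
  assumes "e \<in> K" "e' \<in> K" "into e' = into e" "R (owner e) (anc e')"
  shows "e' = e"
  using owner(3)[OF assms(1-3)] reach_trans assms(4) anc(2)[OF assms(2)] by blast

lemma inj_cedge: "inj_on cedge K"
proof
  fix e e' assume "e \<in> K" "e' \<in> K" "cedge e = cedge e'"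
  moreover from this have "into e' = into e" "anc e' = anc e"
    using into_nonzero[of e] into_nonzero[of e'] by (auto simp: cedge_def)
  ultimately show "e = e'" using cedge_same[of e e'] anc(1)[of e] by simp
qed

text \<open>The path is not empty, because the source has a lower level than the root of
  \<open>e\<close>. Its last edge is a contracted edge into that root whose start is reached by the
  owner, so it is \<open>cedge e\<close>; what precedes it is the path to
  \<open>anc e\<close>.\<close>

lemma cedge_unique:
  assumes E: "E'' \<subseteq> cedge ` K" and e: "e \<in> K" and path: "(ss ! owner e, into e - 1) \<in> E''\<^sup>*"
  shows "cedge e \<in> E''" "(ss ! owner e, anc e) \<in> E''\<^sup>*"
proof -
  let ?i = "owner e"
  note o = owner[OF e]
  have Ri: "R ?i (src e)" and lt: "lev (src e) < lev (into e - 1)"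
    using pick_edge[OF o(1)] o(2) lev_rt src_ends by auto
  have "lev (ss ! ?i) \<le> lev (src e)" using Ri level_mono by (auto simp: reach_def)
  then have "ss ! ?i \<noteq> into e - 1" using lt by auto
  then obtain y where y: "(ss ! ?i, y) \<in> E''\<^sup>*" "(y, into e - 1) \<in> E''"
    using path by (blast elim: rtranclE)
  obtain e' where e': "e' \<in> K" "y = anc e'" "into e - 1 = into e' - 1"
    using E y(2) unfolding cedge_def by auto
  have ie: "into e' = into e" using e'(3) into_nonzero[OF e] into_nonzero[OF e'(1)] by simp
  have "R ?i y" using cedge_reach[OF E y(1)] Ri by (auto simp: reach_def)
  then have "e' = e" using cedge_same e e' ie by blast
  then show "cedge e \<in> E''" "(ss ! ?i, anc e) \<in> E''\<^sup>*" using y e' by (auto simp: cedge_def)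
qed

lemma owned_edge:
  assumes "r \<in> owned i" "N i r \<noteq> 0"
  obtains e where "e \<in> K" "owner e = i" "into e = r" "N i r = 2" "pk i r = e"
  using assms owner unfolding owned_def by blast

text \<open>A preserver keeps only connections that its graph has, so the contracted graph must be
  shown to contain the paths that will force its edges.\<close>

lemma top_reach_cedge: "N i r \<noteq> 0 \<Longrightarrow> (ss ! i, top_node i r) \<in> (cedge ` K)\<^sup>*"
proof (induction "lev (r - 1)" arbitrary: r rule: less_induct)
  case less
  show ?case
  proof (cases "r \<in> owned i")
    case True
    then obtain e where e: "e \<in> K" "owner e = i" "into e = r" "N i r = 2" "pk i r = e"
      using owned_edge less.prems by blast
    have "(ss ! i, anc e) \<in> (cedge ` K)\<^sup>*"
      using less.hyps[OF pick_edge(5)[OF e(4)] N2(3)[OF e(4)]] e by (simp add: anc_def)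
    moreover have "(anc e, top_node i r) \<in> cedge ` K"
      using e top_owned[OF True] by (auto simp: cedge_def intro!: rev_image_eqI[of e])
    ultimately show ?thesis by simp
  next
    case False
    from less.prems show ?thesis
    proof (cases rule: N_cases)
      case 1
      then show ?thesis using top_stop by simp
    next
      case 2
      then show ?thesis using less.hyps[OF pick_edge(5)[OF 2] N2(3)[OF 2]] top_up[OF 2 False] by simp
    qed
  qed
qed

text \<open>The tops of all needed roots are reached inside \<open>E''\<close>, by induction from
  high levels to low ones. A root that is not demanded itself is the root of the tail of a chosen
  entry to a higher root. If that higher root is owned, uniqueness forces the path through the
  anchor of its edge, which is the lower top; otherwise the two tops coincide. Applied to owned
  roots, this forces every contracted edge.\<close>

lemma cedge_preserver:
  assumes E: "E'' \<subseteq> cedge ` K"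
    and Q: "\<And>i t. demand i t \<Longrightarrow> (ss ! i, top_node i (rt t)) \<in> E''\<^sup>*"
  shows "E'' = cedge ` K"
proof -
  have tops: "(ss ! i, top_node i r) \<in> E''\<^sup>*" if "N i r \<noteq> 0" for i r
    using that
  proof (induction "length ss - lev (r - 1)" arbitrary: r rule: less_induct)
    case less
    from N_origin[OF less.prems] show ?case
    proof (elim disjE exE conjE)
      fix t assume "demand i t" "r = rt t"
      then show ?thesis using Q by simp
    next
      fix r' assume r': "N i r' = 2" "r = rt (src (pk i r'))"
      have "lev (r - 1) < lev (r' - 1)" using pick_edge(5)[OF r'(1)] r'(2) by simp
      then have *: "(ss ! i, top_node i r') \<in> E''\<^sup>*"
        using less.hyps[of r'] r'(1) level_le[of es ss "r' - 1"] by simp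
      show ?thesis
      proof (cases "r' \<in> owned i")
        case True
        then obtain e where e: "e \<in> K" "owner e = i" "into e = r'" "pk i r' = e"
          using owned_edge r' by (metis zero_neq_numeral)
        have "(ss ! owner e, into e - 1) \<in> E''\<^sup>*" using * top_owned[OF True] e by simp
        then have "(ss ! i, anc e) \<in> E''\<^sup>*" using cedge_unique(2)[OF E e(1)] e(2) by simp
        then show ?thesis using e r' by (simp add: anc_def)
      next
        case False
        then show ?thesis using * top_up[OF r'(1) False] r' by simp
      qed
    qed
  qed
  have "cedge e \<in> E''" if e: "e \<in> K" for e
  proof -
    have "into e \<in> owned (owner e)" using e by (auto simp: owned_def)
    then have "top_node (owner e) (into e) = into e - 1" by (rule top_owned)
    then show ?thesis
      using cedge_unique(1)[OF E e] tops[of "owner e" "into e"] owner(1)[OF e] by simp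
  qed
  then show ?thesis using E by blast
qed

lemma reach_bounded:
  assumes "R i v"
  shows "v < n"
proof -
  have "(ss ! i, v) \<in> (set es)\<^sup>*" "ss ! i < n" "set es \<subseteq> {..<n} \<times> {..<n}"
    using assms input by (auto simp: rp_input_def rp_instance_def reach_def dest: nth_mem)
  then show ?thesis by (induction rule: rtrancl_induct) auto
qed

lemma card_K_le:
  fixes f :: "nat \<Rightarrow> nat \<Rightarrow> nat \<Rightarrow> real"
  assumes f: "\<And>(V :: nat set) E S P. rp_instance V E S P \<Longrightarrow>
    \<exists>E'. reach_preserver E P E' \<and> real (card E') \<le> f (card V) (card P) (card S)"
  shows "real (card K) \<le> f n (card P) (card (set ss))"
proof -
  let ?SV = "set ss \<times> {..<n}"
  define D where "D = {(i, t). demand i t}"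
  define Q where "Q = (\<lambda>(i, t). (ss ! i, top_node i (rt t))) ` D"
  have dist: "distinct ss" and PSV: "P \<subseteq> ?SV" and ssn: "set ss \<subseteq> {..<n}"
    using input by (auto simp: rp_input_def rp_instance_def)
  have finP: "finite P" using PSV finite_subset by blast
  have inj: "inj_on (\<lambda>(i, t). (ss ! i, t)) D"
    using dist by (auto simp: inj_on_def D_def demand_def reach_def nth_eq_iff_index_eq)
  have img: "(\<lambda>(i, t). (ss ! i, t)) ` D \<subseteq> P" by (auto simp: D_def demand_def)
  have finD: "finite D" using inj img finP finite_imageD finite_subset by metis
  have "card D \<le> card P" using card_inj_on_le[OF inj img finP] .
  then have cardQ: "card Q \<le> card P" unfolding Q_def using card_image_le[OF finD] order_trans by blast
  have "Q \<subseteq> ?SV"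
  proof -
    have "ss ! i \<in> set ss" "top_node i (rt t) < n" if "demand i t" for i t
      using that top_path[OF N_demand] reach_bounded by (auto simp: demand_def reach_def)
    then show ?thesis by (auto simp: Q_def D_def)
  qed
  moreover have "card P \<le> card ?SV" using PSV by (intro card_mono) auto
  \<comment> \<open>Contraction may identify several demands, and \<open>f\<close> need not be
    monotone; the pairs are therefore padded to exactly \<open>card P\<close>.\<close>
  ultimately obtain Q' where Q': "Q \<subseteq> Q'" "Q' \<subseteq> ?SV" "card Q' = card P"
    using exists_subset_between[OF cardQ, of ?SV] by auto
  have "cedge ` K \<subseteq> {..<n} \<times> {..<n}"
  proof -
    have "anc e < n" "into e - 1 < n" if "e \<in> K" for e
      using reach_bounded anc(1)[OF that] NR[of "owner e" "into e"] owner(1)[OF that] by auto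
    then show ?thesis by (auto simp: cedge_def)
  qed
  then have "rp_instance {..<n} (cedge ` K) (set ss) Q'"
    using ssn Q' by (auto simp: rp_instance_def)
  from f[OF this] obtain E'' where E'': "reach_preserver (cedge ` K) Q' E''"
    "real (card E'') \<le> f n (card P) (card (set ss))" using Q'(3) by auto
  have "E'' = cedge ` K"
  proof (rule cedge_preserver)
    show "E'' \<subseteq> cedge ` K" using E'' by (simp add: reach_preserver_def)
    show "(ss ! i, top_node i (rt t)) \<in> E''\<^sup>*" if "demand i t" for i t
    proof -
      have "(ss ! i, top_node i (rt t)) \<in> Q'" using that Q'(1) by (auto simp: Q_def D_def)
      then show ?thesis
        using E''(1) top_reach_cedge[OF N_demand[OF that]] by (auto simp: reach_preserver_def)
    qed
  qed
  then show ?thesis using E''(2) card_image[OF inj_cedge] by simp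
qed

end

text \<open>A directed path through all nodes loses its end-to-end connection with any edge. The
  other sources and pairs only adjust the parameters; \<open>p \<le> s * n\<close> leaves room for
  them. This bound pays for the forests.\<close>

lemma path_lower_bound:
  fixes f :: "nat \<Rightarrow> nat \<Rightarrow> nat \<Rightarrow> real"
  assumes f: "\<And>(V :: nat set) E S P. rp_instance V E S P \<Longrightarrow>
    \<exists>E'. reach_preserver E P E' \<and> real (card E') \<le> f (card V) (card P) (card S)"
    and s: "1 \<le> s" "s \<le> n" and p: "1 \<le> p" "p \<le> s * n"
  shows "real (n - 1) \<le> f n p s"
proof -
  define E where "E = (\<lambda>k. (k, Suc k)) ` {..<n - 1}"
  let ?SV = "{..<s} \<times> {..<n}"
  have n: "0 < n" using s by simp
  have "{(0, n - 1)} \<subseteq> ?SV" "card {(0, n - 1)} \<le> p" "p \<le> card ?SV" using s p n by auto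
  then obtain Q where Q: "{(0, n - 1)} \<subseteq> Q" "Q \<subseteq> ?SV" "card Q = p"
    using exists_subset_between[of "{(0, n - 1)}" p ?SV] by auto
  have "rp_instance {..<n} E {..<s} Q" using Q s by (auto simp: rp_instance_def E_def)
  from f[OF this] obtain E' where E': "reach_preserver E Q E'" "real (card E') \<le> f n p s"
    using Q by auto
  have "k \<le> n - 1 \<Longrightarrow> (0, k) \<in> E\<^sup>*" for k
  proof (induction k)
    case (Suc k)
    then show ?case by (auto simp: E_def intro: rtrancl_into_rtrancl)
  qed simp
  then have *: "(0, n - 1) \<in> E'\<^sup>*" and sub: "E' \<subseteq> E" using E'(1) Q(1) by (auto simp: reach_preserver_def)
  \<comment> \<open>Each edge raises the node by exactly one, so a path from 0 past \<open>k\<close>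
    uses the edge leaving \<open>k\<close>.\<close>
  have "(0, v) \<in> E'\<^sup>* \<Longrightarrow> k < v \<Longrightarrow> (k, Suc k) \<in> E'" for k v
  proof (induction rule: rtrancl_induct)
    case (step y z)
    then show ?case using sub by (cases "k = y") (auto simp: E_def)
  qed simp
  then have "E = E'" using * sub by (auto simp: E_def)
  moreover have "card E = n - 1" by (simp add: E_def card_image inj_on_def)
  ultimately show ?thesis using E'(2) by simp
qed

section \<open>Total correctness of RAM programs\<close>

text \<open>A point mass as the outcome expresses determinism, termination and correctness at once.
  Time is a field of the state, so \<open>Q\<close> can bound it too.\<close>

definition tot :: "nat \<Rightarrow> com \<Rightarrow> (ram \<Rightarrow> bool) \<Rightarrow> ram \<Rightarrow> bool" where
  "tot W c Q st \<longleftrightarrow> (\<exists>st'. exec W c st = return_spmf st' \<and> Q st')"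

lemma ram_simps [simp]:
  "regs (tick k st) = regs st" "arrs (tick k st) = arrs st" "time (tick k st) = time st + k"
  "regs (set_reg x v st) = (regs st)(x := v)" "arrs (set_reg x v st) = arrs st"
  "time (set_reg x v st) = time st"
  "regs (set_arr a i v st) = regs st" "arrs (set_arr a i v st) = (arrs st)(a := (arrs st a)(i := v))"
  "time (set_arr a i v st) = time st"
  by (simp_all add: tick_def set_reg_def set_arr_def)

lemma val_tick [simp]: "val W (tick k st) e = val W st e"
  by (induction e) auto

lemma val_bool [simp]:
  "1 < W \<Longrightarrow> val W st (Bin Less a b) = of_bool (val W st a < val W st b)"
  "1 < W \<Longrightarrow> val W st (Bin Equal a b) = of_bool (val W st a = val W st b)"
  by (auto simp: of_bool_def)

text \<open>Sequences are reassociated and their first command is executed, so rewriting runs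
  straight-line code symbolically and stops in front of a loop.\<close>

lemma tot_simps [simp]:
  "tot W Skip Q st \<longleftrightarrow> Q (tick 1 st)"
  "tot W (SetReg x e) Q st \<longleftrightarrow> Q (tick (1 + cost e) (set_reg x (val W st e) st))"
  "tot W (SetArr a i e) Q st \<longleftrightarrow> Q (tick (1 + cost i + cost e) (set_arr a (val W st i) (val W st e) st))"
  "tot W (If e c1 c2) Q st \<longleftrightarrow> (if val W st e \<noteq> 0 then tot W c1 Q (tick (1 + cost e) st)
     else tot W c2 Q (tick (1 + cost e) st))"
  "tot W (Seq Skip d) Q st \<longleftrightarrow> tot W d Q (tick 1 st)"
  "tot W (Seq (SetReg x e) d) Q st \<longleftrightarrow> tot W d Q (tick (1 + cost e) (set_reg x (val W st e) st))"
  "tot W (Seq (SetArr a i e) d) Q st \<longleftrightarrow>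
     tot W d Q (tick (1 + cost i + cost e) (set_arr a (val W st i) (val W st e) st))"
  "tot W (Seq (If e c1 c2) d) Q st \<longleftrightarrow> (if val W st e \<noteq> 0 then tot W (Seq c1 d) Q (tick (1 + cost e) st)
     else tot W (Seq c2 d) Q (tick (1 + cost e) st))"
  "tot W (Seq (Seq c1 c2) d) Q st \<longleftrightarrow> tot W (Seq c1 (Seq c2 d)) Q st"
proof -
  have "exec W (Seq a b) = (\<lambda>st. bind_spmf (exec W a st) (exec W b))" for a b
    by (rule ext) simp
  then show "tot W (Seq (Seq c1 c2) d) Q st \<longleftrightarrow> tot W (Seq c1 (Seq c2 d)) Q st"
    by (simp add: tot_def)
qed (simp_all add: tot_def)

lemma tot_Seq: "tot W c (tot W d Q) st \<Longrightarrow> tot W (Seq c d) Q st"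
  by (auto simp: tot_def)

lemma tot_conseq: "tot W c Q' st \<Longrightarrow> (\<And>st'. Q' st' \<Longrightarrow> Q st') \<Longrightarrow> tot W c Q st"
  by (auto simp: tot_def)

lemma tot_Seq_conseq: "tot W c Q' st \<Longrightarrow> (\<And>st'. Q' st' \<Longrightarrow> tot W d Q st') \<Longrightarrow> tot W (Seq c d) Q st"
  by (blast intro: tot_Seq tot_conseq)

text \<open>The index of \<open>I\<close> is the variant. \<open>I\<close> is asserted after the
  guard has been charged, which is where the semantics of the loop evaluates it.\<close>

lemma tot_While:
  fixes I :: "nat \<Rightarrow> ram \<Rightarrow> bool"
  assumes entry: "I k (tick (1 + cost e) st)"
    and step: "\<And>k st. I k st \<Longrightarrow> val W st e \<noteq> 0 \<Longrightarrow>
      tot W c (\<lambda>st'. \<exists>k'<k. I k' (tick (1 + cost e) st')) st"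
    and exit: "\<And>k st. I k st \<Longrightarrow> val W st e = 0 \<Longrightarrow> Q st"
  shows "tot W (While e c) Q st"
proof -
  let ?loop = "loop (\<lambda>st. val W st e \<noteq> 0) (\<lambda>st. map_spmf (tick (1 + cost e)) (exec W c st))"
  have "I k st \<Longrightarrow> \<exists>st'. ?loop st = return_spmf st' \<and> Q st'" for k st
  proof (induction k arbitrary: st rule: less_induct)
    case (less k)
    show ?case
    proof (cases "val W st e = 0")
      case True
      then show ?thesis using exit less.prems by (subst loop.simps) simp
    next
      case False
      then obtain st1 k' where "exec W c st = return_spmf st1" "k' < k" "I k' (tick (1 + cost e) st1)"
        using step[OF less.prems] by (auto simp: tot_def)
      then show ?thesis using less.IH False by (subst loop.simps) simp
    qed
  qed
  then show ?thesis using entry by (simp add: tot_def)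
qed

abbreviation (input) agree :: "'i set \<Rightarrow> ('i \<Rightarrow> 'v) \<Rightarrow> ('i \<Rightarrow> 'v) \<Rightarrow> bool" where
  "agree U g f \<equiv> \<forall>x. x \<notin> U \<longrightarrow> g x = f x"

abbreviation (input) agree_but :: "'i \<Rightarrow> ('i \<Rightarrow> 'v) \<Rightarrow> ('i \<Rightarrow> 'v) \<Rightarrow> bool" where
  "agree_but i g f \<equiv> \<forall>x. x \<noteq> i \<longrightarrow> g x = f x"

definition When :: "expr \<Rightarrow> com \<Rightarrow> com" where
  "When e c = If e c Skip"

definition For :: "nat \<Rightarrow> nat \<Rightarrow> com \<Rightarrow> com" where
  "For r b c = Seq (SetReg r (Num 0)) (While (Bin Less (Reg r) (Reg b))
     (Seq c (SetReg r (Bin Plus (Reg r) (Num 1)))))"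

lemma tot_When [simp]:
  "tot W (When e c) Q st \<longleftrightarrow> (if val W st e \<noteq> 0 then tot W c Q (tick (1 + cost e) st)
     else Q (tick (2 + cost e) st))"
  "tot W (Seq (When e c) d) Q st \<longleftrightarrow> (if val W st e \<noteq> 0 then tot W (Seq c d) Q (tick (1 + cost e) st)
     else tot W d Q (tick (2 + cost e) st))"
  by (simp_all add: When_def tick_def)

text \<open>\<open>\<Phi>\<close> is a potential that pays for bodies whose cost is only bounded in an amortized sense.\<close>

lemma tot_For_amortized:
  assumes J0: "J 0 (arrs st)" and b: "regs st b < W" "1 < W" "r \<in> U" "b \<notin> U"
    and step: "\<And>k st1. k < regs st b \<Longrightarrow> J k (arrs st1) \<Longrightarrow> regs st1 r = k \<Longrightarrow>
      (\<And>x. x \<notin> U \<Longrightarrow> regs st1 x = regs st x) \<Longrightarrow>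
      tot W c (\<lambda>st'. J (Suc k) (arrs st') \<and> regs st' r = k \<and> agree U (regs st') (regs st) \<and>
        time st' + \<Phi> (arrs st1) \<le> time st1 + B k + \<Phi> (arrs st')) st1"
    and fin: "\<And>st'. J (regs st b) (arrs st') \<Longrightarrow> (\<And>x. x \<notin> U \<Longrightarrow> regs st' x = regs st x) \<Longrightarrow>
      time st' + \<Phi> (arrs st) \<le> time st + 6 + (\<Sum>k<regs st b. B k + 8) + \<Phi> (arrs st') \<Longrightarrow> Q st'"
  shows "tot W (For r b c) Q st"
proof -
  let ?N = "regs st b"
  \<comment> \<open>The 6 is the initial assignment (2) and the first guard (4); the 8 per iteration
    is the increment (4) and the next guard (4).\<close>
  define I where "I d st' \<longleftrightarrow> (\<exists>k. d = ?N - k \<and> k \<le> ?N \<and> regs st' r = k \<and> J k (arrs st') \<and>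
    agree U (regs st') (regs st) \<and>
    time st' + \<Phi> (arrs st) \<le> time st + 6 + (\<Sum>j<k. B j + 8) + \<Phi> (arrs st'))" for d and st' :: ram
  have "b \<noteq> r" using b by auto
  show ?thesis unfolding For_def tot_simps
  proof (rule tot_While[where I = I])
    show "I ?N (tick (1 + cost (Bin Less (Reg r) (Reg b))) (tick (1 + cost (Num 0)) (set_reg r (val W st (Num 0)) st)))"
      unfolding I_def using J0 b by (auto intro!: exI[of _ 0])
  next
    fix d and st1 :: ram
    assume "I d st1" and g: "val W st1 (Bin Less (Reg r) (Reg b)) \<noteq> 0"
    then obtain k where k: "d = ?N - k" "regs st1 r = k" "J k (arrs st1)"
      and fr: "\<And>x. x \<notin> U \<Longrightarrow> regs st1 x = regs st x"
      and t: "time st1 + \<Phi> (arrs st) \<le> time st + 6 + (\<Sum>j<k. B j + 8) + \<Phi> (arrs st1)"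
      unfolding I_def by auto
    have kN: "k < ?N" using g k fr[OF b(4)] b(2) by simp
    show "tot W (Seq c (SetReg r (Bin Plus (Reg r) (Num 1))))
        (\<lambda>st'. \<exists>k'<d. I k' (tick (1 + cost (Bin Less (Reg r) (Reg b))) st')) st1"
    proof (rule tot_Seq_conseq[OF step[OF kN k(3,2) fr]], assumption)
      fix st2 :: ram
      assume s2: "J (Suc k) (arrs st2) \<and> regs st2 r = k \<and> agree U (regs st2) (regs st) \<and>
        time st2 + \<Phi> (arrs st1) \<le> time st1 + B k + \<Phi> (arrs st2)"
      have "(k + 1) mod W = Suc k" using kN b by simp
      then show "tot W (SetReg r (Bin Plus (Reg r) (Num 1)))
        (\<lambda>st'. \<exists>k'<d. I k' (tick (1 + cost (Bin Less (Reg r) (Reg b))) st')) st2"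
        using s2 kN k(1) t b by (auto simp: I_def intro!: exI[of _ "?N - Suc k"] exI[of _ "Suc k"])
    qed
  next
    fix d and st1 :: ram
    assume I: "I d st1" and g: "val W st1 (Bin Less (Reg r) (Reg b)) = 0"
    then obtain k where "k \<le> ?N" "regs st1 r = k" "regs st1 b = ?N" unfolding I_def using b by auto
    then have "k = ?N" using g b(2) by simp
    then show "Q st1" using I \<open>regs st1 r = k\<close> unfolding I_def by (intro fin) auto
  qed
qed

lemma tot_For:
  assumes J0: "J 0 (arrs st)" and b: "regs st b < W" "1 < W" "r \<in> U" "b \<notin> U"
    and step: "\<And>k st1. k < regs st b \<Longrightarrow> J k (arrs st1) \<Longrightarrow> regs st1 r = k \<Longrightarrow>
      (\<And>x. x \<notin> U \<Longrightarrow> regs st1 x = regs st x) \<Longrightarrow>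
      tot W c (\<lambda>st'. J (Suc k) (arrs st') \<and> regs st' r = k \<and> agree U (regs st') (regs st) \<and>
        time st' \<le> time st1 + B) st1"
    and fin: "\<And>st'. J (regs st b) (arrs st') \<Longrightarrow> (\<And>x. x \<notin> U \<Longrightarrow> regs st' x = regs st x) \<Longrightarrow>
      time st' \<le> time st + 6 + regs st b * (B + 8) \<Longrightarrow> Q st'"
  shows "tot W (For r b c) Q st"
  by (rule tot_For_amortized[where J = J and U = U and B = "\<lambda>_. B" and \<Phi> = "\<lambda>_. 0"])
    (use assms in auto)

text \<open>A linked list in arrays: 0 ends it and \<open>Suc e\<close> points to the edge
  \<open>e\<close>, so memory filled with 0 represents empty lists.\<close>

fun chain :: "(nat \<Rightarrow> nat) \<Rightarrow> nat \<Rightarrow> nat list \<Rightarrow> bool" where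
  "chain nxt h [] \<longleftrightarrow> h = 0"
| "chain nxt h (e # es) \<longleftrightarrow> h = Suc e \<and> chain nxt (nxt e) es"

lemma chain_cong: "(\<And>e. e \<in> set es \<Longrightarrow> nxt' e = nxt e) \<Longrightarrow> chain nxt' h es \<longleftrightarrow> chain nxt h es"
  by (induction nxt h es rule: chain.induct) auto

section \<open>Graph search\<close>

text \<open>
  Graph search from the node in register 12 along the edges whose ends have equal keys. Newly
  reached nodes \<open>w\<close> are marked in cell \<open>regs 10 + w\<close> with the value of register 11; array 12 is
  the stack. Adjacency lists are chained through \<open>first\<close> and \<open>nxt\<close>, with edge numbers shifted by one.
\<close>

definition Visit :: "nat \<Rightarrow> nat \<Rightarrow> nat \<Rightarrow> nat \<Rightarrow> nat \<Rightarrow> com" where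
  "Visit nxt dst key mark out =
     Seq (SetReg 16 (Bin Minus (Reg 15) (Num 1)))
    (Seq (SetReg 17 (Arr dst (Reg 16)))
    (Seq (When (Bin Equal (Arr key (Reg 14)) (Arr key (Reg 17)))
           (When (Bin Equal (Arr mark (Bin Plus (Reg 10) (Reg 17))) (Num 0))
             (Seq (SetArr mark (Bin Plus (Reg 10) (Reg 17)) (Reg 11))
             (Seq (SetArr out (Reg 16) (Num 1))
             (Seq (SetArr 12 (Reg 13) (Reg 17))
                  (SetReg 13 (Bin Plus (Reg 13) (Num 1))))))))
         (SetReg 15 (Arr nxt (Reg 16)))))"

definition Search :: "nat \<Rightarrow> nat \<Rightarrow> nat \<Rightarrow> nat \<Rightarrow> nat \<Rightarrow> nat \<Rightarrow> com" where
  "Search first nxt dst key mark out =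
     Seq (SetArr mark (Bin Plus (Reg 10) (Reg 12)) (Reg 11))
    (Seq (SetArr 12 (Num 0) (Reg 12))
    (Seq (SetReg 13 (Num 1))
    (While (Reg 13)
      (Seq (SetReg 13 (Bin Minus (Reg 13) (Num 1)))
      (Seq (SetReg 14 (Arr 12 (Reg 13)))
      (Seq (SetReg 15 (Arr first (Reg 14)))
           (While (Reg 15) (Visit nxt dst key mark out))))))))"

text \<open>\<open>sr\<close> and \<open>ds\<close> are the ends of an edge in the direction of the
  search, so forward and backward searches share one proof. \<open>b\<close> is the row offset in
  the mark array, \<open>v\<close> the mark and \<open>x\<close> the start.\<close>

locale search =
  fixes W n m :: nat and first nxt dst key mark out :: nat
    and A0 :: "nat \<Rightarrow> nat \<Rightarrow> nat" and sr ds :: "nat \<Rightarrow> nat" and adj :: "nat \<Rightarrow> nat list"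
    and b v x :: nat
  assumes dist: "distinct [first, nxt, dst, key, mark, out, 12]"
    and chains: "\<And>u. u < n \<Longrightarrow> chain (A0 nxt) (A0 first u) (adj u)"
    and adj: "\<And>u e. u < n \<Longrightarrow> e \<in> set (adj u) \<longleftrightarrow> e < m \<and> sr e = u"
    and ds: "\<And>e. e < m \<Longrightarrow> A0 dst e = ds e \<and> ds e < n"
    and W: "b + n \<le> W" "m < W" "1 < W" "n < W"
    and v: "v \<noteq> 0" and x: "x < n" "A0 mark (b + x) = 0"
begin

text \<open>Nodes marked before the search act as walls: it neither enters nor rescans them.\<close>

definition M0 :: "nat set" where "M0 = {w. w < n \<and> A0 mark (b + w) \<noteq> 0}"

definition same :: "nat \<Rightarrow> bool" where "same e \<longleftrightarrow> A0 key (sr e) = A0 key (ds e)"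

abbreviation deg :: "nat set \<Rightarrow> nat" where "deg X \<equiv> (\<Sum>u\<in>X. length (adj u))"

text \<open>\<open>X\<close> holds the nodes found, \<open>Y\<close> the stack and \<open>D\<close>
  the edges through which nodes were found. \<open>D\<close> is a tree rooted at \<open>x\<close>,
  of which only the paths from \<open>x\<close> and the edge count are recorded.\<close>

definition visited :: "nat set \<Rightarrow> nat set \<Rightarrow> nat list \<Rightarrow> ram \<Rightarrow> bool" where
  "visited X D Y st \<longleftrightarrow>
     x \<in> X \<and> X \<subseteq> {..<n} \<and> X \<inter> M0 = {} \<and> D \<subseteq> {e. e < m \<and> same e} \<and> card D < card X \<and>
     (\<forall>w\<in>X. (x, w) \<in> ((\<lambda>e. (sr e, ds e)) ` D)\<^sup>*) \<and>
     set Y \<subseteq> X \<and> distinct Y \<and> regs st 13 = length Y \<and> (\<forall>i<length Y. arrs st 12 i = Y ! i) \<and>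
     arrs st mark = (\<lambda>j. if j \<in> (+) b ` X then v else A0 mark j) \<and>
     arrs st out = (\<lambda>e. if e \<in> D then 1 else A0 out e) \<and>
     (\<forall>a. a \<notin> {12, mark, out} \<longrightarrow> arrs st a = A0 a) \<and> regs st 10 = b \<and> regs st 11 = v"

definition settled :: "nat set \<Rightarrow> nat set \<Rightarrow> bool" where
  "settled X Z \<longleftrightarrow> (\<forall>u\<in>Z. \<forall>e. e < m \<longrightarrow> sr e = u \<longrightarrow> same e \<longrightarrow> ds e \<in> X \<union> M0)"

lemma visited_finite: "visited X D Y st \<Longrightarrow> finite X \<and> finite D \<and> length Y \<le> card X \<and> card X \<le> n"
proof -
  assume v: "visited X D Y st"
  then have X: "X \<subseteq> {..<n}" and D: "D \<subseteq> {..<m}" and Y: "set Y \<subseteq> X" "distinct Y"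
    unfolding visited_def by auto
  have fX: "finite X" using X finite_subset by blast
  moreover have "card X \<le> n" using card_mono[OF _ X] by simp
  moreover have "length Y \<le> card X" using card_mono[OF fX Y(1)] distinct_card[OF Y(2)] by simp
  moreover have "finite D" using D finite_subset by blast
  ultimately show ?thesis by blast
qed

lemma visited_tick [simp]: "visited X D Y (tick k st) \<longleftrightarrow> visited X D Y st"
  by (simp add: visited_def)

text \<open>A new node enters \<open>X\<close> and the stack together, so the set
  \<open>X - set Y\<close> of popped nodes stays as it is. The branch that finds a new node costs
  exactly 38.\<close>

lemma tot_Visit:
  assumes vis: "visited X D Y st" and u: "u < n" "u \<in> X" "u \<notin> set Y" "regs st 14 = u"
    and e: "regs st 15 = Suc e" "e < m" "sr e = u"
  shows "tot W (Visit nxt dst key mark out) (\<lambda>st'. \<exists>X' D' Y'. visited X' D' Y' st' \<and>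
    X' - set Y' = X - set Y \<and> X \<subseteq> X' \<and> (same e \<longrightarrow> ds e \<in> X' \<union> M0) \<and>
    agree {13..17} (regs st') (regs st) \<and> regs st' 14 = u \<and>
    regs st' 15 = A0 nxt e \<and> time st' \<le> time st + 38) st"
proof -
  let ?w = "ds e"
  have w: "?w < n" "A0 dst e = ?w" using ds e by auto
  have d: "first \<noteq> nxt" "first \<noteq> dst" "mark \<noteq> 12" "out \<noteq> 12" "mark \<noteq> out" "dst \<noteq> 12" "dst \<noteq> mark"
    "dst \<noteq> out" "key \<noteq> 12" "key \<noteq> mark" "key \<noteq> out" "nxt \<noteq> 12" "nxt \<noteq> mark" "nxt \<noteq> out"
    using dist by auto
  have arr: "arrs st dst = A0 dst" "arrs st key = A0 key" "arrs st nxt = A0 nxt"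
    "arrs st mark = (\<lambda>j. if j \<in> (+) b ` X then v else A0 mark j)"
    "arrs st out = (\<lambda>e. if e \<in> D then 1 else A0 out e)"
    and reg: "regs st 10 = b" "regs st 11 = v" "regs st 13 = length Y"
    using vis d unfolding visited_def by auto
  note fin = visited_finite[OF vis]
  have mods: "e mod W = e" "(b + ?w) mod W = b + ?w" "Suc (length Y) mod W = Suc (length Y)" if "card X < n"
    using that fin w(1) W e(2) by auto
  have m1: "e mod W = e" "(b + ?w) mod W = b + ?w" using w(1) W e(2) by auto
  have bw: "b + ?w \<in> (+) b ` X \<longleftrightarrow> ?w \<in> X" by auto
  show ?thesis
  proof (cases "same e \<and> ?w \<notin> X \<union> M0")
    case False
    have no: "\<not> (same e \<and> arrs st mark (b + ?w) = 0)"
      using False v w(1) by (auto simp: arr bw M0_def)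
    have "tot W (Visit nxt dst key mark out) (\<lambda>st'. visited X D Y st' \<and>
      agree {13..17} (regs st') (regs st) \<and> regs st' 14 = u \<and>
      regs st' 15 = A0 nxt e \<and> time st' \<le> time st + 38) st"
      using no vis W(3) unfolding Visit_def same_def
      by (simp add: e u m1 w arr(1-3) reg) (auto simp: visited_def)
    then show ?thesis using False by (elim tot_conseq) blast
  next
    case True
    have X': "insert ?w X \<subseteq> {..<n}" "?w \<notin> X" using True w vis by (auto simp: visited_def)
    have "card (insert ?w X) \<le> n" using card_mono[OF _ X'(1)] by simp
    then have cX: "card X < n" using X' fin by simp
    have yes: "A0 key u = A0 key ?w" "arrs st mark (b + ?w) = 0"
      using True w(1) e by (auto simp: arr bw M0_def same_def)
    let ?X = "insert ?w X" and ?D = "insert e D" and ?Y = "Y @ [?w]"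
    have path: "\<forall>y\<in>?X. (x, y) \<in> ((\<lambda>e. (sr e, ds e)) ` ?D)\<^sup>*"
    proof -
      have "(x, y) \<in> ((\<lambda>e. (sr e, ds e)) ` ?D)\<^sup>*" if "y \<in> X" for y
      proof -
        have "(x, y) \<in> ((\<lambda>e. (sr e, ds e)) ` D)\<^sup>*" using vis that by (auto simp: visited_def)
        then show ?thesis by (rule rtrancl_mono[THEN subsetD, rotated]) auto
      qed
      moreover from this[OF u(2)] have "(x, ?w) \<in> ((\<lambda>e. (sr e, ds e)) ` ?D)\<^sup>*"
        by (rule rtrancl_into_rtrancl) (use e in auto)
      ultimately show ?thesis by blast
    qed
    have sets: "x \<in> ?X \<and> ?X \<subseteq> {..<n} \<and> ?X \<inter> M0 = {} \<and> ?D \<subseteq> {e. e < m \<and> same e} \<and> card ?D < card ?X \<and>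
      set ?Y \<subseteq> ?X \<and> distinct ?Y \<and> ?X - set ?Y = X - set Y"
    proof -
      have "x \<in> ?X" "?X \<inter> M0 = {}" "?D \<subseteq> {e. e < m \<and> same e}" "set ?Y \<subseteq> ?X" "distinct ?Y"
        "?X - set ?Y = X - set Y" and DX: "card D < card X"
        using vis True X'(2) e(2) unfolding visited_def by auto
      moreover have "card ?D < card ?X"
        using DX X'(2) fin by (simp add: card_insert_if)
      ultimately show ?thesis using X'(1) by blast
    qed
    have "tot W (Visit nxt dst key mark out) (\<lambda>st'.
      regs st' = (regs st)(16 := e, 17 := ?w, 13 := Suc (length Y), 15 := A0 nxt e) \<and>
      arrs st' = (arrs st)(mark := (arrs st mark)(b + ?w := v), out := (arrs st out)(e := 1),
        12 := (arrs st 12)(length Y := ?w)) \<and> time st' \<le> time st + 38) st"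
      using yes W(3) d unfolding Visit_def by (simp add: e u mods[OF cX] w arr(1-3) reg)
    then show ?thesis
    proof (rule tot_conseq)
      fix st' :: ram
      assume r: "regs st' = (regs st)(16 := e, 17 := ?w, 13 := Suc (length Y), 15 := A0 nxt e) \<and>
        arrs st' = (arrs st)(mark := (arrs st mark)(b + ?w := v), out := (arrs st out)(e := 1),
          12 := (arrs st 12)(length Y := ?w)) \<and> time st' \<le> time st + 38"
      have regs': "regs st' 13 = length ?Y" "regs st' 10 = b" "regs st' 11 = v"
        using r reg by auto
      have st: "\<forall>i<length ?Y. arrs st' 12 i = ?Y ! i"
        using r vis by (auto simp: visited_def nth_append)
      have mk: "arrs st' mark = (\<lambda>j. if j \<in> (+) b ` ?X then v else A0 mark j)"
        using r d arr(4) by (auto simp: fun_eq_iff)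
      have ou: "arrs st' out = (\<lambda>f. if f \<in> ?D then 1 else A0 out f)"
        using r d arr(5) by (auto simp: fun_eq_iff)
      have fr: "\<forall>a. a \<notin> {12, mark, out} \<longrightarrow> arrs st' a = A0 a"
        using r vis by (auto simp: visited_def)
      have "visited ?X ?D ?Y st'"
        unfolding visited_def using sets path regs' st mk ou fr by blast
      then show "\<exists>X' D' Y'. visited X' D' Y' st' \<and>
        X' - set Y' = X - set Y \<and> X \<subseteq> X' \<and> (same e \<longrightarrow> ds e \<in> X' \<union> M0) \<and>
        agree {13..17} (regs st') (regs st) \<and> regs st' 14 = u \<and>
        regs st' 15 = A0 nxt e \<and> time st' \<le> time st + 38"
        using sets r u(4) by (intro exI[of _ ?X] exI[of _ ?D] exI[of _ ?Y]) auto
    qed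
  qed
qed

lemma settled_mono: "settled X Z \<Longrightarrow> X \<subseteq> X' \<Longrightarrow> settled X' Z"
  unfolding settled_def by blast

text \<open>\<open>u\<close> has been popped but its edges are still unscanned, hence its exclusion
  from the settled set at the start. Each edge costs 38 for the visit and 2 for the guard.\<close>

lemma tot_scan:
  assumes vis: "visited X D Y st" and u: "u < n" "u \<in> X" "u \<notin> set Y" "regs st 14 = u"
    and h: "regs st 15 = A0 first u" and Z: "settled X (X - set Y - {u})"
  shows "tot W (While (Reg 15) (Visit nxt dst key mark out)) (\<lambda>st'. \<exists>X' D' Y'. visited X' D' Y' st' \<and>
    X' - set Y' = X - set Y \<and> settled X' (X' - set Y') \<and>
    agree {13..17} (regs st') (regs st) \<and> time st' \<le> time st + 2 + 40 * length (adj u)) st"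
proof -
  define I where "I k st' \<longleftrightarrow> (\<exists>X' D' Y' pre l. adj u = pre @ l \<and> k = length l \<and> visited X' D' Y' st' \<and>
    chain (A0 nxt) (regs st' 15) l \<and> X \<subseteq> X' \<and>
    X' - set Y' = X - set Y \<and> (\<forall>e\<in>set pre. same e \<longrightarrow> ds e \<in> X' \<union> M0) \<and>
    agree {13..17} (regs st') (regs st) \<and> regs st' 14 = u \<and>
    time st' \<le> time st + 2 + 40 * length pre)" for k and st' :: ram
  show ?thesis
  proof (rule tot_While[where I = I])
    show "I (length (adj u)) (tick (1 + cost (Reg 15)) st)"
      unfolding I_def using vis u(4) h chains[OF u(1)]
      by (intro exI[of _ X] exI[of _ D] exI[of _ Y] exI[of _ "[]"] exI[of _ "adj u"]) simp
  next
    fix k and st1 :: ram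
    assume "I k st1" and g: "val W st1 (Reg 15) \<noteq> 0"
    then obtain X1 D1 Y1 pre l where I: "adj u = pre @ l" "k = length l" "visited X1 D1 Y1 st1"
      "chain (A0 nxt) (regs st1 15) l" "X \<subseteq> X1"
      "X1 - set Y1 = X - set Y" "\<forall>e\<in>set pre. same e \<longrightarrow> ds e \<in> X1 \<union> M0"
      "agree {13..17} (regs st1) (regs st)" "regs st1 14 = u"
      "time st1 \<le> time st + 2 + 40 * length pre" unfolding I_def by blast
    obtain e l' where l: "l = e # l'" "regs st1 15 = Suc e" "chain (A0 nxt) (A0 nxt e) l'"
      using I(4) g by (cases l) auto
    have e: "e < m" "sr e = u" using adj[OF u(1), of e] I(1) l(1) by auto
    have u1: "u \<in> X1" "u \<notin> set Y1" using I(5,6) u by blast+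
    show "tot W (Visit nxt dst key mark out) (\<lambda>st'. \<exists>k'<k. I k' (tick (1 + cost (Reg 15)) st')) st1"
    proof (rule tot_conseq[OF tot_Visit[OF I(3) u(1) u1 I(9) l(2) e]], elim exE conjE)
      fix X2 D2 Y2 and st2 :: ram
      assume s: "visited X2 D2 Y2 st2" "X2 - set Y2 = X1 - set Y1" "X1 \<subseteq> X2"
        "same e \<longrightarrow> ds e \<in> X2 \<union> M0" "agree {13..17} (regs st2) (regs st1)"
        "regs st2 14 = u" "regs st2 15 = A0 nxt e" "time st2 \<le> time st1 + 38"
      have "I (length l') (tick (1 + cost (Reg 15)) st2)"
        unfolding I_def
      proof (intro exI conjI)
        show "adj u = (pre @ [e]) @ l'" using I(1) l(1) by simp
        show "visited X2 D2 Y2 (tick (1 + cost (Reg 15)) st2)" using s(1) by simp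
        show "X \<subseteq> X2" using I(5) s(3) by blast
        show "X2 - set Y2 = X - set Y" using I(6) s(2) by simp
        show "\<forall>f\<in>set (pre @ [e]). same f \<longrightarrow> ds f \<in> X2 \<union> M0" using I(7) s(3,4) by auto
        show "\<forall>r. r \<notin> {13..17} \<longrightarrow> regs (tick (1 + cost (Reg 15)) st2) r = regs st r"
          using I(8) s(5) by simp
      qed (use s(6-8) I(10) l(3) in simp_all)
      then show "\<exists>k'<k. I k' (tick (1 + cost (Reg 15)) st2)" using I(2) l(1) by (intro exI[of _ "length l'"]) simp
    qed
  next
    fix k and st1 :: ram
    assume "I k st1" and g: "val W st1 (Reg 15) = 0"
    then obtain X1 D1 Y1 pre l where I: "adj u = pre @ l" "visited X1 D1 Y1 st1"
      "chain (A0 nxt) (regs st1 15) l" "X \<subseteq> X1"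
      "X1 - set Y1 = X - set Y" "\<forall>e\<in>set pre. same e \<longrightarrow> ds e \<in> X1 \<union> M0"
      "agree {13..17} (regs st1) (regs st)"
      "time st1 \<le> time st + 2 + 40 * length pre" unfolding I_def by blast
    have "pre = adj u" using I(1,3) g by (cases l) auto
    then have "settled X1 {u}" using I(6) adj[OF u(1)] by (auto simp: settled_def)
    moreover have "settled X1 (X - set Y - {u})" using settled_mono[OF Z I(4)] .
    ultimately have "settled X1 (X1 - set Y1)" unfolding I(5) settled_def by blast
    then show "\<exists>X' D' Y'. visited X' D' Y' st1 \<and>
      X' - set Y' = X - set Y \<and> settled X' (X' - set Y') \<and>
      agree {13..17} (regs st1) (regs st) \<and> time st1 \<le> time st + 2 + 40 * length (adj u)"
      using I \<open>pre = adj u\<close> by blast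
  qed
qed

text \<open>The start costs 12, a popped node 14 including the first guard of its list and the next
  outer guard, and an edge 40.\<close>

definition found :: "nat set \<Rightarrow> nat set \<Rightarrow> ram \<Rightarrow> ram \<Rightarrow> bool" where
  "found X D st st' \<longleftrightarrow>
    x \<in> X \<and> X \<subseteq> {..<n} \<and> X \<inter> M0 = {} \<and> D \<subseteq> {e. e < m \<and> same e} \<and> card D < card X \<and>
    (\<forall>w\<in>X. (x, w) \<in> ((\<lambda>e. (sr e, ds e)) ` D)\<^sup>*) \<and> settled X X \<and>
    arrs st' mark = (\<lambda>j. if j \<in> (+) b ` X then v else A0 mark j) \<and>
    arrs st' out = (\<lambda>e. if e \<in> D then 1 else A0 out e) \<and>
    (\<forall>a. a \<notin> {12, mark, out} \<longrightarrow> arrs st' a = A0 a) \<and>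
    agree {13..17} (regs st') (regs st) \<and>
    time st' \<le> time st + 12 + 14 * card X + 40 * deg X"

lemma tot_Search:
  assumes A0: "arrs st = A0" and reg: "regs st 10 = b" "regs st 11 = v" "regs st 12 = x"
  shows "tot W (Search first nxt dst key mark out) (\<lambda>st'. \<exists>X D. found X D st st') st"
proof -
  \<comment> \<open>The variant counts the nodes not popped so far; it decreases because no node is
    pushed twice.\<close>
  define I where "I k st' \<longleftrightarrow> (\<exists>X D Y. k = n - card (X - set Y) \<and> visited X D Y st' \<and>
    settled X (X - set Y) \<and> agree {13..17} (regs st') (regs st) \<and>
    time st' \<le> time st + 12 + 14 * card (X - set Y) + 40 * deg (X - set Y))" for k and st' :: ram
  have d: "mark \<noteq> 12" "out \<noteq> 12" "mark \<noteq> out" "first \<noteq> 12" "first \<noteq> mark" "first \<noteq> out" using dist by auto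
  have m0: "(b + x) mod W = b + x" "1 mod W = 1" using W x by auto
  have five: "(5::nat) = Suc (Suc (Suc (Suc (Suc 0))))" by simp
  have sc: "tot W (Search first nxt dst key mark out) Q st \<longleftrightarrow>
    tot W (While (Reg 13) (Seq (SetReg 13 (Bin Minus (Reg 13) (Num 1)))
      (Seq (SetReg 14 (Arr 12 (Reg 13)))
      (Seq (SetReg 15 (Arr first (Reg 14)))
           (While (Reg 15) (Visit nxt dst key mark out)))))) Q
      (tick 2 (set_reg 13 1 (tick 3 (set_arr 12 0 x (tick 5 (set_arr mark (b + x) v st))))))" for Q
    using m0 W unfolding Search_def by (simp add: reg numeral_2_eq_2 numeral_3_eq_3 five)
  show ?thesis unfolding sc
  proof (rule tot_While[where I = I])
    let ?st = "tick (1 + cost (Reg 13)) (tick 2 (set_reg 13 1 (tick 3 (set_arr 12 0 x (tick 5 (set_arr mark (b + x) v st))))))"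
    have "visited {x} {} [x] ?st"
      unfolding visited_def using x d A0 reg by (auto simp: M0_def fun_eq_iff)
    then show "I n ?st" unfolding I_def
      by (intro exI[of _ "{x}"] exI[of _ "{}"] exI[of _ "[x]"]) (auto simp: settled_def)
  next
    fix k and st1 :: ram
    assume "I k st1" and g: "val W st1 (Reg 13) \<noteq> 0"
    then obtain X D Y where I: "k = n - card (X - set Y)" "visited X D Y st1" "settled X (X - set Y)"
      "agree {13..17} (regs st1) (regs st)"
      "time st1 \<le> time st + 12 + 14 * card (X - set Y) + 40 * deg (X - set Y)" unfolding I_def by blast
    note fin = visited_finite[OF I(2)]
    have r13: "regs st1 13 = length Y" using I(2) by (simp add: visited_def)
    then obtain Z u where Y: "Y = Z @ [u]" using g by (cases Y rule: rev_cases) auto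
    have u: "u \<in> X" "u \<notin> set Z" "u < n" "set Z \<subseteq> X" "distinct Z" using I(2) Y by (auto simp: visited_def)
    have lt: "(length Y - 1) mod W = length Z" "arrs st1 12 (length Z) = u" "arrs st1 first = A0 first"
      using fin W Y I(2) d by (auto simp: visited_def nth_append)
    let ?st2 = "tick 3 (set_reg 15 (A0 first u) (tick 3 (set_reg 14 u (tick 4 (set_reg 13 (length Z) st1)))))"
    have vis2: "visited X D Z ?st2" using I(2) unfolding visited_def Y by (auto simp: nth_append)
    have XZ: "X - set Z = insert u (X - set Y)" "u \<notin> X - set Y" using u Y by auto
    have s2: "settled X (X - set Z - {u})" using I(3) XZ by (metis Diff_insert_absorb)
    have cardXZ: "card (X - set Z) = Suc (card (X - set Y))" "deg (X - set Z) = length (adj u) + deg (X - set Y)"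
      unfolding XZ(1) using XZ(2) fin by simp_all
    have "card (X - set Z) \<le> n" using fin card_mono[of X "X - set Z"] by auto
    then have kdec: "n - card (X - set Z) < k" using I(1) cardXZ by simp
    have step: "tot W (While (Reg 15) (Visit nxt dst key mark out))
      (\<lambda>st'. \<exists>k'<k. I k' (tick (1 + cost (Reg 13)) st')) ?st2"
    proof (rule tot_conseq[OF tot_scan[OF vis2 u(3,1,2)]])
      show "regs ?st2 14 = u" "regs ?st2 15 = A0 first u" by simp_all
      show "settled X (X - set Z - {u})" by (rule s2)
      fix st3 :: ram
      assume "\<exists>X' D' Y'. visited X' D' Y' st3 \<and> X' - set Y' = X - set Z \<and> settled X' (X' - set Y') \<and>
        agree {13..17} (regs st3) (regs ?st2) \<and> time st3 \<le> time ?st2 + 2 + 40 * length (adj u)"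
      then obtain X' D' Y' where s: "visited X' D' Y' st3" "X' - set Y' = X - set Z" "settled X' (X' - set Y')"
        "agree {13..17} (regs st3) (regs ?st2)" "time st3 \<le> time ?st2 + 2 + 40 * length (adj u)"
        by blast
      have "I (n - card (X - set Z)) (tick (1 + cost (Reg 13)) st3)"
        unfolding I_def
      proof (intro exI conjI)
        show "visited X' D' Y' (tick (1 + cost (Reg 13)) st3)" using s(1) by simp
        show "settled X' (X' - set Y')" using s(3) .
        show "\<forall>r. r \<notin> {13..17} \<longrightarrow> regs (tick (1 + cost (Reg 13)) st3) r = regs st r"
          using s(4) I(4) by auto
      qed (use s(2,5) I(5) cardXZ in auto)
      then show "\<exists>k'<k. I k' (tick (1 + cost (Reg 13)) st3)" using kdec by blast
    qed
    show "tot W (Seq (SetReg 13 (Bin Minus (Reg 13) (Num 1)))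
      (Seq (SetReg 14 (Arr 12 (Reg 13)))
      (Seq (SetReg 15 (Arr first (Reg 14)))
           (While (Reg 15) (Visit nxt dst key mark out)))))
      (\<lambda>st'. \<exists>k'<k. I k' (tick (1 + cost (Reg 13)) st')) st1"
      using step by (simp add: m0 lt r13 del: One_nat_def)
  next
    fix k and st1 :: ram
    assume "I k st1" and g: "val W st1 (Reg 13) = 0"
    then obtain X D Y where I: "visited X D Y st1" "settled X (X - set Y)"
      "agree {13..17} (regs st1) (regs st)"
      "time st1 \<le> time st + 12 + 14 * card (X - set Y) + 40 * deg (X - set Y)" unfolding I_def by blast
    have "Y = []" using I(1) g by (simp add: visited_def)
    then show "\<exists>X D. found X D st st1"
      using I unfolding visited_def found_def by (intro exI[of _ X] exI[of _ D]) auto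
  qed
qed

end

section \<open>Reachability and levels\<close>

text \<open>
  Use of the arrays: 4 output; 5 and 6 adjacency lists of the outgoing edges, 7 and 8 of the incoming
  ones; 9 constantly \<open>0\<close>; 10 reachability table; 11 levels; 12 stack; 13 marks of the search for the
  candidates stored in 14 (their number is in cell 0); 15 labels \<open>rt\<close>; 16 labels \<open>cp\<close>; 17 last
  covering edges, shifted by one; 18 the greedy state \<open>N\<close>; 19 ignored output; 20 all edge ends; 21 a flag.
  The row-major tables 17 and 18 are addressed with shifted labels, so row \<open>i\<close> occupies the cells
  \<open>i * n + 1, ..., i * n + n\<close>.
\<close>

abbreviation (input) cell :: "nat \<Rightarrow> nat \<Rightarrow> expr" where
  "cell i v \<equiv> Bin Plus (Bin Times (Reg i) (Reg 0)) (Reg v)"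

abbreviation (input) inputs :: "ram \<Rightarrow> ram \<Rightarrow> bool" where
  "inputs st' st \<equiv> \<forall>x<4. regs st' x = regs st x"

abbreviation (input) build_step :: com where
  "build_step \<equiv> Seq (SetReg 6 (Arr 0 (Reg 4)))
    (Seq (SetReg 7 (Arr 1 (Reg 4)))
    (Seq (SetReg 8 (Bin Plus (Reg 4) (Num 1)))
    (Seq (SetArr 20 (Reg 4) (Reg 6))
    (Seq (SetArr 20 (Bin Plus (Reg 1) (Reg 4)) (Reg 7))
    (Seq (SetArr 6 (Reg 4) (Arr 5 (Reg 6)))
    (Seq (SetArr 5 (Reg 6) (Reg 8))
    (Seq (SetArr 8 (Reg 4) (Arr 7 (Reg 7)))
         (SetArr 7 (Reg 7) (Reg 8)))))))))"

definition Build :: com where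
  "Build = For 4 1 build_step"

abbreviation (input) reach_step :: com where
  "reach_step \<equiv> Seq (SetReg 10 (Bin Times (Reg 4) (Reg 0)))
    (Seq (SetReg 11 (Num 1))
    (Seq (SetReg 12 (Arr 2 (Reg 4)))
         (Search 5 6 1 9 10 19)))"

definition Reach :: com where
  "Reach = For 4 2 reach_step"

abbreviation (input) level_add :: com where
  "level_add \<equiv> SetArr 11 (Reg 6) (Bin Plus (Arr 11 (Reg 6)) (Arr 10 (cell 5 6)))"

abbreviation (input) level_step :: com where
  "level_step \<equiv> Seq (SetReg 6 (Arr 20 (Reg 4)))
    (Seq (SetArr 11 (Reg 6) (Num 0))
         (For 5 2 level_add))"

definition Levels :: com where
  "Levels = Seq (SetReg 20 (Bin Plus (Reg 1) (Reg 1))) (For 4 20 level_step)"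

text \<open>The bound on \<open>W\<close> is \<open>4 * (n + 2) ^ 2\<close> expanded. It leaves room
  for the cells of the \<open>n\<close> by \<open>n\<close> tables and for numbers up to
  \<open>2 * m + 1\<close>.\<close>

locale rp_run =
  fixes n :: nat and es :: "(nat \<times> nat) list" and ss :: "nat list" and P :: "(nat \<times> nat) set" and W :: nat
  assumes input: "rp_input n es ss P" and n2: "2 \<le> n" and W: "4 * n * n + 16 * n + 16 \<le> W"
begin

abbreviation "m \<equiv> length es"
abbreviation "s \<equiv> length ss"
abbreviation "src e \<equiv> fst (es ! e)"
abbreviation "dst e \<equiv> snd (es ! e)"
abbreviation "R \<equiv> reach es ss"
abbreviation "lev \<equiv> level es ss"

text \<open>Reversed, because edges are inserted at the heads of the lists.\<close>

definition outs :: "nat \<Rightarrow> nat list" where "outs u = rev (filter (\<lambda>e. src e = u) [0..<m])"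
definition ins :: "nat \<Rightarrow> nat list" where "ins u = rev (filter (\<lambda>e. dst e = u) [0..<m])"

lemma edge_bound: "e < m \<Longrightarrow> src e < n" "e < m \<Longrightarrow> dst e < n"
proof -
  have "set es \<subseteq> {..<n} \<times> {..<n}" using input by (simp add: rp_input_def rp_instance_def)
  then have "e < m \<Longrightarrow> es ! e \<in> {..<n} \<times> {..<n}" using nth_mem by blast
  then show "e < m \<Longrightarrow> src e < n" "e < m \<Longrightarrow> dst e < n" by (auto simp: mem_Times_iff)
qed

lemma ss_bound: "i < s \<Longrightarrow> ss ! i < n"
  using input nth_mem by (fastforce simp: rp_input_def rp_instance_def)

lemma s_le: "s \<le> n"
proof -
  have "card (set ss) \<le> card {..<n}"
    using input by (intro card_mono) (auto simp: rp_input_def rp_instance_def)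
  then show ?thesis using input distinct_card[of ss] by (simp add: rp_input_def)
qed

lemma m_le: "m \<le> n * n"
proof -
  have "card (set es) \<le> card ({..<n} \<times> {..<n})"
    using input by (intro card_mono) (auto simp: rp_input_def rp_instance_def)
  then show ?thesis using input distinct_card[of es] by (simp add: rp_input_def)
qed

lemma small: "1 < W" "2 < W" "n < W" "n + n < W" "s < W" "m < W" "m + m < W" "Suc (m + m) < W"
  using W s_le m_le by auto

lemma cell_less: "u < n \<Longrightarrow> v \<le> n \<Longrightarrow> u * n + v < W"
proof -
  assume "u < n" "v \<le> n"
  then have "u * n \<le> n * n" by simp
  then show "u * n + v < W" using W \<open>v \<le> n\<close> by linarith
qed

lemma cell_mod [simp]: "u < n \<Longrightarrow> v \<le> n \<Longrightarrow> (u * n + v) mod W = u * n + v" "u < n \<Longrightarrow> u * n mod W = u * n"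
  "i < s \<Longrightarrow> v \<le> n \<Longrightarrow> (i * n + v) mod W = i * n + v" "i < s \<Longrightarrow> i * n mod W = i * n"
  using cell_less[of u v] cell_less[of u 0] cell_less[of i v] cell_less[of i 0] s_le by auto

lemma cell_inj:
  assumes "u * n + v = u' * n + v'" "v < n" "v' < n"
  shows "u = u' \<and> v = v'"
proof -
  have "(u * n + v) div n = u" "(u' * n + v') div n = u'" using assms(2,3) by auto
  then show ?thesis using assms(1) by auto
qed

lemma cell_eq [simp]:
  "v < n \<Longrightarrow> v' < n \<Longrightarrow> u * n + v = u' * n + v' \<longleftrightarrow> u = u' \<and> v = v'"
  using cell_inj by blast

lemma cell_eq_shift [simp]:
  assumes "0 < r" "r \<le> n" "0 < r'" "r' \<le> n"
  shows "u * n + r = u' * n + r' \<longleftrightarrow> u = u' \<and> r = r'"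
  using cell_eq[of "r - 1" "r' - 1" u u'] assms by auto

lemma ends_bound: "v \<in> ends es \<Longrightarrow> v < n"
  using input by (auto simp: ends_def rp_input_def rp_instance_def)

definition env :: "ram \<Rightarrow> bool" where
  "env st \<longleftrightarrow> regs st 0 = n \<and> regs st 1 = m \<and> regs st 2 = s"

lemma envD: "env st \<Longrightarrow> regs st 0 = n" "env st \<Longrightarrow> regs st 1 = m" "env st \<Longrightarrow> regs st 2 = s"
  by (auto simp: env_def)

definition loaded :: "(nat \<Rightarrow> nat \<Rightarrow> nat) \<Rightarrow> bool" where
  "loaded A \<longleftrightarrow> (\<forall>e<m. A 0 e = src e \<and> A 1 e = dst e) \<and> (\<forall>i<s. A 2 i = ss ! i) \<and>
    (\<forall>u<n. \<forall>v<n. A 3 (u * n + v) = of_bool ((u, v) \<in> P))"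

text \<open>Both ends of all edges as one sequence of length \<open>2 * m\<close>. Going through it
  meets every non-isolated node in \<open>O(m)\<close> steps.\<close>

definition node :: "nat \<Rightarrow> nat" where "node j = (if j < m then src j else dst (j - m))"

definition linked :: "(nat \<Rightarrow> nat \<Rightarrow> nat) \<Rightarrow> bool" where
  "linked A \<longleftrightarrow> (\<forall>u<n. chain (A 6) (A 5 u) (outs u)) \<and> (\<forall>u<n. chain (A 8) (A 7 u) (ins u)) \<and>
    (\<forall>j<m + m. A 20 j = node j)"

lemma node_ends: "j < m + m \<Longrightarrow> node j \<in> ends es"
  by (auto simp: node_def ends_def)

lemma ends_node: "v \<in> ends es \<Longrightarrow> \<exists>j<m + m. node j = v"
proof -
  assume "v \<in> ends es"
  then obtain e where "e < m" "v = src e \<or> v = dst e" by (auto simp: ends_def in_set_conv_nth)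
  then show ?thesis
    by (elim disjE) (simp_all add: node_def exI[of _ e] exI[of _ "m + e"])
qed

lemma tot_Build:
  assumes "env st" "loaded (arrs st)" and zero: "arrs st 5 = (\<lambda>_. 0)" "arrs st 7 = (\<lambda>_. 0)"
  shows "tot W Build (\<lambda>st'. linked (arrs st') \<and> agree {5, 6, 7, 8, 20} (arrs st') (arrs st) \<and>
    inputs st' st \<and> time st' \<le> time st + 6 + 50 * m) st"
    (is "tot _ _ ?Post _")
proof -
  define J where "J k A \<longleftrightarrow>
    (\<forall>u. chain (A 6) (A 5 u) (rev (filter (\<lambda>e. src e = u) [0..<k]))) \<and>
    (\<forall>u. chain (A 8) (A 7 u) (rev (filter (\<lambda>e. dst e = u) [0..<k]))) \<and>
    (\<forall>e<k. A 20 e = src e \<and> A 20 (m + e) = dst e) \<and>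
    agree {5, 6, 7, 8, 20} A (arrs st)" for k and A :: "nat \<Rightarrow> nat \<Rightarrow> nat"
  note env = envD[OF assms(1)]
  show ?thesis unfolding Build_def
  proof (rule tot_For[where J = J and U = "{4..19}" and B = 42])
    show "J 0 (arrs st)" using zero by (simp add: J_def)
    fix k and st1 :: ram
    assume k: "k < regs st 1" and J: "J k (arrs st1)" and r4: "regs st1 4 = k"
      and fr: "\<And>x. x \<notin> {4..19} \<Longrightarrow> regs st1 x = regs st x"
    have km: "k < m" using k env by simp
    have in01: "arrs st1 0 k = src k" "arrs st1 1 k = dst k"
      using J assms km by (auto simp: J_def loaded_def)
    have r1: "regs st1 1 = m" using fr env by simp
    have mods: "(k + 1) mod W = Suc k" "(m + k) mod W = m + k" using km small by auto
    have "J (Suc k) ((arrs st1)(20 := (arrs st1 20)(k := src k, m + k := dst k),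
       6 := (arrs st1 6)(k := arrs st1 5 (src k)), 5 := (arrs st1 5)(src k := Suc k),
       8 := (arrs st1 8)(k := arrs st1 7 (dst k)), 7 := (arrs st1 7)(dst k := Suc k)))"
      (is "J _ ?A")
      unfolding J_def
    proof (intro conjI allI impI)
      fix u
      have c: "chain (arrs st1 6) h l \<Longrightarrow> set l \<subseteq> {..<k} \<Longrightarrow> chain ((arrs st1 6)(k := z)) h l"
        "chain (arrs st1 8) h l \<Longrightarrow> set l \<subseteq> {..<k} \<Longrightarrow> chain ((arrs st1 8)(k := z)) h l" for h l z
        by (subst chain_cong[where nxt = "arrs st1 6"], auto)
          (subst chain_cong[where nxt = "arrs st1 8"], auto)
      show "chain (?A 6) (?A 5 u) (rev (filter (\<lambda>e. src e = u) [0..<Suc k]))"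
        "chain (?A 8) (?A 7 u) (rev (filter (\<lambda>e. dst e = u) [0..<Suc k]))"
        using J by (auto simp: J_def intro!: c)
    next
      fix e assume "e < Suc k"
      then show "?A 20 e = src e" "?A 20 (m + e) = dst e" using J km by (auto simp: J_def less_Suc_eq)
    next
      fix a :: nat assume "a \<notin> {5, 6, 7, 8, 20}"
      then show "?A a = arrs st a" using J by (simp add: J_def)
    qed
    then show "tot W build_step
       (\<lambda>st'. J (Suc k) (arrs st') \<and> regs st' 4 = k \<and> agree {4..19} (regs st') (regs st) \<and>
        time st' \<le> time st1 + 42) st1"
      using fr by (simp add: r4 r1 in01 mods small env del: One_nat_def)
  next
    fix st' :: ram
    assume J: "J (regs st 1) (arrs st')" and fr: "\<And>x. x \<notin> {4..19} \<Longrightarrow> regs st' x = regs st x"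
      and t: "time st' \<le> time st + 6 + regs st 1 * (42 + 8)"
    have "linked (arrs st')" unfolding linked_def outs_def ins_def
    proof (intro conjI allI impI)
      have "e < m \<Longrightarrow> arrs st' 20 e = src e \<and> arrs st' 20 (m + e) = dst e" for e
        using J env by (simp add: J_def)
      then show "arrs st' 20 j = node j" if "j < m + m" for j
        using that by (cases "j < m") (auto simp: node_def dest: meta_spec[of _ "j - m"])
    qed (use J env in \<open>auto simp: J_def\<close>)
    then show "?Post st'"
      using J fr t env by (simp add: J_def)
  qed (use env small in auto)
qed

lemma adj_mem: "e \<in> set (outs u) \<longleftrightarrow> e < m \<and> src e = u" "e \<in> set (ins u) \<longleftrightarrow> e < m \<and> dst e = u"
  by (auto simp: outs_def ins_def)

lemma deg_le: "finite X \<Longrightarrow> (\<Sum>u\<in>X. length (outs u)) \<le> m" "finite X \<Longrightarrow> (\<Sum>u\<in>X. length (ins u)) \<le> m"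
proof -
  have d: "distinct (outs u)" "distinct (ins u)" for u by (auto simp: outs_def ins_def)
  assume X: "finite X"
  have "(\<Sum>u\<in>X. length (outs u)) = card (\<Union>u\<in>X. set (outs u))"
    by (subst card_UN_disjoint) (use X adj_mem d in \<open>auto simp: distinct_card\<close>)
  also have "\<dots> \<le> card {..<m}" by (rule card_mono) (auto simp: adj_mem)
  finally show "(\<Sum>u\<in>X. length (outs u)) \<le> m" by simp
  have "(\<Sum>u\<in>X. length (ins u)) = card (\<Union>u\<in>X. set (ins u))"
    by (subst card_UN_disjoint) (use X adj_mem d in \<open>auto simp: distinct_card\<close>)
  also have "\<dots> \<le> card {..<m}" by (rule card_mono) (auto simp: adj_mem)
  finally show "(\<Sum>u\<in>X. length (ins u)) \<le> m" by simp
qed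

section \<open>The reachability table\<close>

definition reached :: "(nat \<Rightarrow> nat \<Rightarrow> nat) \<Rightarrow> bool" where
  "reached A \<longleftrightarrow> (\<forall>i<s. \<forall>v<n. A 10 (i * n + v) = of_bool (R i v))"

lemma edges_image: "(\<lambda>e. (src e, dst e)) ` {e. e < m} = set es"
  by (auto simp: set_conv_nth image_iff)

lemma search_forward:
  assumes "loaded A" "linked A" "distinct [5, 6, 1, key, mark, out, 12::nat]"
    "b + n \<le> W" "v \<noteq> 0" "x < n" "A mark (b + x) = 0"
  shows "search W n m 5 6 1 key mark out A src dst outs b v x"
  using assms small by unfold_locales (auto simp: linked_def loaded_def adj_mem edge_bound)

lemma search_backward:
  assumes "loaded A" "linked A" "distinct [7, 8, 0, key, mark, out, 12::nat]"
    "b + n \<le> W" "v \<noteq> 0" "x < n" "A mark (b + x) = 0"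
  shows "search W n m 7 8 0 key mark out A dst src ins b v x"
  using assms small by unfold_locales (auto simp: linked_def loaded_def adj_mem edge_bound)

text \<open>Array 9 is constantly 0, so the key test always succeeds and all edges are used; row
  \<open>k\<close> is still empty, so no wall stops the search from source \<open>k\<close>.\<close>

lemma tot_Reach:
  assumes "env st" and ld: "loaded (arrs st)" and lk: "linked (arrs st)"
    and zero: "arrs st 9 = (\<lambda>_. 0)" "arrs st 10 = (\<lambda>_. 0)"
  shows "tot W Reach (\<lambda>st'. reached (arrs st') \<and> agree {10, 12, 19} (arrs st') (arrs st) \<and>
    inputs st' st \<and> time st' \<le> time st + 6 + s * (50 + 54 * m)) st"
    (is "tot _ _ ?Post _")
proof -
  define J where "J k A \<longleftrightarrow>
    (\<forall>i<s. \<forall>v<n. A 10 (i * n + v) = of_bool (i < k \<and> R i v)) \<and>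
    (agree {10, 12, 19} A (arrs st))" for k and A :: "nat \<Rightarrow> nat \<Rightarrow> nat"
  note env = envD[OF assms(1)]
  show ?thesis unfolding Reach_def
  proof (rule tot_For[where J = J and U = "{4..19}" and B = "42 + 54 * m"])
    show "J 0 (arrs st)" using zero by (simp add: J_def)
    fix k and st1 :: ram
    assume k: "k < regs st 2" and J: "J k (arrs st1)" and r4: "regs st1 4 = k"
      and fr: "\<And>x. x \<notin> {4..19} \<Longrightarrow> regs st1 x = regs st x"
    have ks: "k < s" and kn: "k < n" using k env s_le by auto
    have ld1: "loaded (arrs st1)" and lk1: "linked (arrs st1)"
      using J ld lk by (auto simp: J_def loaded_def linked_def)
    have key: "arrs st1 9 = (\<lambda>_. 0)" using J zero by (simp add: J_def)
    have r0: "regs st1 0 = n" using fr env by simp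
    let ?x = "ss ! k"
    have x: "?x < n" "arrs st1 2 k = ?x" using ss_bound ks ld1 by (auto simp: loaded_def)
    have unm: "arrs st1 10 (k * n + w) = 0" if "w < n" for w
      using J that ks by (simp add: J_def)
    have "k * n + n \<le> W" using cell_less[OF kn, of n] by simp
    then interpret S: search W n m 5 6 1 9 10 19 "arrs st1" src dst outs "k * n" 1 ?x
      using ld1 lk1 x unm by (intro search_forward) auto
    have noM: "S.M0 = {}" using unm by (auto simp: S.M0_def)
    have same: "S.same e" for e using key by (simp add: S.same_def)
    have fin: "J (Suc k) (arrs st') \<and> time st' \<le> time st1 + (42 + 54 * m)"
      if X: "?x \<in> X" "X \<subseteq> {..<n}" "D \<subseteq> {e. e < m \<and> S.same e}"
        "\<forall>w\<in>X. (?x, w) \<in> ((\<lambda>e. (src e, dst e)) ` D)\<^sup>*" "S.settled X X"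
        and mk: "arrs st' 10 = (\<lambda>j. if j \<in> (+) (k * n) ` X then 1 else arrs st1 10 j)"
        and ar: "agree {12, 10, 19} (arrs st') (arrs st1)"
        and t: "time st' \<le> time st1 + 9 + 12 + 14 * card X + 40 * S.deg X" for X D and st' :: ram
    proof -
      have D: "(\<lambda>e. (src e, dst e)) ` D \<subseteq> set es" using X(3) edges_image by auto
      have "R k w" if "w \<in> X" for w
        using X(4) that rtrancl_mono[OF D] ks by (auto simp: reach_def)
      moreover have "w \<in> X" if "R k w" for w
      proof -
        have "(?x, w) \<in> (set es)\<^sup>*" using that by (simp add: reach_def)
        then show ?thesis
        proof (induction rule: rtrancl_induct)
          case (step y z)
          obtain e where "e < m" "es ! e = (y, z)" using step(2) by (auto simp: in_set_conv_nth)
          moreover from this have "src e = y" "dst e = z" by simp_all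
          ultimately show ?case using X(5) step(3) same noM unfolding S.settled_def by blast
        qed (use X in simp)
      qed
      ultimately have XR: "X = {w. R k w}" by blast
      have "J (Suc k) (arrs st')"
        unfolding J_def
      proof (intro conjI allI impI)
        fix i v assume iv: "i < s" "v < n"
        have "i * n + v \<in> (+) (k * n) ` X \<longleftrightarrow> i = k \<and> v \<in> X"
          using X(2) iv by (auto simp: image_iff)
        then show "arrs st' 10 (i * n + v) = of_bool (i < Suc k \<and> R i v)"
          using J iv XR unfolding mk by (auto simp: J_def less_Suc_eq)
      qed (use J ar in \<open>auto simp: J_def\<close>)
      \<comment> \<open>All nodes found except the start are heads of edges, so the cost is bounded
        in \<open>m\<close> instead of \<open>n\<close>.\<close>
      moreover have subX: "X \<subseteq> insert ?x (dst ` {..<m})"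
      proof
        fix w assume "w \<in> X"
        then have "(?x, w) \<in> (set es)\<^sup>*" using XR by (simp add: reach_def)
        then show "w \<in> insert ?x (dst ` {..<m})"
          by (cases rule: rtranclE) (auto simp: in_set_conv_nth image_iff, metis snd_conv lessThan_iff)
      qed
      have "card X \<le> Suc m"
        using card_mono[OF _ subX] card_insert_le_m1[of "Suc m" "dst ` {..<m}" ?x]
          card_image_le[of "{..<m}" dst] by simp
      moreover have "S.deg X \<le> m" using deg_le(1) X(2) finite_subset by blast
      ultimately show ?thesis using t by simp
    qed
    have step: "tot W (Search 5 6 1 9 10 19) (\<lambda>st'. J (Suc k) (arrs st') \<and> regs st' 4 = k \<and>
       agree {4..19} (regs st') (regs st) \<and> time st' \<le> time st1 + (42 + 54 * m)) st2"
      if s2: "arrs st2 = arrs st1" "regs st2 10 = k * n" "regs st2 11 = 1" "regs st2 12 = ?x"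
        "regs st2 4 = k" "agree {4..19} (regs st2) (regs st)" "time st2 \<le> time st1 + 9" for st2
    proof (rule tot_conseq[OF S.tot_Search[OF s2(1-4)]])
      fix st' :: ram
      assume "\<exists>X D. S.found X D st2 st'"
      then obtain X D where f: "S.found X D st2 st'" by blast
      have "J (Suc k) (arrs st') \<and> time st' \<le> time st1 + (42 + 54 * m)"
      proof (rule fin[of X D])
        show "time st' \<le> time st1 + 9 + 12 + 14 * card X + 40 * S.deg X"
          using f s2(7) unfolding S.found_def by linarith
      qed (use f[unfolded S.found_def] in blast)+
      moreover have "regs st' 4 = k" "agree {4..19} (regs st') (regs st)"
        using f[unfolded S.found_def] s2 by auto
      ultimately show "J (Suc k) (arrs st') \<and> regs st' 4 = k \<and>
       agree {4..19} (regs st') (regs st) \<and> time st' \<le> time st1 + (42 + 54 * m)" by blast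
    qed
    show "tot W reach_step
     (\<lambda>st'. J (Suc k) (arrs st') \<and> regs st' 4 = k \<and> agree {4..19} (regs st') (regs st) \<and>
       time st' \<le> time st1 + (42 + 54 * m)) st1"
      unfolding tot_simps by (rule step) (use ks small r4 r0 x fr in simp_all)
  next
    fix st' :: ram
    assume J: "J (regs st 2) (arrs st')" and fr: "\<And>x. x \<notin> {4..19} \<Longrightarrow> regs st' x = regs st x"
      and t: "time st' \<le> time st + 6 + regs st 2 * (42 + 54 * m + 8)"
    then show "?Post st'"
      using env by (simp add: J_def reached_def algebra_simps)
  qed (use env small in auto)
qed

section \<open>Levels of the edge ends\<close>

definition leveled :: "(nat \<Rightarrow> nat \<Rightarrow> nat) \<Rightarrow> bool" where
  "leveled A \<longleftrightarrow> (\<forall>v\<in>ends es. A 11 v = lev v)"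

text \<open>A node occurring several times among the edge ends is recomputed each time; clearing its
  cell first prevents counting sources twice.\<close>

lemma tot_Levels:
  assumes "env st" and lk: "linked (arrs st)" and rd: "reached (arrs st)"
  shows "tot W Levels (\<lambda>st'. leveled (arrs st') \<and> (agree_but 11 (arrs st') (arrs st)) \<and>
    inputs st' st \<and> time st' \<le> time st + 10 + (m + m) * (20 + 20 * s)) st"
    (is "tot _ _ ?Post _")
proof -
  define J where "J k A \<longleftrightarrow> (\<forall>j<k. A 11 (node j) = lev (node j)) \<and>
    (agree_but 11 A (arrs st))" for k and A :: "nat \<Rightarrow> nat \<Rightarrow> nat"
  note env = envD[OF assms(1)]
  have loop: "tot W (For 4 20 level_step)
    ?Post st0"
    if s0: "arrs st0 = arrs st" "regs st0 = (regs st)(20 := m + m)" "time st0 = time st + 4" for st0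
  proof (rule tot_For[where J = J and U = "{4..19}" and B = "12 + 20 * s"])
    show "J 0 (arrs st0)" using s0 by (simp add: J_def)
    fix k and st1 :: ram
    assume k: "k < regs st0 20" and J: "J k (arrs st1)" and r4: "regs st1 4 = k"
      and fr: "\<And>x. x \<notin> {4..19} \<Longrightarrow> regs st1 x = regs st0 x"
    let ?v = "node k"
    have km: "k < m + m" using k s0 by simp
    have v: "arrs st1 20 k = ?v" "?v < n" using J lk km ends_bound node_ends by (auto simp: J_def linked_def)
    have A10: "arrs st1 10 (i * n + ?v) = of_bool (R i ?v)" if "i < s" for i
      using J rd v that by (auto simp: J_def reached_def)
    have inner: "tot W (For 5 2 level_add)
      (\<lambda>st'. J (Suc k) (arrs st') \<and> regs st' 4 = k \<and> agree {4..19} (regs st') (regs st0) \<and>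
        time st' \<le> time st1 + (12 + 20 * s)) st2"
      if s2: "arrs st2 = (arrs st1)(11 := (arrs st1 11)(?v := 0))" "regs st2 6 = ?v" "regs st2 4 = k"
        "agree {4..19} (regs st2) (regs st0)" "time st2 \<le> time st1 + 6" for st2
    proof (rule tot_For[where U = "{5}" and B = 12 and
          J = "\<lambda>i A. A = (arrs st1)(11 := (arrs st1 11)(?v := card {j. j < i \<and> R j ?v}))"])
      show "arrs st2 = (arrs st1)(11 := (arrs st1 11)(?v := card {j. j < 0 \<and> R j ?v}))"
        using s2 by simp
      show "regs st2 2 < W" using s2 env small s0 by simp
      fix i and st3 :: ram
      assume i: "i < regs st2 2" and A3: "arrs st3 = (arrs st1)(11 := (arrs st1 11)(?v := card {j. j < i \<and> R j ?v}))"
        and r5: "regs st3 5 = i" and fr3: "\<And>x. x \<notin> {5} \<Longrightarrow> regs st3 x = regs st2 x"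
      have il: "i < s" using i s2 env s0 by simp
      have r: "regs st3 0 = n" "regs st3 6 = ?v" using fr3 s2 env s0 by simp_all
      have "{j. j < Suc i \<and> R j ?v} = (if R i ?v then insert i {j. j < i \<and> R j ?v} else {j. j < i \<and> R j ?v})"
        by (auto simp: less_Suc_eq)
      then have c: "card {j. j < Suc i \<and> R j ?v} = card {j. j < i \<and> R j ?v} + of_bool (R i ?v)"
        by auto
      have "card {j. j < Suc i \<and> R j ?v} \<le> card {..<Suc i}" by (intro card_mono) auto
      then have "card {j. j < Suc i \<and> R j ?v} < W" using il small by simp
      then have "(card {j. j < i \<and> R j ?v} + of_bool (R i ?v)) mod W = card {j. j < Suc i \<and> R j ?v}"
        using c by simp
      then show "tot W level_add
        (\<lambda>st'. arrs st' = (arrs st1)(11 := (arrs st1 11)(?v := card {j. j < Suc i \<and> R j ?v})) \<and>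
          regs st' 5 = i \<and> agree {5} (regs st') (regs st2) \<and> time st' \<le> time st3 + 12) st3"
        using fr3 il v(2) by (simp add: r r5 A3 A10 less_imp_le)
    next
      fix st' :: ram
      assume A: "arrs st' = (arrs st1)(11 := (arrs st1 11)(?v := card {j. j < regs st2 2 \<and> R j ?v}))"
        and fr3: "\<And>x. x \<notin> {5} \<Longrightarrow> regs st' x = regs st2 x"
        and t: "time st' \<le> time st2 + 6 + regs st2 2 * (12 + 8)"
      have s2s: "regs st2 2 = s" using s2 env s0 by simp
      have "{j. j < s \<and> R j ?v} = {j. R j ?v}" by (auto simp: reach_def)
      then have "J (Suc k) (arrs st')" using J A s2s by (auto simp: J_def level_def less_Suc_eq)
      then show "J (Suc k) (arrs st') \<and> regs st' 4 = k \<and> agree {4..19} (regs st') (regs st0) \<and>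
        time st' \<le> time st1 + (12 + 20 * s)"
        using fr3 s2 t s2s by auto
    qed (use small in auto)
    show "tot W level_step
      (\<lambda>st'. J (Suc k) (arrs st') \<and> regs st' 4 = k \<and> agree {4..19} (regs st') (regs st0) \<and>
        time st' \<le> time st1 + (12 + 20 * s)) st1"
      unfolding tot_simps by (rule inner) (use fr r4 v in simp_all)
  next
    fix st' :: ram
    assume J: "J (regs st0 20) (arrs st')" and fr: "\<And>x. x \<notin> {4..19} \<Longrightarrow> regs st' x = regs st0 x"
      and t: "time st' \<le> time st0 + 6 + regs st0 20 * (12 + 20 * s + 8)"
    have "leveled (arrs st')" using J ends_node s0 by (force simp: J_def leveled_def)
    then show "?Post st'"
      using J fr t s0 by (simp add: J_def algebra_simps)
  qed (use small s0 in auto)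
  show ?thesis unfolding Levels_def tot_simps by (rule loop) (use small env in simp_all)
qed

end

section \<open>Roots of the flat graph\<close>

text \<open>
  No candidate reaches a later one. Going through the candidates backwards, one that has not been
  reached yet therefore lies in an initial strongly connected component of the flat graph, and the
  backward search from it finds exactly this component.
\<close>

abbreviation (input) cand_step :: com where
  "cand_step \<equiv> Seq (SetReg 12 (Arr 20 (Reg 4)))
        (When (Bin Equal (Arr 13 (Reg 12)) (Num 0))
          (Seq (SetArr 14 (Num 0) (Bin Plus (Arr 14 (Num 0)) (Num 1)))
          (Seq (SetArr 14 (Arr 14 (Num 0)) (Reg 12))
               (Search 5 6 1 11 13 19))))"

definition Cands :: com where
  "Cands = Seq (SetReg 20 (Bin Plus (Reg 1) (Reg 1)))
    (Seq (SetReg 10 (Num 0)) (Seq (SetReg 11 (Num 1)) (For 4 20 cand_step)))"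

abbreviation (input) root_step :: com where
  "root_step \<equiv> Seq (SetReg 12 (Arr 14 (Bin Minus (Reg 21) (Reg 4))))
      (When (Bin Equal (Arr 15 (Reg 12)) (Num 0))
        (Seq (SetReg 11 (Bin Plus (Reg 12) (Num 1)))
        (Seq (Search 5 6 1 11 15 4)
             (Search 7 8 0 11 16 4))))"

definition Roots :: com where
  "Roots = Seq (SetReg 10 (Num 0)) (Seq (SetReg 21 (Arr 14 (Num 0))) (For 4 21 root_step))"

context rp_run
begin

abbreviation "Flat \<equiv> flat es ss"

definition marked :: "(nat \<Rightarrow> nat) \<Rightarrow> nat set" where "marked a = {w. w < n \<and> a w \<noteq> 0}"

lemma finite_marked [simp]: "finite (marked a)"
  by (auto simp: marked_def)

lemma marked_update: "X \<subseteq> {..<n} \<Longrightarrow> v \<noteq> 0 \<Longrightarrow> marked (\<lambda>j. if j \<in> X then v else a j) = marked a \<union> X"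
  by (auto simp: marked_def)

definition closed :: "nat set \<Rightarrow> bool" where
  "closed X \<longleftrightarrow> (\<forall>a b. (a, b) \<in> Flat \<longrightarrow> a \<in> X \<longrightarrow> b \<in> X)"

lemma closed_path: "closed X \<Longrightarrow> (a, b) \<in> Flat\<^sup>* \<Longrightarrow> a \<in> X \<Longrightarrow> b \<in> X"
  by (erule rtrancl_induct) (auto simp: closed_def)

lemma Flat_edge: "(a, b) \<in> Flat \<longleftrightarrow> (\<exists>e<m. es ! e \<in> Flat \<and> src e = a \<and> dst e = b)"
proof
  assume ab: "(a, b) \<in> Flat"
  then obtain e where "e < m" "es ! e = (a, b)" by (auto simp: flat_def in_set_conv_nth)
  then show "\<exists>e<m. es ! e \<in> Flat \<and> src e = a \<and> dst e = b" using ab by auto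
qed (metis prod.collapse)

lemma Flat_index: "e < m \<Longrightarrow> es ! e \<in> Flat \<longleftrightarrow> lev (src e) = lev (dst e)"
  using nth_mem[of e es] by (cases "es ! e") (auto simp: flat_def)

lemma Flat_ends: "(a, b) \<in> Flat \<Longrightarrow> a \<in> ends es \<and> b \<in> ends es"
  by (force simp: flat_def ends_def)

lemma Flat_path_ends: "(a, b) \<in> Flat\<^sup>* \<Longrightarrow> a \<in> ends es \<Longrightarrow> b \<in> ends es"
  by (erule rtrancl_induct) (auto dest: Flat_ends)

lemma leveled_same: "leveled A \<Longrightarrow> e < m \<Longrightarrow> A 11 (src e) = A 11 (dst e) \<longleftrightarrow> es ! e \<in> Flat"
  using Flat_index by (auto simp: leveled_def ends_def)

text \<open>The order clause comes from closedness: marked nodes reach only marked nodes, and a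
  candidate is unmarked when it is chosen.\<close>

definition cand_inv :: "nat list \<Rightarrow> (nat \<Rightarrow> nat \<Rightarrow> nat) \<Rightarrow> bool" where
  "cand_inv c A \<longleftrightarrow> A 14 0 = length c \<and> (\<forall>i<length c. A 14 (Suc i) = c ! i) \<and>
    set c \<subseteq> marked (A 13) \<and> marked (A 13) \<subseteq> ends es \<and> closed (marked (A 13)) \<and>
    (\<forall>w\<in>marked (A 13). \<exists>x\<in>set c. (x, w) \<in> Flat\<^sup>*) \<and>
    (\<forall>i j. i < j \<longrightarrow> j < length c \<longrightarrow> (c ! i, c ! j) \<notin> Flat\<^sup>*)"

lemma card_ends: "finite (ends es)" "card (ends es) \<le> m + m"
proof -
  have sub: "ends es \<subseteq> node ` {..<m + m}" using ends_node by (metis image_eqI lessThan_iff subsetI)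
  then show "finite (ends es)" using finite_subset by blast
  show "card (ends es) \<le> m + m"
    using card_mono[OF _ sub] card_image_le[of "{..<m + m}" node] by simp
qed

lemma tot_Cands:
  assumes "env st" and ld: "loaded (arrs st)" and lk: "linked (arrs st)" and lv: "leveled (arrs st)"
    and zero: "arrs st 13 = (\<lambda>_. 0)" "arrs st 14 = (\<lambda>_. 0)"
  shows "tot W Cands (\<lambda>st'. (\<exists>c. cand_inv c (arrs st') \<and> length c \<le> m + m \<and> ends es \<subseteq> marked (arrs st' 13)) \<and>
    agree {12, 13, 14, 19} (arrs st') (arrs st) \<and>
    inputs st' st \<and> time st' \<le> time st + 14 + 176 * m) st"
    (is "tot _ _ ?Post _")
proof -
  \<comment> \<open>Each node is marked once, so the costs of all searches telescope. At most
    \<open>2 * m\<close> nodes get marked, hence the final potential is at most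
    \<open>68 * m\<close>.\<close>
  define \<Phi> where "\<Phi> A = 14 * card (marked (A 13)) + 40 * (\<Sum>u\<in>marked (A 13). length (outs u))"
    for A :: "nat \<Rightarrow> nat \<Rightarrow> nat"
  define J where "J k A \<longleftrightarrow> (\<exists>c. cand_inv c A \<and> length c \<le> k \<and> (\<forall>j<k. node j \<in> marked (A 13))) \<and>
    (agree {12, 13, 14, 19} A (arrs st))" for k and A :: "nat \<Rightarrow> nat \<Rightarrow> nat"
  note env = envD[OF assms(1)]
  have loop: "tot W (For 4 20 cand_step)
    ?Post st0"
    if s0: "arrs st0 = arrs st" "regs st0 = (regs st)(20 := m + m, 10 := 0, 11 := 1)" "time st0 = time st + 8" for st0
  proof (rule tot_For_amortized[where J = J and U = "insert 4 {12..17}" and B = "\<lambda>_. 38" and \<Phi> = \<Phi>])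
    show "J 0 (arrs st0)" using s0 zero
      by (auto simp: J_def cand_inv_def marked_def closed_def intro!: exI[of _ "[]"])
    fix k and st1 :: ram
    assume k: "k < regs st0 20" and J: "J k (arrs st1)" and r4: "regs st1 4 = k"
      and fr: "\<And>x. x \<notin> insert 4 {12..17} \<Longrightarrow> regs st1 x = regs st0 x"
    let ?A = "arrs st1"
    let ?x = "node k"
    let ?M = "marked (?A 13)"
    have km: "k < m + m" using k s0 by simp
    have x: "?A 20 k = ?x" "?x < n" "?x \<in> ends es"
      using J lk km ends_bound node_ends by (auto simp: J_def linked_def)
    obtain c where c: "cand_inv c ?A" "length c \<le> k" "\<forall>j<k. node j \<in> ?M" using J unfolding J_def by blast
    have c14: "?A 14 0 = length c" using c(1) by (simp add: cand_inv_def)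
    let ?Q = "\<lambda>st'. J (Suc k) (arrs st') \<and> regs st' 4 = k \<and>
      agree (insert 4 {12..17}) (regs st') (regs st0) \<and>
      time st' + \<Phi> ?A \<le> time st1 + 38 + \<Phi> (arrs st')"
    have step: "tot W (Search 5 6 1 11 13 19) ?Q st2"
      if un: "?A 13 ?x = 0"
        and s2: "arrs st2 = ?A(14 := (?A 14)(0 := Suc (length c), Suc (length c) := ?x))"
        "regs st2 10 = 0" "regs st2 11 = 1" "regs st2 12 = ?x"
        "regs st2 4 = k" "agree (insert 4 {12..17}) (regs st2) (regs st0)" "time st2 \<le> time st1 + 20" for st2
    proof -
      have ld2: "loaded (arrs st2)" and lk2: "linked (arrs st2)" and lv2: "leveled (arrs st2)"
        using J ld lk lv unfolding s2 by (auto simp: J_def loaded_def linked_def leveled_def)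
      have "search W n m 5 6 1 11 13 19 (arrs st2) src dst outs 0 1 ?x"
        using ld2 lk2 x un s2 small by (intro search_forward) auto
      then interpret S: search W n m 5 6 1 11 13 19 "arrs st2" src dst outs 0 1 ?x .
      have M0: "S.M0 = ?M" unfolding S.M0_def marked_def using s2(1) by simp
      have same: "e < m \<Longrightarrow> S.same e \<longleftrightarrow> es ! e \<in> Flat" for e
        using leveled_same[OF lv2] by (simp add: S.same_def)
      show ?thesis
      proof (rule tot_conseq[OF S.tot_Search[OF refl s2(2-4)]])
        fix st' :: ram
        assume "\<exists>X D. S.found X D st2 st'"
        then obtain X D where f: "S.found X D st2 st'" by blast
        have X: "?x \<in> X" "X \<subseteq> {..<n}" "X \<inter> ?M = {}" "D \<subseteq> {e. e < m \<and> S.same e}"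
          "\<forall>w\<in>X. (?x, w) \<in> ((\<lambda>e. (src e, dst e)) ` D)\<^sup>*" "S.settled X X"
          "arrs st' 13 = (\<lambda>j. if j \<in> (+) 0 ` X then 1 else arrs st2 13 j)"
          "agree {12, 13, 19} (arrs st') (arrs st2)"
          "agree {13..17} (regs st') (regs st2)"
          and t: "time st' \<le> time st2 + 12 + 14 * card X + 40 * S.deg X"
          using f[unfolded S.found_def] M0 by blast+
        have m': "marked (arrs st' 13) = ?M \<union> X"
        proof -
          have "arrs st2 13 = ?A 13" using s2(1) by simp
          then show ?thesis using X(7) marked_update[OF X(2), of 1 "arrs st2 13"] by simp
        qed
        have "(\<lambda>e. (src e, dst e)) ` D \<subseteq> Flat" using X(4) same by auto
        then have path: "(?x, w) \<in> Flat\<^sup>*" if "w \<in> X" for w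
          using X(5) that rtrancl_mono by blast
        have closed': "closed (?M \<union> X)"
          unfolding closed_def
        proof (intro allI impI)
          fix a b assume ab: "(a, b) \<in> Flat" "a \<in> ?M \<union> X"
          show "b \<in> ?M \<union> X"
          proof (cases "a \<in> X")
            case True
            obtain e where "e < m" "es ! e \<in> Flat" "src e = a" "dst e = b" using ab(1) Flat_edge by blast
            then show ?thesis using X(6) True same M0 unfolding S.settled_def by blast
          qed (use c(1) ab in \<open>auto simp: cand_inv_def closed_def\<close>)
        qed
        have xM: "?x \<notin> ?M" using un by (simp add: marked_def)
        have a14: "arrs st' 14 = (?A 14)(0 := Suc (length c), Suc (length c) := ?x)" using X(8) s2(1) by simp
        have "cand_inv (c @ [?x]) (arrs st')"
          unfolding cand_inv_def m'
        proof (intro conjI)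
          show "arrs st' 14 0 = length (c @ [?x])" using a14 by simp
          show "\<forall>i<length (c @ [?x]). arrs st' 14 (Suc i) = (c @ [?x]) ! i"
            using a14 c(1) by (auto simp: cand_inv_def nth_append less_Suc_eq)
          show "set (c @ [?x]) \<subseteq> ?M \<union> X" using X(1) c(1) by (auto simp: cand_inv_def)
          show "?M \<union> X \<subseteq> ends es" using c(1) path Flat_path_ends x(3) by (auto simp: cand_inv_def)
          show "\<forall>w\<in>?M \<union> X. \<exists>z\<in>set (c @ [?x]). (z, w) \<in> Flat\<^sup>*"
            using c(1) path by (fastforce simp: cand_inv_def)
          have "(c ! i, ?x) \<notin> Flat\<^sup>*" if "i < length c" for i
          proof
            assume "(c ! i, ?x) \<in> Flat\<^sup>*"
            moreover have "c ! i \<in> ?M" "closed ?M" using c(1) that nth_mem by (auto simp: cand_inv_def)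
            ultimately show False using closed_path xM by blast
          qed
          then show "\<forall>i j. i < j \<longrightarrow> j < length (c @ [?x]) \<longrightarrow> ((c @ [?x]) ! i, (c @ [?x]) ! j) \<notin> Flat\<^sup>*"
            using c(1) by (auto simp: cand_inv_def nth_append less_Suc_eq)
        qed (rule closed')
        moreover have "\<forall>j<Suc k. node j \<in> marked (arrs st' 13)"
          using c(3) X(1) unfolding m' by (auto simp: less_Suc_eq)
        moreover have "agree {12, 13, 14, 19} (arrs st') (arrs st)"
          using X(8) s2(1) J by (simp add: J_def)
        ultimately have "J (Suc k) (arrs st')"
          unfolding J_def using c(2) by (auto intro!: exI[of _ "c @ [?x]"])
        moreover have "\<Phi> (arrs st') = \<Phi> ?A + (14 * card X + 40 * S.deg X)"
        proof -
          have "finite X" "?M \<inter> X = {}" using X(2,3) finite_subset by auto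
          then show ?thesis unfolding \<Phi>_def m' by (simp add: card_Un_disjoint sum.union_disjoint)
        qed
        moreover have "regs st' 4 = k" "agree (insert 4 {12..17}) (regs st') (regs st0)"
          using X(9) s2(5,6) by auto
        ultimately show "?Q st'" using t s2(7) by simp
      qed
    qed
    have l: "Suc (length c) mod W = Suc (length c)" "(length c + 1) mod W = Suc (length c)"
      using c(2) km small by auto
    have skip: "J (Suc k) ?A" if "?A 13 ?x \<noteq> 0"
      using J c that x(2) unfolding J_def by (auto simp: less_Suc_eq marked_def intro!: exI[of _ c])
    have r: "regs st1 10 = 0" "regs st1 11 = 1" using fr[of 10] fr[of 11] s0 by simp_all
    show "tot W cand_step ?Q st1"
    proof (cases "?A 13 ?x = 0")
      case True
      show ?thesis unfolding tot_simps tot_When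
        apply (subst if_P)
        subgoal using True x small r4 by simp
        apply (rule step[OF True])
        using fr r4 r x small c14 l by (simp_all del: One_nat_def)
    next
      case False
      then show ?thesis using fr r4 x small skip by simp
    qed
  next
    fix st' :: ram
    assume J: "J (regs st0 20) (arrs st')" and fr: "\<And>x. x \<notin> insert 4 {12..17} \<Longrightarrow> regs st' x = regs st0 x"
      and t: "time st' + \<Phi> (arrs st0) \<le> time st0 + 6 + (\<Sum>k<regs st0 20. 38 + 8) + \<Phi> (arrs st')"
    obtain c where c: "cand_inv c (arrs st')" "length c \<le> m + m" "\<forall>j<m + m. node j \<in> marked (arrs st' 13)"
      using J s0 unfolding J_def by auto
    have e: "ends es \<subseteq> marked (arrs st' 13)" using c(3) ends_node by blast
    have "marked (arrs st' 13) \<subseteq> ends es" using c(1) by (simp add: cand_inv_def)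
    then have "card (marked (arrs st' 13)) \<le> m + m" using card_mono[OF card_ends(1)] card_ends(2) order_trans by blast
    then have "\<Phi> (arrs st') \<le> 14 * (m + m) + 40 * m" using deg_le(1)[of "marked (arrs st' 13)"] by (simp add: \<Phi>_def)
    then have "time st' \<le> time st + 14 + 176 * m" using t s0 by simp
    then show "?Post st'"
      using c e J fr s0 by (auto simp: J_def)
  qed (use small s0 in auto)
  show ?thesis unfolding Cands_def tot_simps by (rule loop) (use small env in simp_all)
qed

end

context rp_run
begin

section \<open>Spanning forests from and into the initial components\<close>

definition chosen :: "(nat \<Rightarrow> nat) \<Rightarrow> nat set" where "chosen a = {e. e < m \<and> a e \<noteq> 0}"

text \<open>Both forests are collected in array 4. Each search contributes fewer edges than nodes it
  labels, which gives the last clause and finally \<open>2 * n\<close>.\<close>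

definition forest_inv :: "(nat \<Rightarrow> nat \<Rightarrow> nat) \<Rightarrow> bool" where
  "forest_inv A \<longleftrightarrow>
    marked (A 15) \<subseteq> ends es \<and> closed (marked (A 15)) \<and>
    (\<forall>w\<in>marked (A 15). (A 15 w - 1, w) \<in> ((!) es ` chosen (A 4))\<^sup>* \<and> A 16 (A 15 w - 1) = A 15 w) \<and>
    (\<forall>w. A 16 w \<noteq> 0 \<longrightarrow> w \<in> marked (A 15) \<and> (w, A 16 w - 1) \<in> ((!) es ` chosen (A 4))\<^sup>*) \<and>
    (\<forall>a b. (a, b) \<in> Flat \<longrightarrow> A 16 b \<noteq> 0 \<longrightarrow> A 16 a = A 16 b) \<and>
    (\<forall>e\<in>chosen (A 4). es ! e \<in> Flat) \<and>
    card (chosen (A 4)) \<le> card (marked (A 15)) + card (marked (A 16))"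

lemma finite_chosen [simp]: "finite (chosen a)"
  by (auto simp: chosen_def)

text \<open>No marked node reaches \<open>x\<close>, since the marked set is closed under flat
  edges. By \<open>root\<close>, whatever reaches \<open>x\<close> is then also reached from
  \<open>x\<close>. So \<open>X2\<close> consists of nodes strongly connected to \<open>x\<close>
  and meets no component labelled earlier.\<close>

lemma forest_inv_step:
  assumes inv: "forest_inv A" and x: "x \<notin> marked (A 15)" "x \<in> ends es"
    and root: "\<And>w. (w, x) \<in> Flat\<^sup>* \<Longrightarrow> w \<in> ends es \<Longrightarrow> w \<in> marked (A 15) \<or> (x, w) \<in> Flat\<^sup>*"
    and X1: "x \<in> X1" "X1 \<subseteq> {..<n}" "X1 \<inter> marked (A 15) = {}" "D1 \<subseteq> {e. e < m \<and> es ! e \<in> Flat}"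
      "card D1 < card X1" "\<And>w. w \<in> X1 \<Longrightarrow> (x, w) \<in> ((!) es ` D1)\<^sup>*"
      "\<And>a b. (a, b) \<in> Flat \<Longrightarrow> a \<in> X1 \<Longrightarrow> b \<in> X1 \<union> marked (A 15)"
    and X2: "x \<in> X2" "X2 \<subseteq> {..<n}" "X2 \<inter> marked (A 16) = {}" "D2 \<subseteq> {e. e < m \<and> es ! e \<in> Flat}"
      "card D2 < card X2" "\<And>w. w \<in> X2 \<Longrightarrow> (w, x) \<in> ((!) es ` D2)\<^sup>*"
      "\<And>a b. (a, b) \<in> Flat \<Longrightarrow> b \<in> X2 \<Longrightarrow> a \<in> X2 \<union> marked (A 16)"
    and A': "A' 15 = (\<lambda>j. if j \<in> X1 then Suc x else A 15 j)" "A' 16 = (\<lambda>j. if j \<in> X2 then Suc x else A 16 j)"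
      "A' 4 = (\<lambda>e. if e \<in> D2 then 1 else if e \<in> D1 then 1 else A 4 e)"
  shows "forest_inv A'"
proof -
  let ?M = "marked (A 15)" and ?C = "marked (A 16)" and ?F = "chosen (A 4)"
  let ?H = "(!) es ` (?F \<union> D1 \<union> D2)"
  have Mends: "?M \<subseteq> ends es" and Mcl: "closed ?M"
    and M15: "\<And>w. w \<in> ?M \<Longrightarrow> (A 15 w - 1, w) \<in> ((!) es ` ?F)\<^sup>* \<and> A 16 (A 15 w - 1) = A 15 w"
    and C16: "\<And>w. A 16 w \<noteq> 0 \<Longrightarrow> w \<in> ?M \<and> (w, A 16 w - 1) \<in> ((!) es ` ?F)\<^sup>*"
    and eq16: "\<And>a b. (a, b) \<in> Flat \<Longrightarrow> A 16 b \<noteq> 0 \<Longrightarrow> A 16 a = A 16 b"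
    and F: "\<And>e. e \<in> ?F \<Longrightarrow> es ! e \<in> Flat" "card ?F \<le> card ?M + card ?C"
    using inv unfolding forest_inv_def by blast+
  have M': "marked (A' 15) = ?M \<union> X1" unfolding A' by (rule marked_update[OF X1(2)]) simp
  have C': "marked (A' 16) = ?C \<union> X2" unfolding A' by (rule marked_update[OF X2(2)]) simp
  have F': "chosen (A' 4) = ?F \<union> D1 \<union> D2"
    using X1(4) X2(4) unfolding A' chosen_def by auto
  have Hs: "(u, v) \<in> ((!) es ` ?F)\<^sup>* \<Longrightarrow> (u, v) \<in> ?H\<^sup>*" "(u, v) \<in> ((!) es ` D1)\<^sup>* \<Longrightarrow> (u, v) \<in> ?H\<^sup>*"
    "(u, v) \<in> ((!) es ` D2)\<^sup>* \<Longrightarrow> (u, v) \<in> ?H\<^sup>*" for u v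
    by (rule rtrancl_mono[THEN subsetD, rotated], assumption, blast)+
  have D: "(!) es ` D1 \<subseteq> Flat" "(!) es ` D2 \<subseteq> Flat" using X1(4) X2(4) by auto
  have path1: "(x, w) \<in> Flat\<^sup>*" if "w \<in> X1" for w using X1(6)[OF that] rtrancl_mono[OF D(1)] by blast
  have path2: "(w, x) \<in> Flat\<^sup>*" if "w \<in> X2" for w using X2(6)[OF that] rtrancl_mono[OF D(2)] by blast
  have M'cl: "closed (?M \<union> X1)" using Mcl X1(7) unfolding closed_def by blast
  have X2ends: "w \<in> ends es" if "w \<in> X2" for w
    using path2[OF that] x(2) by (cases rule: converse_rtranclE) (auto dest: Flat_ends)
  have X2M: "X2 \<inter> ?M = {}" using path2 closed_path[OF Mcl] x(1) by blast
  have X2sub: "X2 \<subseteq> ?M \<union> X1"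
    using root[OF path2 X2ends] closed_path[OF M'cl] X1(1) by blast
  have C0: "A 16 w = 0" if "w \<in> X2" for w using C16[of w] X2M that by blast
  have bound: "w < n" if "A 16 w \<noteq> 0" for w using C16[OF that] by (simp add: marked_def)
  have n16: "A 16 (A 15 w - 1) \<noteq> 0" "A 15 w - 1 \<notin> X2" if "w \<in> ?M" for w
    using M15[OF that] that C0 by (auto simp: marked_def)
  show ?thesis
    unfolding forest_inv_def M' C' F'
  proof (intro conjI ballI allI impI)
    show "?M \<union> X1 \<subseteq> ends es" using Mends path1 Flat_path_ends x(2) by blast
    show "closed (?M \<union> X1)" by (rule M'cl)
    fix w assume w: "w \<in> ?M \<union> X1"
    show "(A' 15 w - 1, w) \<in> ?H\<^sup>*"
      using w X1(6) M15 Hs by (cases "w \<in> X1") (auto simp: A')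
    show "A' 16 (A' 15 w - 1) = A' 15 w"
      using w M15[of w] n16[of w] X2(1) by (cases "w \<in> X1") (auto simp: A')
  next
    fix w assume w: "A' 16 w \<noteq> 0"
    show "w \<in> ?M \<union> X1" using w X2sub C16 by (cases "w \<in> X2") (auto simp: A')
    show "(w, A' 16 w - 1) \<in> ?H\<^sup>*" using w X2(6) C16 Hs by (cases "w \<in> X2") (auto simp: A')
  next
    fix a b assume ab: "(a, b) \<in> Flat" "A' 16 b \<noteq> 0"
    show "A' 16 a = A' 16 b"
    proof (cases "b \<in> X2")
      case True
      \<comment> \<open>A tail with an older label would be marked, and so would its head
        \<open>b\<close>, but \<open>X2\<close> avoids marked nodes.\<close>
      have "a \<notin> ?C" using eq16[OF ab(1)] X2M C16 True C0 closed_path[OF Mcl, of a b] ab(1)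
        by (auto simp: marked_def)
      then show ?thesis using X2(7)[OF ab(1) True] True by (simp add: A')
    next
      case False
      then have "A 16 b \<noteq> 0" using ab(2) by (simp add: A')
      then have "A 16 a = A 16 b" using eq16 ab(1) by blast
      then show ?thesis using False C0[of a] \<open>A 16 b \<noteq> 0\<close> by (auto simp: A')
    qed
  next
    show "es ! e \<in> Flat" if "e \<in> ?F \<union> D1 \<union> D2" for e using that F X1(4) X2(4) by auto
    have fin: "finite X1" "finite X2" using X1(2) X2(2) finite_subset by blast+
    have "card (?F \<union> D1 \<union> D2) \<le> card ?F + card D1 + card D2"
      using card_Un_le[of ?F D1] card_Un_le[of "?F \<union> D1" D2] by linarith
    also have "\<dots> \<le> (card ?M + card X1) + (card ?C + card X2)" using F(2) X1(5) X2(5) by linarith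
    also have "\<dots> = card (?M \<union> X1) + card (?C \<union> X2)"
      using fin X1(3) X2(3) by (subst card_Un_disjoint, auto)+
    finally show "card (?F \<union> D1 \<union> D2) \<le> card (?M \<union> X1) + card (?C \<union> X2)" .
  qed
qed

lemma forest_final:
  assumes "forest_inv A" "ends es \<subseteq> marked (A 15)"
  shows "flat_forest es ss (A 15) (A 16) (chosen (A 4))" "card (chosen (A 4)) \<le> 2 * n"
proof -
  have inv: "\<forall>w\<in>marked (A 15). (A 15 w - 1, w) \<in> ((!) es ` chosen (A 4))\<^sup>* \<and> A 16 (A 15 w - 1) = A 15 w"
    "\<forall>w. A 16 w \<noteq> 0 \<longrightarrow> w \<in> marked (A 15) \<and> (w, A 16 w - 1) \<in> ((!) es ` chosen (A 4))\<^sup>*"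
    "\<forall>a b. (a, b) \<in> Flat \<longrightarrow> A 16 b \<noteq> 0 \<longrightarrow> A 16 a = A 16 b"
    "\<forall>e\<in>chosen (A 4). es ! e \<in> Flat"
    "card (chosen (A 4)) \<le> card (marked (A 15)) + card (marked (A 16))"
    using assms(1) unfolding forest_inv_def by blast+
  show "flat_forest es ss (A 15) (A 16) (chosen (A 4))"
  proof
    show "chosen (A 4) \<subseteq> {..<m}" by (auto simp: chosen_def)
    fix v assume "v \<in> ends es"
    then have v: "v \<in> marked (A 15)" using assms(2) by blast
    then show "A 15 v \<noteq> 0" by (simp add: marked_def)
    show "(A 15 v - 1, v) \<in> ((!) es ` chosen (A 4))\<^sup>*" "A 16 (A 15 v - 1) = A 15 v" using inv(1) v by blast+
  qed (use inv in blast)+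
  have "card (marked a) \<le> n" for a
    using card_mono[of "{..<n}" "marked a"] by (auto simp: marked_def)
  from this[of "A 15"] this[of "A 16"] show "card (chosen (A 4)) \<le> 2 * n" using inv(5) by linarith
qed

lemma path_converse:
  assumes "(x, w) \<in> ((\<lambda>e. (dst e, src e)) ` D)\<^sup>*"
  shows "(w, x) \<in> ((!) es ` D)\<^sup>*"
proof -
  have "(\<lambda>e. (dst e, src e)) ` D = ((!) es ` D)\<inverse>"
  proof (rule set_eqI, clarify)
    fix a b
    show "(a, b) \<in> (\<lambda>e. (dst e, src e)) ` D \<longleftrightarrow> (a, b) \<in> ((!) es ` D)\<inverse>"
      unfolding converse_iff image_iff by (metis fst_conv snd_conv prod.collapse)
  qed
  then show ?thesis using assms by (simp add: rtrancl_converse)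
qed

text \<open>The prices are those of \<open>found\<close>: the forward search is paid by nodes newly
  labelled in array 15, the backward search by those in array 16.\<close>

definition pot :: "(nat \<Rightarrow> nat \<Rightarrow> nat) \<Rightarrow> nat" where
  "pot A = (14 * card (marked (A 15)) + 40 * (\<Sum>u\<in>marked (A 15). length (outs u))) +
    (14 * card (marked (A 16)) + 40 * (\<Sum>u\<in>marked (A 16). length (ins u)))"

lemma tot_two_searches:
  assumes ld: "loaded (arrs st)" and lk: "linked (arrs st)" and lv: "leveled (arrs st)"
    and inv: "forest_inv (arrs st)" and x: "x \<notin> marked (arrs st 15)" "x \<in> ends es"
    and root: "\<And>w. (w, x) \<in> Flat\<^sup>* \<Longrightarrow> w \<in> ends es \<Longrightarrow> w \<in> marked (arrs st 15) \<or> (x, w) \<in> Flat\<^sup>*"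
    and reg: "regs st 10 = 0" "regs st 11 = Suc x" "regs st 12 = x"
  shows "tot W (Seq (Search 5 6 1 11 15 4) (Search 7 8 0 11 16 4))
    (\<lambda>st'. forest_inv (arrs st') \<and> x \<in> marked (arrs st' 15) \<and>
      marked (arrs st 15) \<subseteq> marked (arrs st' 15) \<and>
      agree {4, 12, 15, 16} (arrs st') (arrs st) \<and>
      agree {13..17} (regs st') (regs st) \<and>
      time st' + pot (arrs st) \<le> time st + 24 + pot (arrs st')) st"
proof -
  let ?A = "arrs st"
  have xn: "x < n" using x(2) ends_bound by blast
  have x15: "?A 15 x = 0" using x(1) xn by (simp add: marked_def)
  \<comment> \<open>Labels in array 16 occur only on nodes labelled in array 15, so \<open>x\<close>
    is new to both searches.\<close>
  have x16: "?A 16 x = 0" using inv x(1) unfolding forest_inv_def by blast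
  have "search W n m 5 6 1 11 15 4 ?A src dst outs 0 (Suc x) x"
    by (rule search_forward[OF ld lk]) (use small xn x15 in simp_all)
  then interpret S1: search W n m 5 6 1 11 15 4 ?A src dst outs 0 "Suc x" x .
  show ?thesis
  proof (rule tot_Seq_conseq[OF S1.tot_Search[OF refl reg]])
    fix st1 :: ram
    assume "\<exists>X D. S1.found X D st st1"
    then obtain X1 D1 where f: "S1.found X1 D1 st st1" by blast
    have M0: "S1.M0 = marked (?A 15)" unfolding S1.M0_def marked_def by simp
    note f1 = f[unfolded S1.found_def M0]
    have ar1: "\<And>a. a \<notin> {12, 15, 4} \<Longrightarrow> arrs st1 a = ?A a" using f1 by blast
    have reg1: "\<And>r. r \<notin> {13..17} \<Longrightarrow> regs st1 r = regs st r" using f1 by blast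
    have ld1: "loaded (arrs st1)" using ld ar1[of 0] ar1[of 1] ar1[of 2] ar1[of 3] by (simp add: loaded_def)
    have lk1: "linked (arrs st1)"
      using lk ar1[of 5] ar1[of 6] ar1[of 7] ar1[of 8] ar1[of 20] by (simp add: linked_def)
    have a16: "arrs st1 16 = ?A 16" and a11: "arrs st1 11 = ?A 11" using ar1[of 16] ar1[of 11] by simp_all
    have "search W n m 7 8 0 11 16 4 (arrs st1) dst src ins 0 (Suc x) x"
      by (rule search_backward[OF ld1 lk1]) (use small xn x16 a16 in simp_all)
    then interpret S2: search W n m 7 8 0 11 16 4 "arrs st1" dst src ins 0 "Suc x" x .
    have r1: "regs st1 10 = 0" "regs st1 11 = Suc x" "regs st1 12 = x" using reg reg1 by simp_all
    show "tot W (Search 7 8 0 11 16 4) (\<lambda>st'. forest_inv (arrs st') \<and> x \<in> marked (arrs st' 15) \<and>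
      marked (arrs st 15) \<subseteq> marked (arrs st' 15) \<and>
      agree {4, 12, 15, 16} (arrs st') (arrs st) \<and>
      agree {13..17} (regs st') (regs st) \<and>
      time st' + pot (arrs st) \<le> time st + 24 + pot (arrs st')) st1"
    proof (rule tot_conseq[OF S2.tot_Search[OF refl r1]])
      fix st2 :: ram
      assume "\<exists>X D. S2.found X D st1 st2"
      then obtain X2 D2 where g: "S2.found X2 D2 st1 st2" by blast
      have N0: "S2.M0 = marked (?A 16)" unfolding S2.M0_def marked_def by (simp add: a16)
      note f2 = g[unfolded S2.found_def N0]
      have same1: "S1.same e \<longleftrightarrow> es ! e \<in> Flat" and same2: "S2.same e \<longleftrightarrow> es ! e \<in> Flat" if "e < m" for e
        using leveled_same[OF lv that] by (auto simp: S1.same_def S2.same_def a11)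
      have ar2: "\<And>a. a \<notin> {12, 16, 4} \<Longrightarrow> arrs st2 a = arrs st1 a" using f2 by blast
      have plus0: "(+) (0::nat) ` X = X" for X by simp
      have X1: "x \<in> X1" "X1 \<subseteq> {..<n}" "X1 \<inter> marked (?A 15) = {}" "D1 \<subseteq> {e. e < m \<and> S1.same e}"
        "card D1 < card X1" "\<forall>w\<in>X1. (x, w) \<in> ((\<lambda>e. (src e, dst e)) ` D1)\<^sup>*" "S1.settled X1 X1"
        using f1 by blast+
      have X2: "x \<in> X2" "X2 \<subseteq> {..<n}" "X2 \<inter> marked (?A 16) = {}" "D2 \<subseteq> {e. e < m \<and> S2.same e}"
        "card D2 < card X2" "\<forall>w\<in>X2. (x, w) \<in> ((\<lambda>e. (dst e, src e)) ` D2)\<^sup>*" "S2.settled X2 X2"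
        using f2 by blast+
      have a15': "arrs st2 15 = (\<lambda>j. if j \<in> X1 then Suc x else ?A 15 j)"
        using f1 ar2[of 15] unfolding plus0 by auto
      have a16': "arrs st2 16 = (\<lambda>j. if j \<in> X2 then Suc x else ?A 16 j)"
        using f2 a16 unfolding plus0 by auto
      have a4: "arrs st1 4 = (\<lambda>e. if e \<in> D1 then 1 else ?A 4 e)" using f1 by blast
      have a4': "arrs st2 4 = (\<lambda>e. if e \<in> D2 then 1 else if e \<in> D1 then 1 else ?A 4 e)"
        using f2 unfolding a4 by blast
      have inv': "forest_inv (arrs st2)"
      proof (rule forest_inv_step[OF inv x root _ _ _ _ _ _ _ _ _ _ _ _ _ _ a15' a16' a4'])
        show "D1 \<subseteq> {e. e < m \<and> es ! e \<in> Flat}" using X1(4) same1 by blast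
        show "D2 \<subseteq> {e. e < m \<and> es ! e \<in> Flat}" using X2(4) same2 by blast
        show "(x, w) \<in> ((!) es ` D1)\<^sup>*" if "w \<in> X1" for w using X1(6) that by simp
        show "(w, x) \<in> ((!) es ` D2)\<^sup>*" if "w \<in> X2" for w using X2(6) that path_converse by blast
        show "b \<in> X1 \<union> marked (?A 15)" if "(a, b) \<in> Flat" "a \<in> X1" for a b
        proof -
          obtain e where "e < m" "es ! e \<in> Flat" "src e = a" "dst e = b" using Flat_edge \<open>(a, b) \<in> Flat\<close> by blast
          then show ?thesis using X1(7) same1 that M0 unfolding S1.settled_def by blast
        qed
        show "a \<in> X2 \<union> marked (?A 16)" if "(a, b) \<in> Flat" "b \<in> X2" for a b
        proof -
          obtain e where "e < m" "es ! e \<in> Flat" "src e = a" "dst e = b" using Flat_edge \<open>(a, b) \<in> Flat\<close> by blast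
          then show ?thesis using X2(7) same2 that N0 unfolding S2.settled_def by blast
        qed
      qed (use X1 X2 in auto)
      have m15: "marked (arrs st2 15) = marked (?A 15) \<union> X1"
        unfolding a15' by (rule marked_update[OF X1(2)]) simp
      have m16: "marked (arrs st2 16) = marked (?A 16) \<union> X2"
        unfolding a16' by (rule marked_update[OF X2(2)]) simp
      have fin: "finite X1" "finite X2" using X1(2) X2(2) finite_subset by blast+
      have "pot (arrs st2) = pot ?A + (14 * card X1 + 40 * S1.deg X1) + (14 * card X2 + 40 * S2.deg X2)"
      proof -
        have "marked (?A 15) \<inter> X1 = {}" "marked (?A 16) \<inter> X2 = {}" using X1(3) X2(3) by blast+
        then show ?thesis unfolding pot_def m15 m16 using fin
          by (simp add: card_Un_disjoint sum.union_disjoint)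
      qed
      moreover have "time st1 \<le> time st + 12 + 14 * card X1 + 40 * S1.deg X1"
        "time st2 \<le> time st1 + 12 + 14 * card X2 + 40 * S2.deg X2" using f1 f2 by blast+
      ultimately have t: "time st2 + pot ?A \<le> time st + 24 + pot (arrs st2)" by linarith
      have fr: "agree {4, 12, 15, 16} (arrs st2) ?A" using ar1 ar2 by simp
      have frr: "agree {13..17} (regs st2) (regs st)" using f1 f2 by simp
      show "forest_inv (arrs st2) \<and> x \<in> marked (arrs st2 15) \<and>
        marked (arrs st 15) \<subseteq> marked (arrs st2 15) \<and>
        agree {4, 12, 15, 16} (arrs st2) (arrs st) \<and>
        agree {13..17} (regs st2) (regs st) \<and>
        time st2 + pot (arrs st) \<le> time st + 24 + pot (arrs st2)"
        using inv' m15 X1(1) fr frr t by blast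
    qed
  qed
qed

lemma tot_Roots:
  assumes "env st" and ld: "loaded (arrs st)" and lk: "linked (arrs st)" and lv: "leveled (arrs st)"
    and c: "cand_inv c (arrs st)" "length c \<le> m + m" "ends es \<subseteq> marked (arrs st 13)"
    and zero: "arrs st 4 = (\<lambda>_. 0)" "arrs st 15 = (\<lambda>_. 0)" "arrs st 16 = (\<lambda>_. 0)"
  shows "tot W Roots (\<lambda>st'. flat_forest es ss (arrs st' 15) (arrs st' 16) (chosen (arrs st' 4)) \<and>
    card (chosen (arrs st' 4)) \<le> 2 * n \<and>
    agree {4, 12, 15, 16} (arrs st') (arrs st) \<and>
    inputs st' st \<and> time st' \<le> time st + 13 + 250 * m) st"
    (is "tot _ _ ?Post _")
proof -
  let ?L = "length c"
  define J where "J k A \<longleftrightarrow> forest_inv A \<and> (\<forall>j<k. c ! (?L - Suc j) \<in> marked (A 15)) \<and>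
    (agree {4, 12, 15, 16} A (arrs st))" for k and A :: "nat \<Rightarrow> nat \<Rightarrow> nat"
  note env = envD[OF assms(1)]
  have LW: "?L < W" using c(2) small by simp
  have c14: "arrs st 14 0 = ?L" "\<And>i. i < ?L \<Longrightarrow> arrs st 14 (Suc i) = c ! i"
    and cm: "set c \<subseteq> marked (arrs st 13)" "marked (arrs st 13) \<subseteq> ends es" "closed (marked (arrs st 13))"
    and cr: "\<And>w. w \<in> marked (arrs st 13) \<Longrightarrow> \<exists>x\<in>set c. (x, w) \<in> Flat\<^sup>*"
    and co: "\<And>i j. i < j \<Longrightarrow> j < ?L \<Longrightarrow> (c ! i, c ! j) \<notin> Flat\<^sup>*"
    using c(1) unfolding cand_inv_def by blast+
  have loop: "tot W (For 4 21 root_step)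
    ?Post st0"
    if s0: "arrs st0 = arrs st" "regs st0 = (regs st)(10 := 0, 21 := ?L)" "time st0 = time st + 5" for st0
  proof (rule tot_For_amortized[where J = J and U = "insert 4 {11..17}" and B = "\<lambda>_. 40" and \<Phi> = pot])
    have "marked (\<lambda>_. 0) = {}" "chosen (\<lambda>_. 0) = {}" by (auto simp: marked_def chosen_def)
    then show "J 0 (arrs st0)" using s0 zero by (auto simp: J_def forest_inv_def closed_def)
    fix k and st1 :: ram
    assume k: "k < regs st0 21" and J: "J k (arrs st1)" and r4: "regs st1 4 = k"
      and fr: "\<And>x. x \<notin> insert 4 {11..17} \<Longrightarrow> regs st1 x = regs st0 x"
    let ?A = "arrs st1"
    let ?x = "c ! (?L - Suc k)"
    have kL: "k < ?L" using k s0 by simp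
    have A14: "?A 14 = arrs st 14" using J by (simp add: J_def)
    have x14: "?A 14 (?L - k) = ?x" using c14(2)[of "?L - Suc k"] kL A14 by (simp add: Suc_diff_Suc)
    have xe: "?x \<in> ends es" 
    proof -
      have "?x \<in> set c" using kL by (intro nth_mem) simp
      then show ?thesis using cm(1,2) by blast
    qed
    have xn: "?x < n" by (rule ends_bound[OF xe])
    have inv: "forest_inv ?A" and prev: "\<And>j. j < k \<Longrightarrow> c ! (?L - Suc j) \<in> marked (?A 15)"
      and frA: "\<And>a. a \<notin> {4, 12, 15, 16} \<Longrightarrow> ?A a = arrs st a" using J unfolding J_def by blast+
    have cl: "closed (marked (?A 15))" using inv unfolding forest_inv_def by blast
    have ld1: "loaded ?A" and lk1: "linked ?A" and lv1: "leveled ?A"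
      using ld lk lv by (auto simp: loaded_def linked_def leveled_def frA)
    let ?Q = "\<lambda>st'. J (Suc k) (arrs st') \<and> regs st' 4 = k \<and>
      agree (insert 4 {11..17}) (regs st') (regs st0) \<and>
      time st' + pot ?A \<le> time st1 + 40 + pot (arrs st')"
    have step: "tot W (Seq (Search 5 6 1 11 15 4) (Search 7 8 0 11 16 4)) ?Q st2"
      if un: "?A 15 ?x = 0"
        and s2: "arrs st2 = ?A" "regs st2 10 = 0" "regs st2 11 = Suc ?x" "regs st2 12 = ?x"
        "regs st2 4 = k" "agree (insert 4 {11..17}) (regs st2) (regs st0)" "time st2 \<le> time st1 + 16" for st2
    proof -
      have xM: "?x \<notin> marked (?A 15)" using un by (simp add: marked_def)
      have root: "w \<in> marked (?A 15) \<or> (?x, w) \<in> Flat\<^sup>*" if w: "(w, ?x) \<in> Flat\<^sup>*" "w \<in> ends es" for w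
      proof -
        \<comment> \<open>Some candidate reaches \<open>w\<close> and hence \<open>?x\<close>. An
          earlier candidate never reaches a later one, and a later one has been processed already,
          which would have marked \<open>?x\<close>. So that candidate is \<open>?x\<close>
          itself.\<close>
        obtain i where i: "i < ?L" "(c ! i, w) \<in> Flat\<^sup>*" using cr[of w] c(3) w(2) by (metis in_set_conv_nth subsetD)
        have ix: "(c ! i, ?x) \<in> Flat\<^sup>*" using i(2) w(1) by (rule rtrancl_trans)
        have "\<not> i < ?L - Suc k" using co[of i "?L - Suc k"] ix kL by (metis diff_less zero_less_Suc gr_implies_not0 neq0_conv)
        moreover have "\<not> i > ?L - Suc k"
        proof
          assume gt: "i > ?L - Suc k"
          have "c ! (?L - Suc (?L - Suc i)) \<in> marked (?A 15)" using prev[of "?L - Suc i"] gt i(1) kL by auto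
          then have "c ! i \<in> marked (?A 15)" using i(1) by (simp add: Suc_diff_Suc)
          then show False using closed_path[OF cl ix] xM by blast
        qed
        ultimately have "i = ?L - Suc k" by simp
        then show ?thesis using i(2) by simp
      qed
      show ?thesis
      proof (rule tot_conseq[OF tot_two_searches[of st2 ?x]], unfold s2(1))
        fix st' :: ram
        assume f: "forest_inv (arrs st') \<and> ?x \<in> marked (arrs st' 15) \<and>
          marked (?A 15) \<subseteq> marked (arrs st' 15) \<and>
          (agree {4, 12, 15, 16} (arrs st') ?A) \<and>
          agree {13..17} (regs st') (regs st2) \<and>
          time st' + pot ?A \<le> time st2 + 24 + pot (arrs st')"
        have "c ! (?L - Suc j) \<in> marked (arrs st' 15)" if "j < Suc k" for j
          using that f prev[of j] by (cases "j = k") auto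
        then have "J (Suc k) (arrs st')" unfolding J_def using f frA by simp
        moreover have "regs st' 4 = k" "agree (insert 4 {11..17}) (regs st') (regs st0)"
          using f s2(5,6) by auto
        ultimately show "?Q st'" using f s2(7) by simp
      qed (use ld1 lk1 lv1 inv xM xe root s2 in blast)+
    qed
    have mods: "(?x + 1) mod W = Suc ?x" "(?L - k) mod W = ?L - k" using xn small LW by auto
    have skip: "J (Suc k) ?A" if "?A 15 ?x \<noteq> 0"
      using J that xn unfolding J_def by (auto simp: less_Suc_eq marked_def)
    have r: "regs st1 10 = 0" "regs st1 21 = ?L" using fr[of 10] fr[of 21] s0 by simp_all
    show "tot W root_step ?Q st1"
    proof (cases "?A 15 ?x = 0")
      case True
      show ?thesis unfolding tot_simps tot_When
        apply (subst if_P)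
        subgoal using True x14 mods small r r4 by simp
        apply (rule step[OF True])
        using fr r4 r x14 small mods by (simp_all del: One_nat_def)
    next
      case False
      then show ?thesis using fr r4 r x14 mods small skip by simp
    qed
  next
    fix st' :: ram
    assume J: "J (regs st0 21) (arrs st')" and fr: "\<And>x. x \<notin> insert 4 {11..17} \<Longrightarrow> regs st' x = regs st0 x"
      and t: "time st' + pot (arrs st0) \<le> time st0 + 6 + (\<Sum>k<regs st0 21. 40 + 8) + pot (arrs st')"
    have inv: "forest_inv (arrs st')" and prev: "\<And>j. j < ?L \<Longrightarrow> c ! (?L - Suc j) \<in> marked (arrs st' 15)"
      using J s0 unfolding J_def by auto
    have call: "c ! i \<in> marked (arrs st' 15)" if "i < ?L" for i
      using prev[of "?L - Suc i"] that by (simp add: Suc_diff_Suc)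
    have cl: "closed (marked (arrs st' 15))" and me: "marked (arrs st' 15) \<subseteq> ends es"
      and m16: "marked (arrs st' 16) \<subseteq> marked (arrs st' 15)"
      using inv unfolding forest_inv_def marked_def by blast+
    have e: "ends es \<subseteq> marked (arrs st' 15)"
    proof
      fix w assume "w \<in> ends es"
      then obtain x where "x \<in> set c" "(x, w) \<in> Flat\<^sup>*" using cr c(3) by blast
      then show "w \<in> marked (arrs st' 15)" using closed_path[OF cl] call by (metis in_set_conv_nth)
    qed
    have "card (marked (arrs st' 15)) \<le> m + m" "card (marked (arrs st' 16)) \<le> m + m"
      using card_mono[OF card_ends(1) me] card_mono[OF card_ends(1) subset_trans[OF m16 me]] card_ends(2)
      by linarith+
    then have "pot (arrs st') \<le> 14 * (m + m) + 40 * m + (14 * (m + m) + 40 * m)"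
      using deg_le(1)[of "marked (arrs st' 15)"] deg_le(2)[of "marked (arrs st' 16)"] unfolding pot_def by simp
    moreover have "time st' \<le> time st + 11 + ?L * 48 + pot (arrs st')" using t s0 by simp
    moreover have "?L * 48 \<le> (m + m) * 48" using c(2) by simp
    \<comment> \<open>At most \<open>2 * m\<close> iterations at 48 and two potentials of
      \<open>68 * m\<close> give \<open>232 * m\<close>, rounded up.\<close>
    ultimately have "time st' \<le> time st + 13 + 250 * m" by simp
    then show "?Post st'"
      using forest_final[OF inv e] J fr s0 by (simp add: J_def)
  qed (use LW small s0 in auto)
  show ?thesis unfolding Roots_def tot_simps by (rule loop) (use small env c14 in simp_all)
qed

end

section \<open>Running the greedy selection\<close>

abbreviation (input) last_set :: com where
  "last_set \<equiv> When (Arr 10 (cell 5 6)) (SetArr 17 (cell 5 8) (Bin Plus (Reg 4) (Num 1)))"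

abbreviation (input) last_step :: com where
  "last_step \<equiv> Seq (SetReg 6 (Arr 0 (Reg 4)))
    (Seq (SetReg 7 (Arr 1 (Reg 4)))
    (Seq (SetReg 8 (Arr 16 (Reg 7)))
    (When (Reg 8)
    (When (Bin Less (Arr 11 (Reg 6)) (Arr 11 (Reg 7)))
      (For 5 2 last_set)))))"

definition Last :: com where
  "Last = For 4 1 last_step"

abbreviation (input) demand_set :: com where
  "demand_set \<equiv> Seq (SetReg 7 (Arr 1 (Reg 5)))
        (When (Arr 10 (cell 4 7))
        (When (Arr 3 (cell 9 7))
          (SetArr 18 (Bin Plus (Bin Times (Reg 4) (Reg 0)) (Arr 15 (Reg 7))) (Num 1))))"

abbreviation (input) demand_step :: com where
  "demand_step \<equiv> Seq (SetReg 9 (Arr 2 (Reg 4)))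
      (For 5 1 demand_set)"

definition Demand :: com where
  "Demand = For 4 2 demand_step"

abbreviation (input) hit_step :: com where
  "hit_step \<equiv> When (Bin Equal (Arr 18 (cell 23 8)) (Num 1))
    (When (Bin Equal (Arr 17 (cell 23 8)) (Bin Plus (Reg 5) (Num 1)))
      (SetArr 21 (Num 0) (Num 1)))"

definition Hit :: com where
  "Hit = For 23 2 hit_step"

abbreviation (input) take_step :: com where
  "take_step \<equiv> When (Bin Equal (Arr 18 (cell 23 8)) (Num 1))
    (When (Arr 10 (cell 23 6))
      (Seq (SetArr 18 (cell 23 8) (Num 2)) (SetArr 18 (cell 23 24) (Num 1))))"

definition Take :: com where
  "Take = For 23 2 take_step"

definition Pick :: com where
  "Pick =
    Seq (SetReg 6 (Arr 0 (Reg 5)))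
    (Seq (SetReg 7 (Arr 1 (Reg 5)))
    (Seq (SetReg 8 (Arr 16 (Reg 7)))
    (When (Reg 8)
    (When (Bin Equal (Arr 11 (Reg 7)) (Reg 22))
    (When (Bin Less (Arr 11 (Reg 6)) (Reg 22))
      (Seq (SetArr 21 (Num 0) (Num 0))
      (Seq Hit
      (When (Arr 21 (Num 0))
        (Seq (SetArr 4 (Reg 5) (Num 1))
        (Seq (SetReg 24 (Arr 15 (Reg 6))) Take))))))))))"

definition Choose :: com where
  "Choose = For 4 2 (Seq (SetReg 22 (Bin Minus (Reg 2) (Reg 4))) (For 5 1 Pick))"

locale rp_forest = rp_run + ff: flat_forest es ss P rt cp F for rt cp :: "nat \<Rightarrow> nat" and F :: "nat set"
begin

definition ready :: "(nat \<Rightarrow> nat \<Rightarrow> nat) \<Rightarrow> bool" where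
  "ready A \<longleftrightarrow> loaded A \<and> reached A \<and> leveled A \<and> A 15 = rt \<and> A 16 = cp"

lemma ready_cong:
  assumes "ready A" "\<And>a. a \<in> {0, 1, 2, 3, 10, 11, 15, 16} \<Longrightarrow> A' a = A a"
  shows "ready A'"
  using assms by (simp add: ready_def loaded_def reached_def leveled_def)

lemma rt_range:
  assumes "v \<in> ends es"
  shows "0 < rt v" "rt v \<le> n"
proof -
  show p: "0 < rt v" using ff.rt_nonzero[OF assms] by simp
  have "(rt v - 1, v) \<in> (set es)\<^sup>*" using ff.F_path_E[OF ff.rt_path[OF assms]] .
  then have "rt v - 1 < n"
    by (cases rule: converse_rtranclE) (use assms ends_bound in \<open>force simp: ends_def\<close>)+
  then show "rt v \<le> n" by simp
qed

lemma cp_range: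
  assumes "e < m"
  shows "cp (dst e) \<le> n"
proof (cases "cp (dst e) = 0")
  case False
  have "(dst e, cp (dst e) - 1) \<in> (set es)\<^sup>*" using ff.F_path_E[OF ff.cp_path[OF False]] .
  then have "cp (dst e) - 1 < n"
  proof (cases rule: rtranclE)
    case base
    then show ?thesis using edge_bound(2)[OF assms] by simp
  next
    case (step y)
    then have "cp (dst e) - 1 \<in> ends es" by (force simp: ends_def)
    then show ?thesis by (rule ends_bound)
  qed
  then show ?thesis by simp
qed simp

lemma ready_edge:
  assumes "ready A" "e < m"
  shows "A 0 e = src e" "A 1 e = dst e" "A 16 (dst e) = cp (dst e)" "A 11 (src e) = lev (src e)"
    "A 11 (dst e) = lev (dst e)" "A 15 (src e) = rt (src e)" "A 15 (dst e) = rt (dst e)"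
    "i < s \<Longrightarrow> A 10 (i * n + src e) = of_bool (R i (src e))"
    "i < s \<Longrightarrow> A 10 (i * n + dst e) = of_bool (R i (dst e))"
    "i < s \<Longrightarrow> A 3 (ss ! i * n + dst e) = of_bool ((ss ! i, dst e) \<in> P)"
    "i < s \<Longrightarrow> A 2 i = ss ! i"
  using assms edge_bound ss_bound ff.src_ends ff.dst_ends
  by (auto simp: ready_def loaded_def reached_def leveled_def)

text \<open>0 means that there is none and \<open>Suc e\<close> is the edge \<open>e\<close>. This
  is the content of a cell that each covering edge overwrites in order of its index.\<close>

primrec latest :: "nat \<Rightarrow> nat \<Rightarrow> nat \<Rightarrow> nat" where
  "latest 0 i r = 0"
| "latest (Suc k) i r = (if ff.covers i r k then Suc k else latest k i r)"

lemma latest_eq: "latest k i r = Suc e \<longleftrightarrow> e < k \<and> ff.covers i r e \<and> (\<forall>e'<k. ff.covers i r e' \<longrightarrow> e' \<le> e)"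
proof (induction k)
  case (Suc k)
  then show ?case by (auto simp: less_Suc_eq)
qed simp

lemma latest_last: "latest m i r = Suc e \<longleftrightarrow> ff.last_cover i r e"
  unfolding latest_eq ff.last_cover_def by (auto simp: ff.covers_def ff.rising_def)

definition last_rep :: "nat \<Rightarrow> (nat \<Rightarrow> nat \<Rightarrow> nat) \<Rightarrow> bool" where
  "last_rep k A \<longleftrightarrow> (\<forall>i<s. \<forall>r. 0 < r \<longrightarrow> r \<le> n \<longrightarrow> A 17 (i * n + r) = latest k i r)"

definition need_rep :: "(nat \<Rightarrow> nat \<Rightarrow> nat) \<Rightarrow> (nat \<Rightarrow> nat \<Rightarrow> nat) \<Rightarrow> bool" where
  "need_rep N A \<longleftrightarrow> (\<forall>i<s. \<forall>r. 0 < r \<longrightarrow> r \<le> n \<longrightarrow> A 18 (i * n + r) = N i r)"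

lemma tot_Last:
  assumes "env st" and rd: "ready (arrs st)" and zero: "arrs st 17 = (\<lambda>_. 0)"
  shows "tot W Last (\<lambda>st'. last_rep m (arrs st') \<and> (agree_but 17 (arrs st') (arrs st)) \<and>
    inputs st' st \<and> time st' \<le> time st + 6 + m * (32 + 24 * s)) st"
    (is "tot _ _ ?Post _")
proof -
  define J where "J k A \<longleftrightarrow> last_rep k A \<and> (agree_but 17 A (arrs st))"
    for k and A :: "nat \<Rightarrow> nat \<Rightarrow> nat"
  note env = envD[OF assms(1)]
  show ?thesis unfolding Last_def
  proof (rule tot_For[where J = J and U = "{4..19}" and B = "24 + 24 * s"])
    show "J 0 (arrs st)" using zero by (simp add: J_def last_rep_def)
    fix k and st1 :: ram
    assume k: "k < regs st 1" and J: "J k (arrs st1)" and r4: "regs st1 4 = k"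
      and fr: "\<And>x. x \<notin> {4..19} \<Longrightarrow> regs st1 x = regs st x"
    have km: "k < m" using k env by simp
    let ?x = "src k" and ?y = "dst k"
    let ?Q = "\<lambda>st'. J (Suc k) (arrs st') \<and> regs st' 4 = k \<and> agree {4..19} (regs st') (regs st) \<and>
        time st' \<le> time st1 + (24 + 24 * s)"
    have rd1: "ready (arrs st1)" by (rule ready_cong[OF rd]) (use J in \<open>auto simp: J_def\<close>)
    note A = ready_edge[OF rd1 km]
    have bd: "?x < n" "?x \<le> n" "cp ?y \<le> n" using edge_bound[OF km] cp_range[OF km] by auto
    have skip: "J (Suc k) (arrs st1)" if "\<not> ff.rising k"
      using J that by (auto simp: J_def last_rep_def ff.covers_def)
    \<comment> \<open>Inside the loop over the sources, the rows below \<open>i0\<close> already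
      take edge \<open>k\<close> into account.\<close>
    define G where "G i0 A \<longleftrightarrow>
      (\<forall>i<s. \<forall>r. 0 < r \<longrightarrow> r \<le> n \<longrightarrow> A 17 (i * n + r) = latest (if i < i0 then Suc k else k) i r) \<and>
      (agree_but 17 A (arrs st))" for i0 and A :: "nat \<Rightarrow> nat \<Rightarrow> nat"
    have inner: "tot W (For 5 2 last_set) ?Q st2"
      if ris: "ff.rising k" and s2: "arrs st2 = arrs st1" "regs st2 6 = ?x" "regs st2 8 = cp ?y" "regs st2 4 = k"
        "agree {4..19} (regs st2) (regs st)" "time st2 \<le> time st1 + 17" for st2
    proof (rule tot_For[where U = "{5}" and B = 16 and
          J = G])
      show "G 0 (arrs st2)"
        using J s2(1) by (simp add: J_def last_rep_def G_def)
      show "regs st2 2 < W" using s2 env small by simp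
      fix i0 and st3 :: ram
      assume i0: "i0 < regs st2 2" and r5: "regs st3 5 = i0" and fr3: "\<And>x. x \<notin> {5} \<Longrightarrow> regs st3 x = regs st2 x"
        and A3: "G i0 (arrs st3)"
      have il: "i0 < s" using i0 s2 env by simp
      have r: "regs st3 0 = n" "regs st3 6 = ?x" "regs st3 8 = cp ?y" "regs st3 4 = k"
        using fr3 s2 env by simp_all
      have a10: "arrs st3 10 (i0 * n + ?x) = of_bool (R i0 ?x)"
        using A(8)[OF il] A3 J by (simp add: J_def G_def)
      have cpos: "0 < cp ?y" using ris by (simp add: ff.rising_def)
      have mods: "(k + 1) mod W = Suc k" using km small by simp
      have yes: "G (Suc i0) ((arrs st3)(17 := (arrs st3 17)(i0 * n + cp ?y := Suc k)))" if "R i0 ?x"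
        using A3 il bd(3) cpos ris that by (auto simp: G_def ff.covers_def less_Suc_eq)
      have no: "G (Suc i0) (arrs st3)" if "\<not> R i0 ?x"
        using A3 that by (auto simp: G_def ff.covers_def less_Suc_eq)
      show "tot W last_set
        (\<lambda>st'. G (Suc i0) (arrs st') \<and>
          regs st' 5 = i0 \<and> agree {5} (regs st') (regs st2) \<and> time st' \<le> time st3 + 16) st3"
      proof (cases "R i0 ?x")
        case True
        then show ?thesis using fr3 yes[OF True] il bd small
          by (simp add: r r5 a10 mods del: One_nat_def)
      next
        case False
        then show ?thesis using fr3 no[OF False] il bd by (simp add: r r5 a10)
      qed
    next
      fix st' :: ram
      assume A': "G (regs st2 2) (arrs st')"
        and fr3: "\<And>x. x \<notin> {5} \<Longrightarrow> regs st' x = regs st2 x"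
        and t: "time st' \<le> time st2 + 6 + regs st2 2 * (16 + 8)"
      have s2s: "regs st2 2 = s" using s2 env by simp
      have "J (Suc k) (arrs st')" using A' s2s by (auto simp: J_def last_rep_def G_def)
      then show "?Q st'" using fr3 s2 t s2s by auto
    qed (use small in auto)
    show "tot W last_step
      ?Q st1"
    proof (cases "ff.rising k")
      case True
      then have "cp ?y \<noteq> 0" "lev ?x < lev ?y" by (auto simp: ff.rising_def)
      show ?thesis unfolding tot_simps tot_When
        apply (subst if_P)
        subgoal using A \<open>cp ?y \<noteq> 0\<close> \<open>lev ?x < lev ?y\<close> r4 small by simp
        apply (subst if_P)
        subgoal using A \<open>cp ?y \<noteq> 0\<close> \<open>lev ?x < lev ?y\<close> r4 small by simp
        apply (rule inner[OF True])
        using fr r4 A by (simp_all del: One_nat_def)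
    next
      case False
      then have "cp ?y = 0 \<or> \<not> lev ?x < lev ?y" using km by (auto simp: ff.rising_def)
      then show ?thesis using skip[OF False] fr r4 A small by (auto simp del: One_nat_def)
    qed
  next
    fix st' :: ram
    assume J: "J (regs st 1) (arrs st')" and fr: "\<And>x. x \<notin> {4..19} \<Longrightarrow> regs st' x = regs st x"
      and t: "time st' \<le> time st + 6 + regs st 1 * (24 + 24 * s + 8)"
    then show "?Post st'"
      using env by (simp add: J_def algebra_simps)
  qed (use env small in auto)
qed

text \<open>The table of \<open>P\<close> is read only at the heads of edges, \<open>m\<close> times
  per source, so the time does not depend on the size of \<open>P\<close>.\<close>

lemma tot_Demand:
  assumes "env st" and rd: "ready (arrs st)" and zero: "arrs st 18 = (\<lambda>_. 0)"
  shows "tot W Demand (\<lambda>st'. need_rep (\<lambda>i r. of_bool (\<exists>t. ff.demand i t \<and> rt t = r)) (arrs st') \<and>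
    (agree_but 18 (arrs st') (arrs st)) \<and>
    inputs st' st \<and> time st' \<le> time st + 6 + s * (18 + 34 * m)) st"
    (is "tot _ _ ?Post _")
proof -
  define rep where "rep Z A \<longleftrightarrow> need_rep (\<lambda>i r. of_bool (Z i r)) A \<and> (agree_but 18 A (arrs st))"
    for Z and A :: "nat \<Rightarrow> nat \<Rightarrow> nat"
  \<comment> \<open>The progress of the two nested loops: all rows below \<open>k\<close> are
    complete, and row \<open>k\<close> is complete up to edge \<open>e\<close>.\<close>
  define Z where "Z k e i r \<longleftrightarrow> (i < k \<and> (\<exists>t. ff.demand i t \<and> rt t = r)) \<or>
    (i = k \<and> (\<exists>e'<e. ff.demand i (dst e') \<and> rt (dst e') = r))" for k e i r
  have Zm: "Z k m = Z (Suc k) 0" for k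
  proof (intro ext)
    fix i r
    have "(\<exists>e'<m. ff.demand i (dst e') \<and> rt (dst e') = r) \<longleftrightarrow> (\<exists>t. ff.demand i t \<and> rt t = r)"
    proof
      assume "\<exists>t. ff.demand i t \<and> rt t = r"
      then obtain t where t: "ff.demand i t" "rt t = r" by blast
      then obtain e' where "e' < m" "dst e' = t" by (auto simp: ff.demand_def in_set_conv_nth)
      then show "\<exists>e'<m. ff.demand i (dst e') \<and> rt (dst e') = r" using t by blast
    qed blast
    then show "Z k m i r = Z (Suc k) 0 i r" by (auto simp: Z_def less_Suc_eq)
  qed
  note env = envD[OF assms(1)]
  show ?thesis unfolding Demand_def
  proof (rule tot_For[where J = "\<lambda>k. rep (Z k 0)" and U = "{4..19}" and B = "10 + 34 * m"])
    show "rep (Z 0 0) (arrs st)" using zero by (simp add: rep_def need_rep_def Z_def)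
    fix k and st1 :: ram
    assume k: "k < regs st 2" and J: "rep (Z k 0) (arrs st1)" and r4: "regs st1 4 = k"
      and fr: "\<And>x. x \<notin> {4..19} \<Longrightarrow> regs st1 x = regs st x"
    have ks: "k < s" using k env by simp
    let ?Q = "\<lambda>st'. rep (Z (Suc k) 0) (arrs st') \<and> regs st' 4 = k \<and> agree {4..19} (regs st') (regs st) \<and>
        time st' \<le> time st1 + (10 + 34 * m)"
    let ?inner = "Seq (SetReg 7 (Arr 1 (Reg 5)))
        (When (Arr 10 (cell 4 7))
        (When (Arr 3 (cell 9 7))
          (SetArr 18 (Bin Plus (Bin Times (Reg 4) (Reg 0)) (Arr 15 (Reg 7))) (Num 1))))"
    have rd1: "ready (arrs st1)" by (rule ready_cong[OF rd]) (use J in \<open>auto simp: rep_def\<close>)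
    have inner: "tot W (For 5 1 ?inner) ?Q st2"
      if s2: "arrs st2 = arrs st1" "regs st2 9 = ss ! k" "regs st2 4 = k"
        "agree {4..19} (regs st2) (regs st)" "time st2 \<le> time st1 + 3" for st2
    proof (rule tot_For[where U = "{5, 7}" and B = 26 and J = "\<lambda>e. rep (Z k e)"])
      show "rep (Z k 0) (arrs st2)" using J s2(1) by simp
      show "regs st2 1 < W" using s2 env small by simp
      fix e and st3 :: ram
      assume e: "e < regs st2 1" and A3: "rep (Z k e) (arrs st3)" and r5: "regs st3 5 = e"
        and fr3: "\<And>x. x \<notin> {5, 7} \<Longrightarrow> regs st3 x = regs st2 x"
      have em: "e < m" using e s2 env by simp
      have r: "regs st3 0 = n" "regs st3 9 = ss ! k" "regs st3 4 = k" using fr3 s2 env by simp_all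
      have rd3: "ready (arrs st3)" by (rule ready_cong[OF rd]) (use A3 in \<open>auto simp: rep_def\<close>)
      note A = ready_edge[OF rd3 em]
      let ?y = "dst e"
      have y: "?y < n" "?y \<le> n" "ss ! k < n" using edge_bound[OF em] ss_bound[OF ks] by auto
      have ry: "0 < rt ?y" "rt ?y \<le> n" using rt_range[OF ff.dst_ends[OF em]] .
      have dm: "ff.demand k ?y \<longleftrightarrow> R k ?y \<and> (ss ! k, ?y) \<in> P"
        using em by (auto simp: ff.demand_def)
      have yes: "rep (Z k (Suc e)) ((arrs st3)(18 := (arrs st3 18)(k * n + rt ?y := 1)))"
        if "ff.demand k ?y"
        using A3 that ks ry by (auto simp: rep_def need_rep_def Z_def less_Suc_eq)
      have no: "rep (Z k (Suc e)) (arrs st3)" if "\<not> ff.demand k ?y"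
      proof -
        have "Z k (Suc e) = Z k e" using that by (auto simp: Z_def less_Suc_eq fun_eq_iff)
        then show ?thesis using A3 by simp
      qed
      show "tot W ?inner (\<lambda>st'. rep (Z k (Suc e)) (arrs st') \<and>
          regs st' 5 = e \<and> agree {5, 7} (regs st') (regs st2) \<and> time st' \<le> time st3 + 26) st3"
      proof (cases "ff.demand k ?y")
        case True
        then show ?thesis using fr3 yes ks y ry dm small
          by (simp add: r r5 A del: One_nat_def)
      next
        case False
        then show ?thesis using fr3 no ks y ry dm small by (auto simp add: r r5 A simp del: One_nat_def)
      qed
    next
      fix st' :: ram
      assume A': "rep (Z k (regs st2 1)) (arrs st')"
        and fr3: "\<And>x. x \<notin> {5, 7} \<Longrightarrow> regs st' x = regs st2 x"
        and t: "time st' \<le> time st2 + 6 + regs st2 1 * (26 + 8)"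
      have s2s: "regs st2 1 = m" using s2 env by simp
      then show "?Q st'" using A' fr3 s2 t Zm by auto
    qed (use small in auto)
    show "tot W (Seq (SetReg 9 (Arr 2 (Reg 4))) (For 5 1 ?inner)) ?Q st1"
      unfolding tot_simps by (rule inner) (use fr r4 rd1 ks in \<open>simp_all add: ready_def loaded_def\<close>)
  next
    fix st' :: ram
    assume J: "rep (Z (regs st 2) 0) (arrs st')" and fr: "\<And>x. x \<notin> {4..19} \<Longrightarrow> regs st' x = regs st x"
      and t: "time st' \<le> time st + 6 + regs st 2 * (10 + 34 * m + 8)"
    have "Z s 0 i r \<longleftrightarrow> (\<exists>t. ff.demand i t \<and> rt t = r)" for i r
      by (auto simp: Z_def ff.demand_def reach_def)
    then show "?Post st'"
      using J fr t env by (simp add: rep_def algebra_simps)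
  qed (use env small in auto)
qed

text \<open>The last covering edge does not depend on the selection, so deciding whether
  \<open>e\<close> is forced takes two table lookups per source.\<close>

lemma tot_Hit:
  assumes reg: "regs st 0 = n" "regs st 2 = s" "regs st 5 = e" "regs st 8 = r" and e: "e < m" and r: "0 < r" "r \<le> n"
    and N: "need_rep N (arrs st)" and L: "last_rep m (arrs st)" and z: "arrs st 21 0 = 0"
  shows "tot W Hit (\<lambda>st'. (arrs st' 21 0 \<noteq> 0 \<longleftrightarrow> (\<exists>i<s. N i r = 1 \<and> ff.last_cover i r e)) \<and>
    (agree_but 21 (arrs st') (arrs st)) \<and>
    (agree_but 23 (regs st') (regs st)) \<and> time st' \<le> time st + 6 + 32 * s) st"
    (is "tot _ _ ?Post _")
proof -
  define G where "G k A \<longleftrightarrow> (A 21 0 \<noteq> 0 \<longleftrightarrow> (\<exists>i<k. N i r = 1 \<and> ff.last_cover i r e)) \<and>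
    (agree_but 21 A (arrs st))" for k :: nat and A :: "nat \<Rightarrow> nat \<Rightarrow> nat"
  show ?thesis unfolding Hit_def
  proof (rule tot_For[where U = "{23}" and B = 24 and J = G])
  fix k and st1 :: ram
  assume k: "k < regs st 2" and r23: "regs st1 23 = k" and fr: "\<And>x. x \<notin> {23} \<Longrightarrow> regs st1 x = regs st x"
    and J: "G k (arrs st1)"
  have ks: "k < s" using k reg by simp
  have A: "arrs st1 18 (k * n + r) = N k r" "arrs st1 17 (k * n + r) = latest m k r"
    using J N L ks r by (simp_all add: need_rep_def last_rep_def G_def)
  have g: "regs st1 0 = n" "regs st1 5 = e" "regs st1 8 = r" using fr reg by simp_all
  have mods: "(e + 1) mod W = Suc e" using e small by simp
  show "tot W hit_step
    (\<lambda>st'. G (Suc k) (arrs st') \<and> regs st' 23 = k \<and>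
      agree {23} (regs st') (regs st) \<and> time st' \<le> time st1 + 24) st1"
  proof (cases "N k r = 1 \<and> ff.last_cover k r e")
    case True
    then have "latest m k r = Suc e" using latest_last by blast
    moreover have "\<exists>i<Suc k. N i r = 1 \<and> ff.last_cover i r e" using True by blast
    then have "G (Suc k) ((arrs st1)(21 := (arrs st1 21)(0 := 1)))" using J by (simp add: G_def)
    ultimately show ?thesis using True fr ks r small
      by (simp add: g r23 A mods del: One_nat_def)
  next
    case False
    then have no: "\<not> (N k r = 1 \<and> latest m k r = Suc e)" using latest_last by blast
    have "(\<exists>i<Suc k. N i r = 1 \<and> ff.last_cover i r e) \<longleftrightarrow> (\<exists>i<k. N i r = 1 \<and> ff.last_cover i r e)"
      using False by (auto simp: less_Suc_eq)
    then have "G (Suc k) (arrs st1)" using J by (simp add: G_def)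
    then show ?thesis using no fr ks r small
      by (auto simp add: g r23 A mods simp del: One_nat_def)
  qed
next
  fix st' :: ram
  assume "G (regs st 2) (arrs st')" "\<And>x. x \<notin> {23} \<Longrightarrow> regs st' x = regs st x"
    "time st' \<le> time st + 6 + regs st 2 * (24 + 8)"
  then show "?Post st'"
    using reg by (simp add: G_def)
  qed (use reg small z in \<open>auto simp: G_def\<close>)
qed

lemma tot_Take:
  assumes reg: "regs st 0 = n" "regs st 2 = s" "regs st 6 = src e" "regs st 8 = cp (dst e)"
      "regs st 24 = rt (src e)"
    and e: "ff.rising e" and rd: "ready (arrs st)" and N: "need_rep N (arrs st)"
  shows "tot W Take (\<lambda>st'. need_rep (ff.satisfy e N) (arrs st') \<and>
    (agree_but 18 (arrs st') (arrs st)) \<and>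
    (agree_but 23 (regs st') (regs st)) \<and> time st' \<le> time st + 6 + 40 * s) st"
    (is "tot _ _ ?Post _")
proof -
  let ?r = "cp (dst e)" and ?q = "rt (src e)"
  let ?N = "\<lambda>k i r. if i < k then ff.satisfy e N i r else N i r"
  have em: "e < m" using e by (simp add: ff.rising_def)
  have r: "0 < ?r" "?r \<le> n" using e cp_range[OF em] by (simp_all add: ff.rising_def)
  have q: "0 < ?q" "?q \<le> n" using rt_range ff.src_ends[OF em] by blast+
  have "lev (?r - 1) = lev (dst e)" "lev (?q - 1) = lev (src e)"
    using ff.rising_lev_into[OF e] ff.lev_rt[OF ff.src_ends[OF em]] by auto
  \<comment> \<open>The two roots lie on different levels, so the two writes of a row go to
    different cells.\<close>
  then have ne: "?q \<noteq> ?r" using e by (auto simp: ff.rising_def)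
  have sx: "src e < n" using edge_bound[OF em] by simp
  define G where "G k A \<longleftrightarrow> need_rep (?N k) A \<and> (agree_but 18 A (arrs st))"
    for k and A :: "nat \<Rightarrow> nat \<Rightarrow> nat"
  show ?thesis unfolding Take_def
  proof (rule tot_For[where U = "{23}" and B = 32 and J = G])
    fix k and st1 :: ram
    assume k: "k < regs st 2" and r23: "regs st1 23 = k" and fr: "\<And>x. x \<notin> {23} \<Longrightarrow> regs st1 x = regs st x"
      and J: "G k (arrs st1)"
    have ks: "k < s" using k reg by simp
    have A: "arrs st1 18 (k * n + ?r) = N k ?r" "arrs st1 10 (k * n + src e) = of_bool (R k (src e))"
      using J ks r ready_edge(8)[OF rd em ks] by (simp_all add: need_rep_def G_def)
    have g: "regs st1 0 = n" "regs st1 6 = src e" "regs st1 8 = ?r" "regs st1 24 = ?q" using fr reg by simp_all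
    have yes: "G (Suc k) ((arrs st1)(18 := (arrs st1 18)(k * n + ?r := 2, k * n + ?q := 1)))"
      if "N k ?r = 1" "R k (src e)"
      using J ks r q ne that by (auto simp: G_def need_rep_def ff.satisfy_def less_Suc_eq)
    have no: "G (Suc k) (arrs st1)" if "\<not> (N k ?r = 1 \<and> R k (src e))"
      using J that by (auto simp: G_def need_rep_def ff.satisfy_def less_Suc_eq)
    show "tot W take_step
      (\<lambda>st'. G (Suc k) (arrs st') \<and> regs st' 23 = k \<and>
        agree {23} (regs st') (regs st) \<and> time st' \<le> time st1 + 32) st1"
    proof (cases "N k ?r = 1 \<and> R k (src e)")
      case True
      then have "G (Suc k) ((arrs st1)(18 := (arrs st1 18)(k * n + ?r := 2, k * n + ?q := 1)))"
        using yes by blast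
      then show ?thesis using True fr ks r q small sx
        by (simp add: g r23 A less_imp_le del: One_nat_def)
    next
      case False
      have "G (Suc k) (arrs st1)" using no[OF False] .
      then show ?thesis using False fr ks r q small sx
        by (auto simp add: g r23 A less_imp_le simp del: One_nat_def)
    qed
  next
    fix st' :: ram
    assume h: "G (regs st 2) (arrs st')"
      "\<And>x. x \<notin> {23} \<Longrightarrow> regs st' x = regs st x" "time st' \<le> time st + 6 + regs st 2 * (32 + 8)"
    then have "need_rep (ff.satisfy e N) (arrs st')" using reg by (simp add: need_rep_def G_def)
    then show "?Post st'"
      using h reg by (simp add: G_def)
  qed (use reg small N in \<open>auto simp: G_def\<close>)
qed

text \<open>A position in the scan by falling level and, within a level, by rising index, as
  \<open>greedy_inv_take\<close> requires.\<close>

definition scanned :: "nat \<Rightarrow> nat \<Rightarrow> nat set" where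
  "scanned l e = {d. ff.rising d \<and> (l < lev (dst d) \<or> lev (dst d) = l \<and> d < e)}"

definition picked :: "nat set \<Rightarrow> (nat \<Rightarrow> nat \<Rightarrow> nat) \<Rightarrow> bool" where
  "picked D A \<longleftrightarrow> ready A \<and> last_rep m A \<and>
    (\<exists>N K pk. need_rep N A \<and> ff.greedy_inv N K pk D \<and> chosen (A 4) = F \<union> K)"

lemma need_rep_cong: "A 18 = A' 18 \<Longrightarrow> need_rep N A \<longleftrightarrow> need_rep N A'"
  by (simp add: need_rep_def)

lemma last_rep_cong: "A 17 = A' 17 \<Longrightarrow> last_rep k A \<longleftrightarrow> last_rep k A'"
  by (simp add: last_rep_def)

text \<open>The 30 pays for the level tests; only an edge whose head lies on the current level
  proceeds to the sources.\<close>

lemma tot_Pick: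
  assumes reg: "regs st 0 = n" "regs st 2 = s" "regs st 5 = e" "regs st 22 = l"
    and e: "e < m" and P: "picked (scanned l e) (arrs st)"
  shows "tot W Pick (\<lambda>st'. picked (scanned l (Suc e)) (arrs st') \<and>
    agree {4, 18, 21} (arrs st') (arrs st) \<and>
    agree {6, 7, 8, 23, 24} (regs st') (regs st) \<and>
    time st' \<le> time st + (30 + of_bool (lev (dst e) = l) * (40 + 72 * s))) st"
    (is "tot W Pick ?Q st")
proof -
  let ?x = "src e" and ?y = "dst e"
  have rd: "ready (arrs st)" and L: "last_rep m (arrs st)" using P by (auto simp: picked_def)
  obtain N K pk where N: "need_rep N (arrs st)" and inv: "ff.greedy_inv N K pk (scanned l e)"
    and ch: "chosen (arrs st 4) = F \<union> K" using P by (auto simp: picked_def)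
  note A = ready_edge[OF rd e]
  show ?thesis
  proof (cases "ff.rising e \<and> lev ?y = l")
    case False
    then have "scanned l (Suc e) = scanned l e" by (auto simp: scanned_def less_Suc_eq)
    then have P': "picked (scanned l (Suc e)) (arrs st)" using P by simp
    have "cp ?y = 0 \<or> lev ?y \<noteq> l \<or> \<not> lev ?x < l" using False e by (auto simp: ff.rising_def)
    then show ?thesis using P' small unfolding Pick_def
      by (auto simp add: reg A simp del: One_nat_def)
  next
    case True
    then have ris: "ff.rising e" and ll: "lev ?y = l" by auto
    then have cy: "cp ?y \<noteq> 0" "cp ?y \<le> n" "lev ?x < l" using cp_range[OF e] by (auto simp: ff.rising_def)
    have sc: "scanned l (Suc e) = insert e (scanned l e)"
      using ris ll by (auto simp: scanned_def less_Suc_eq)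
    have greedy_skip: "picked (scanned l (Suc e)) A'"
      if no: "\<not> (\<exists>i<s. N i (cp ?y) = 1 \<and> ff.last_cover i (cp ?y) e)"
        and A': "agree_but 21 A' (arrs st)" for A'
    proof -
      have "\<not> ff.last_cover i (cp ?y) e" if "N i (cp ?y) = 1" for i
        using no that by (auto simp: ff.last_cover_def ff.covers_def reach_def)
      then have "ff.greedy_inv N K pk (scanned l (Suc e))"
        unfolding sc by (intro ff.greedy_inv_skip inv ris) blast
      moreover have "ready A'" by (rule ready_cong[OF rd]) (use A' in auto)
      moreover have "need_rep N A'" "last_rep m A'"
        using N L A' need_rep_cong[of A' "arrs st"] last_rep_cong[of A' "arrs st"] by auto
      moreover have "chosen (A' 4) = F \<union> K" using ch A' by simp
      ultimately show ?thesis unfolding picked_def by blast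
    qed
    have greedy_take: "picked (scanned l (Suc e)) A'"
      if yes: "\<exists>i<s. N i (cp ?y) = 1 \<and> ff.last_cover i (cp ?y) e"
        and A': "agree {4, 18, 21} A' (arrs st)" "need_rep (ff.satisfy e N) A'"
          "A' 4 = (arrs st 4)(e := 1)" for A'
    proof -
      obtain i where i: "N i (cp ?y) = 1" "ff.last_cover i (cp ?y) e" using yes by blast
      have "ff.greedy_inv (ff.satisfy e N) (insert e K)
          (\<lambda>i r. if N i (cp ?y) = 1 \<and> R i ?x \<and> r = cp ?y then e else pk i r) (scanned l (Suc e))"
        unfolding sc
      proof (rule ff.greedy_inv_take[OF inv ris i])
        fix d assume d: "d \<in> scanned l e"
        then show "lev ?y \<le> lev (dst d)" using ll by (auto simp: scanned_def)
        assume "cp (dst d) = cp ?y"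
        \<comment> \<open>All heads in one component have the level of its root, so within a
          component the index alone decides the order.\<close>
        then have "lev (dst d) = lev ?y"
          using ff.rising_lev_into[of d] ff.rising_lev_into[OF ris] d by (simp add: scanned_def)
        then show "d < e" using d ll by (auto simp: scanned_def)
      qed
      moreover have "ready A'" by (rule ready_cong[OF rd]) (use A' in auto)
      moreover have "last_rep m A'" using L A' last_rep_cong[of A' "arrs st"] by auto
      moreover have "chosen (A' 4) = F \<union> insert e K" using ch A'(3) e by (auto simp: chosen_def)
      ultimately show ?thesis unfolding picked_def using A'(2) by blast
    qed
    have mid: "tot W (Seq Hit (When (Arr 21 (Num 0)) (Seq (SetArr 4 (Reg 5) (Num 1))
        (Seq (SetReg 24 (Arr 15 (Reg 6))) Take)))) ?Q st2"
      if s2: "arrs st2 = (arrs st)(21 := (arrs st 21)(0 := 0))"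
        "regs st2 = (regs st)(6 := ?x, 7 := ?y, 8 := cp ?y)" "time st2 \<le> time st + 30" for st2
    proof (rule tot_Seq_conseq[OF tot_Hit[where e = e and r = "cp ?y" and N = N]])
      show "need_rep N (arrs st2)" "last_rep m (arrs st2)"
        using N L s2 need_rep_cong[of "arrs st2" "arrs st"] last_rep_cong[of "arrs st2" "arrs st"] by auto
      fix st3 :: ram
      assume s3: "(arrs st3 21 0 \<noteq> 0 \<longleftrightarrow> (\<exists>i<s. N i (cp ?y) = 1 \<and> ff.last_cover i (cp ?y) e)) \<and>
        (agree_but 21 (arrs st3) (arrs st2)) \<and>
        (agree_but 23 (regs st3) (regs st2)) \<and> time st3 \<le> time st2 + 6 + 32 * s"
      have fr3: "agree_but 21 (arrs st3) (arrs st)" using s3 s2 by simp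
      have g3: "agree {6, 7, 8, 23, 24} (regs st3) (regs st)" "regs st3 6 = ?x" "regs st3 8 = cp ?y"
        "regs st3 5 = e" using s3 s2 reg by auto
      show "tot W (When (Arr 21 (Num 0)) (Seq (SetArr 4 (Reg 5) (Num 1))
        (Seq (SetReg 24 (Arr 15 (Reg 6))) Take))) ?Q st3"
      proof (cases "\<exists>i<s. N i (cp ?y) = 1 \<and> ff.last_cover i (cp ?y) e")
        case False
        have "picked (scanned l (Suc e)) (arrs st3)" by (rule greedy_skip[OF False fr3])
        moreover have "arrs st3 21 0 = 0" using s3 False by blast
        ultimately show ?thesis using s3 s2(3) fr3 g3 ll by simp
      next
        case yes: True
        have nz: "arrs st3 21 0 \<noteq> 0" using s3 yes by blast
        have take: "tot W Take ?Q st4"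
          if s4: "arrs st4 = (arrs st3)(4 := (arrs st3 4)(e := 1))" "regs st4 = (regs st3)(24 := rt ?x)"
            "time st4 \<le> time st3 + 12" for st4
        proof (rule tot_conseq[OF tot_Take[where e = e and N = N]])
          show "ready (arrs st4)" by (rule ready_cong[OF rd]) (use s4(1) fr3 in auto)
          show "need_rep N (arrs st4)" using N s4(1) fr3 need_rep_cong[of "arrs st4" "arrs st"] by auto
          fix st' :: ram
          assume s5: "need_rep (ff.satisfy e N) (arrs st') \<and>
            (agree_but 18 (arrs st') (arrs st4)) \<and>
            (agree_but 23 (regs st') (regs st4)) \<and> time st' \<le> time st4 + 6 + 40 * s"
          have fr5: "agree {4, 18, 21} (arrs st') (arrs st)" using s5 s4(1) fr3 by simp
          have "arrs st' 4 = (arrs st 4)(e := 1)" using s5 s4(1) fr3 by simp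
          then have "picked (scanned l (Suc e)) (arrs st')" using greedy_take[OF yes fr5] s5 by blast
          moreover have "agree {6, 7, 8, 23, 24} (regs st') (regs st)" using s5 s4(2) g3(1) by simp
          moreover have "time st' \<le> time st + (30 + of_bool (lev (dst e) = l) * (40 + 72 * s))"
            using s5 s4(3) s3 s2(3) ll by simp
          ultimately show "?Q st'" using fr5 by blast
        qed (use s4(2) g3 reg ris in simp_all)
        have a15: "arrs st3 15 ?x = rt ?x" using fr3 A by simp
        show ?thesis unfolding tot_simps tot_When
          apply (subst if_P)
          subgoal using nz small by simp
          apply (rule take)
          using g3 a15 small by (simp_all del: One_nat_def)
      qed
    qed (use s2 reg e cy in simp_all)
    show ?thesis unfolding Pick_def tot_simps tot_When
      apply (subst if_P)
      subgoal using A reg cy ll small by simp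
      apply (subst if_P)
      subgoal using A reg cy ll small by simp
      apply (subst if_P)
      subgoal using A reg cy ll small by simp
      apply (rule mid)
      using A reg small by (simp_all del: One_nat_def)
  qed
qed

text \<open>One pass over all edges for each level replaces sorting. The passes cost
  \<open>O(m * s)\<close>, and the \<open>O(s)\<close> work on an edge falls due only in the pass
  matching the level of its head.\<close>

lemma tot_Choose:
  assumes "env st" and rd: "ready (arrs st)" and L: "last_rep m (arrs st)"
    and N: "need_rep (\<lambda>i r. of_bool (\<exists>t. ff.demand i t \<and> rt t = r)) (arrs st)"
    and ch: "chosen (arrs st 4) = F"
  shows "tot W Choose (\<lambda>st'. (\<exists>N K pk. ff.greedy_inv N K pk (Collect ff.rising) \<and>
      chosen (arrs st' 4) = F \<union> K) \<and>
    time st' \<le> time st + 6 + 19 * s + 38 * m * s + m * (40 + 72 * s)) st"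
    (is "tot _ _ ?Post _")
proof -
  note env = envD[OF assms(1)]
  let ?B = "\<lambda>l e. 30 + of_bool (lev (dst e) = l) * (40 + 72 * s) :: nat"
  let ?C = "\<lambda>k. 11 + (\<Sum>e<m. ?B (s - k) e + 8)"
  show ?thesis unfolding Choose_def
  proof (rule tot_For_amortized[where U = "{4..24}" and J = "\<lambda>k. picked {d. ff.rising d \<and> s - k < lev (dst d)}"
        and B = ?C and \<Phi> = "\<lambda>_. 0"])
    \<comment> \<open>No level exceeds the number of sources, so nothing counts as scanned before
      the first pass.\<close>
    have e: "{d. ff.rising d \<and> s - 0 < lev (dst d)} = {}" using level_le[of es ss] by (auto simp: not_less)
    show "picked {d. ff.rising d \<and> s - 0 < lev (dst d)} (arrs st)"
      unfolding picked_def e using rd L N ch ff.greedy_inv_init[of undefined] by blast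
    fix k and st1 :: ram
    assume k: "k < regs st 2" and J: "picked {d. ff.rising d \<and> s - k < lev (dst d)} (arrs st1)"
      and r4: "regs st1 4 = k" and fr: "\<And>x. x \<notin> {4..24} \<Longrightarrow> regs st1 x = regs st x"
    have ks: "k < s" using k env by simp
    let ?l = "s - k"
    let ?Q = "\<lambda>st'. picked {d. ff.rising d \<and> s - Suc k < lev (dst d)} (arrs st') \<and> regs st' 4 = k \<and>
      agree {4..24} (regs st') (regs st) \<and> time st' + 0 \<le> time st1 + ?C k + 0"
    have inner: "tot W (For 5 1 Pick) ?Q st2"
      if s2: "arrs st2 = arrs st1" "regs st2 = (regs st1)(22 := ?l)" "time st2 \<le> time st1 + 4" for st2
    proof (rule tot_For_amortized[where U = "{5, 6, 7, 8, 23, 24}" and J = "\<lambda>e. picked (scanned ?l e)"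
          and B = "?B ?l" and \<Phi> = "\<lambda>_. 0"])
      have "scanned ?l 0 = {d. ff.rising d \<and> s - k < lev (dst d)}" by (auto simp: scanned_def)
      then show "picked (scanned ?l 0) (arrs st2)" using J s2(1) by simp
      show "regs st2 1 < W" using s2 fr env small by simp
      fix e and st3 :: ram
      assume e: "e < regs st2 1" and P3: "picked (scanned ?l e) (arrs st3)" and r5: "regs st3 5 = e"
        and fr3: "\<And>x. x \<notin> {5, 6, 7, 8, 23, 24} \<Longrightarrow> regs st3 x = regs st2 x"
      have em: "e < m" using e s2 fr env by simp
      have g: "regs st3 0 = n" "regs st3 2 = s" "regs st3 22 = ?l" using fr3 s2(2) fr env by simp_all
      show "tot W Pick (\<lambda>st'. picked (scanned ?l (Suc e)) (arrs st') \<and> regs st' 5 = e \<and>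
        agree {5, 6, 7, 8, 23, 24} (regs st') (regs st2) \<and> time st' + 0 \<le> time st3 + ?B ?l e + 0) st3"
        by (rule tot_conseq[OF tot_Pick[OF g(1,2) r5 g(3) em P3]]) (use r5 fr3 in auto)
    next
      fix st' :: ram
      assume P': "picked (scanned ?l (regs st2 1)) (arrs st')"
        and fr3: "\<And>x. x \<notin> {5, 6, 7, 8, 23, 24} \<Longrightarrow> regs st' x = regs st2 x"
        and t: "time st' + 0 \<le> time st2 + 6 + (\<Sum>e<regs st2 1. ?B ?l e + 8) + 0"
      have r1: "regs st2 1 = m" using s2 fr env by simp
      have "scanned ?l m = {d. ff.rising d \<and> s - Suc k < lev (dst d)}"
        using ks by (auto simp: scanned_def ff.rising_def)
      then have "picked {d. ff.rising d \<and> s - Suc k < lev (dst d)} (arrs st')" using P' r1 by simp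
      moreover have "time st' + 0 \<le> time st1 + ?C k + 0" using t s2(3) unfolding r1 by linarith
      moreover have "regs st' 4 = k" "agree {4..24} (regs st') (regs st)"
        using fr3 s2(2) r4 fr by auto
      ultimately show "?Q st'" by blast
    qed (use small in auto)
    have "(s - k) mod W = s - k" "regs st1 2 = s" using small fr env by auto
    then show "tot W (Seq (SetReg 22 (Bin Minus (Reg 2) (Reg 4))) (For 5 1 Pick)) ?Q st1"
      unfolding tot_simps by (intro inner) (use r4 in simp_all)
  next
    fix st' :: ram
    assume J: "picked {d. ff.rising d \<and> s - regs st 2 < lev (dst d)} (arrs st')"
      and t: "time st' + 0 \<le> time st + 6 + (\<Sum>k<regs st 2. ?C k + 8) + 0"
    \<comment> \<open>The head of a rising edge has positive level, so the passes for the levels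
      \<open>s\<close> down to 1 meet every rising edge.\<close>
    have "{d. ff.rising d \<and> s - s < lev (dst d)} = Collect ff.rising" by (auto simp: ff.rising_def)
    then have fin: "\<exists>N K pk. ff.greedy_inv N K pk (Collect ff.rising) \<and> chosen (arrs st' 4) = F \<union> K"
      using J env unfolding picked_def by auto
    have one: "(\<Sum>k<s. of_bool (lev (dst e) = s - k) :: nat) \<le> 1" for e
    proof -
      have "(\<Sum>k<s. of_bool (lev (dst e) = s - k) :: nat) = card {k. k < s \<and> lev (dst e) = s - k}"
        by (simp add: of_bool_def sum.If_cases Int_def)
      also have "\<dots> \<le> card {s - lev (dst e)}" by (rule card_mono) auto
      finally show ?thesis by simp
    qed
    have "(\<Sum>k<s. ?C k + 8) = 19 * s + (\<Sum>k<s. \<Sum>e<m. 38 + of_bool (lev (dst e) = s - k) * (40 + 72 * s))"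
      by (simp add: sum.distrib)
    also have "(\<Sum>k<s. \<Sum>e<m. 38 + of_bool (lev (dst e) = s - k) * (40 + 72 * s)) =
        38 * m * s + (\<Sum>e<m. (\<Sum>k<s. of_bool (lev (dst e) = s - k)) * (40 + 72 * s))"
      by (subst sum.swap) (simp add: sum.distrib sum_distrib_right)
    also have "\<dots> \<le> 38 * m * s + (\<Sum>e<m. 1 * (40 + 72 * s))"
      by (intro add_left_mono sum_mono mult_right_mono one) simp
    finally have "(\<Sum>k<s. ?C k + 8) \<le> 19 * s + 38 * m * s + m * (40 + 72 * s)" by simp
    then show "?Post st'"
      using fin t env by simp
  qed (use env small in auto)
qed

end

section \<open>The whole program\<close>

definition Main :: com where
  "Main = Seq Build (Seq Reach (Seq Levels (Seq Cands (Seq Roots (Seq Last (Seq Demand Choose))))))"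

text \<open>Without two nodes, an edge and a pair, the empty output is correct. These cases are
  split off because \<open>|E| |S| log n\<close> can vanish there, and because \<open>f\<close> need
  not reach \<open>n - 1\<close> without a pair.\<close>

definition Program :: com where
  "Program = When (Bin Less (Num 1) (Reg 0)) (When (Reg 1) (When (Reg 3) Main))"

context rp_run
begin

section \<open>Correctness, size and running time of the whole program\<close>

definition solved :: "ram \<Rightarrow> bool" where
  "solved st \<longleftrightarrow> (\<exists>rt cp F N K pk. flat_forest es ss rt cp F \<and>
    flat_forest.greedy_inv es ss P rt cp N K pk (Collect (flat_forest.rising es ss cp)) \<and>
    chosen (arrs st 4) = F \<union> K \<and> card F \<le> 2 * n)"

lemma tot_Main:
  assumes env: "env st" and ld: "loaded (arrs st)" and zero: "\<And>a. 4 \<le> a \<Longrightarrow> arrs st a = (\<lambda>_. 0)"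
  shows "tot W Main (\<lambda>st'. solved st' \<and> time st' \<le> time st + 77 + 588 * m + 87 * s + 262 * (m * s)) st"
  unfolding Main_def
proof (rule tot_Seq_conseq[OF tot_Build[OF env ld zero zero]], simp, simp)
  fix st1 :: ram
  assume s1: "linked (arrs st1) \<and> agree {5, 6, 7, 8, 20} (arrs st1) (arrs st) \<and>
    inputs st1 st \<and> time st1 \<le> time st + 6 + 50 * m"
  let ?Q = "\<lambda>st'. solved st' \<and> time st' \<le> time st + 77 + 588 * m + 87 * s + 262 * (m * s)"
  have env1: "env st1" and ld1: "loaded (arrs st1)" and lk1: "linked (arrs st1)"
    using env ld s1 by (auto simp: env_def loaded_def)
  have z1: "arrs st1 a = (\<lambda>_. 0)" if "9 \<le> a" "a \<noteq> 20" for a using s1 zero[of a] that by simp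
  have z14: "arrs st1 4 = (\<lambda>_. 0)" using s1 zero[of 4] by simp
  show "tot W (Seq Reach (Seq Levels (Seq Cands (Seq Roots (Seq Last (Seq Demand Choose)))))) ?Q st1"
  proof (rule tot_Seq_conseq[OF tot_Reach[OF env1 ld1 lk1 z1 z1]], simp_all only: numeral_eq_iff)
    fix st2 :: ram
    assume s2: "reached (arrs st2) \<and> agree {10, 12, 19} (arrs st2) (arrs st1) \<and>
      inputs st2 st1 \<and> time st2 \<le> time st1 + 6 + s * (50 + 54 * m)"
    have env2: "env st2" and ld2: "loaded (arrs st2)" and lk2: "linked (arrs st2)" and rd2: "reached (arrs st2)"
      using env1 ld1 lk1 s2 by (auto simp: env_def loaded_def linked_def)
    show "tot W (Seq Levels (Seq Cands (Seq Roots (Seq Last (Seq Demand Choose))))) ?Q st2"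
    proof (rule tot_Seq_conseq[OF tot_Levels[OF env2 lk2 rd2]])
      fix st3 :: ram
      assume s3: "leveled (arrs st3) \<and> (agree_but 11 (arrs st3) (arrs st2)) \<and>
        inputs st3 st2 \<and> time st3 \<le> time st2 + 10 + (m + m) * (20 + 20 * s)"
      have env3: "env st3" and ld3: "loaded (arrs st3)" and lk3: "linked (arrs st3)" and rd3: "reached (arrs st3)"
        and lv3: "leveled (arrs st3)"
        using env2 ld2 lk2 rd2 s3 by (auto simp: env_def loaded_def linked_def reached_def)
      have z3: "arrs st3 a = (\<lambda>_. 0)" if "a \<in> {13, 14, 15, 16, 17, 18}" for a using s3 s2 z1[of a] that by auto
      have z34: "arrs st3 4 = (\<lambda>_. 0)" using s3 s2 z14 by simp
      show "tot W (Seq Cands (Seq Roots (Seq Last (Seq Demand Choose)))) ?Q st3"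
      proof (rule tot_Seq_conseq[OF tot_Cands[OF env3 ld3 lk3 lv3 z3 z3]], simp, simp)
        fix st4 :: ram
        assume s4: "(\<exists>c. cand_inv c (arrs st4) \<and> length c \<le> m + m \<and> ends es \<subseteq> marked (arrs st4 13)) \<and>
          agree {12, 13, 14, 19} (arrs st4) (arrs st3) \<and>
          inputs st4 st3 \<and> time st4 \<le> time st3 + 14 + 176 * m"
        then obtain c where c: "cand_inv c (arrs st4)" "length c \<le> m + m" "ends es \<subseteq> marked (arrs st4 13)" by blast
        have env4: "env st4" and ld4: "loaded (arrs st4)" and lk4: "linked (arrs st4)" and rd4: "reached (arrs st4)"
          and lv4: "leveled (arrs st4)"
          using env3 ld3 lk3 rd3 lv3 s4 by (auto simp: env_def loaded_def linked_def reached_def leveled_def)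
        have z4: "arrs st4 a = (\<lambda>_. 0)" if "a \<in> {15, 16, 17, 18}" for a using s4 z3[of a] that by auto
        have z44: "arrs st4 4 = (\<lambda>_. 0)" using s4 z34 by simp
        show "tot W (Seq Roots (Seq Last (Seq Demand Choose))) ?Q st4"
        proof (rule tot_Seq_conseq[OF tot_Roots[OF env4 ld4 lk4 lv4 c z44 z4 z4]], simp, simp)
          fix st5 :: ram
          assume s5: "flat_forest es ss (arrs st5 15) (arrs st5 16) (chosen (arrs st5 4)) \<and>
            card (chosen (arrs st5 4)) \<le> 2 * n \<and>
            agree {4, 12, 15, 16} (arrs st5) (arrs st4) \<and>
            inputs st5 st4 \<and> time st5 \<le> time st4 + 13 + 250 * m"
          let ?rt = "arrs st5 15" and ?cp = "arrs st5 16" and ?F = "chosen (arrs st5 4)"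
          have "rp_forest n es ss P W ?rt ?cp ?F"
            using s5 rp_run_axioms by (simp add: rp_forest_def)
          then interpret T: rp_forest n es ss P W ?rt ?cp ?F .
          have env5: "env st5" and rd5: "T.ready (arrs st5)"
            using env4 ld4 rd4 lv4 s5
            by (auto simp: env_def loaded_def reached_def leveled_def T.ready_def)
          have z5: "arrs st5 17 = (\<lambda>_. 0)" "arrs st5 18 = (\<lambda>_. 0)" using s5 z4[of 17] z4[of 18] by simp_all
          show "tot W (Seq Last (Seq Demand Choose)) ?Q st5"
          proof (rule tot_Seq_conseq[OF T.tot_Last[OF env5 rd5 z5(1)]])
            fix st6 :: ram
            assume s6: "T.last_rep m (arrs st6) \<and> (agree_but 17 (arrs st6) (arrs st5)) \<and>
              inputs st6 st5 \<and> time st6 \<le> time st5 + 6 + m * (32 + 24 * s)"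
            have env6: "env st6" using env5 s6 by (simp add: env_def)
            have rd6: "T.ready (arrs st6)" by (rule T.ready_cong[OF rd5]) (use s6 in auto)
            have z6: "arrs st6 18 = (\<lambda>_. 0)" using s6 z5 by simp
            show "tot W (Seq Demand Choose) ?Q st6"
            proof (rule tot_Seq_conseq[OF T.tot_Demand[OF env6 rd6 z6]])
              fix st7 :: ram
              assume s7: "T.need_rep (\<lambda>i r. of_bool (\<exists>t. T.ff.demand i t \<and> ?rt t = r)) (arrs st7) \<and>
                (agree_but 18 (arrs st7) (arrs st6)) \<and>
                inputs st7 st6 \<and> time st7 \<le> time st6 + 6 + s * (18 + 34 * m)"
              have env7: "env st7" using env6 s7 by (simp add: env_def)
              have rd7: "T.ready (arrs st7)" by (rule T.ready_cong[OF rd6]) (use s7 in auto)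
              have l7: "T.last_rep m (arrs st7)"
                using s6 s7 T.last_rep_cong[of "arrs st7" "arrs st6"] by simp
              have ch7: "chosen (arrs st7 4) = ?F" using s6 s7 by simp
              show "tot W Choose ?Q st7"
              proof (rule tot_conseq[OF T.tot_Choose[OF env7 rd7 l7 _ ch7]])
                show "T.need_rep (\<lambda>i r. of_bool (\<exists>t. T.ff.demand i t \<and> ?rt t = r)) (arrs st7)"
                  using s7 by blast
                fix st8 :: ram
                assume s8: "(\<exists>N K pk. T.ff.greedy_inv N K pk (Collect T.ff.rising) \<and> chosen (arrs st8 4) = ?F \<union> K) \<and>
                  time st8 \<le> time st7 + 6 + 19 * s + 38 * m * s + m * (40 + 72 * s)"
                have "solved st8" unfolding solved_def using s8 s5 by blast
                \<comment> \<open>The phases add up to 50 + 40 + 176 + 250 + 32 + 40 for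
                  \<open>m\<close>, 50 + 18 + 19 for \<open>s\<close> and 54 + 40 + 24 + 34 + 38 +
                  72 for \<open>m * s\<close>.\<close>
                moreover have "time st8 \<le> time st + 77 + 588 * m + 87 * s + 262 * (m * s)"
                  using s1 s2 s3 s4 s5 s6 s7 s8 by (simp add: algebra_simps)
                ultimately show "?Q st8" by blast
              qed
            qed
          qed
        qed
      qed
    qed
  qed simp_all
qed

lemma solved_preserver:
  assumes "solved st"
  shows "reach_preserver (set es) P (marked_edges es st)"
    and "\<lbrakk>\<And>(V :: nat set) E S P. rp_instance V E S P \<Longrightarrow>
      \<exists>E'. reach_preserver E P E' \<and> real (card E') \<le> f (card V) (card P) (card S); P \<noteq> {}\<rbrakk> \<Longrightarrow>
      real (card (marked_edges es st)) \<le> 5 * f n (card P) (card (set ss))"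
proof -
  obtain rt cp F N K pk where ff: "flat_forest es ss rt cp F"
    and inv: "flat_forest.greedy_inv es ss P rt cp N K pk (Collect (flat_forest.rising es ss cp))"
    and ch: "chosen (arrs st 4) = F \<union> K" "card F \<le> 2 * n" using assms unfolding solved_def by blast
  interpret G: greedy_result es ss P rt cp F n N K pk
    by (intro greedy_result.intro ff greedy_result_axioms.intro inv input)
  have marked: "marked_edges es st = (!) es ` (F \<union> K)"
    unfolding ch(1)[symmetric] marked_edges_def chosen_def by auto
  show "reach_preserver (set es) P (marked_edges es st)" unfolding marked by (rule G.is_preserver)
  assume f: "\<And>(V :: nat set) E S P. rp_instance V E S P \<Longrightarrow>
      \<exists>E'. reach_preserver E P E' \<and> real (card E') \<le> f (card V) (card P) (card S)" and P: "P \<noteq> {}"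
  let ?f = "f n (card P) (card (set ss))"
  have sub: "P \<subseteq> set ss \<times> {..<n}" using input by (simp add: rp_input_def rp_instance_def)
  then have "finite P" using finite_subset by blast
  then have p: "1 \<le> card P" using P by (simp add: Suc_le_eq card_gt_0_iff)
  have p': "card P \<le> card (set ss) * n" using card_mono[OF _ sub] by (simp add: card_cartesian_product)
  have "1 \<le> card (set ss)" using p p' by (cases "card (set ss)") auto
  moreover have "card (set ss) \<le> n"
    using card_mono[of "{..<n}" "set ss"] input by (auto simp: rp_input_def rp_instance_def)
  ultimately have "real (n - 1) \<le> ?f" using path_lower_bound[where f = f, OF f] p p' by blast
  \<comment> \<open>For \<open>n \<ge> 2\<close>, \<open>2 * n \<le> 4 * (n - 1)\<close>. The
    forests thus cost four times \<open>f\<close> and the rising edges once, which is the factor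
    5.\<close>
  then have "2 * real n \<le> 4 * ?f" using n2 by (simp add: of_nat_diff)
  moreover have "real (card K) \<le> ?f" by (rule G.card_K_le[where f = f, OF f])
  moreover have "card (marked_edges es st) \<le> card F + card K"
    unfolding marked using card_image_le[of "F \<union> K" "(!) es"] card_Un_le[of F K] finite_chosen[of "arrs st 4"] ch(1)
    by simp
  ultimately show "real (card (marked_edges es st)) \<le> 5 * ?f" using ch(2) by linarith
qed

end

lemma tot_Program:
  assumes W: "2 < W"
    and stop: "\<And>st'. \<not> (1 < regs st 0 \<and> regs st 1 \<noteq> 0 \<and> regs st 3 \<noteq> 0) \<Longrightarrow>
      arrs st' = arrs st \<Longrightarrow> time st' \<le> time st + 20 \<Longrightarrow> Q st'"
    and main: "\<And>st'. 1 < regs st 0 \<Longrightarrow> regs st 1 \<noteq> 0 \<Longrightarrow> regs st 3 \<noteq> 0 \<Longrightarrow>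
      arrs st' = arrs st \<Longrightarrow> regs st' = regs st \<Longrightarrow> time st' \<le> time st + 20 \<Longrightarrow> tot W Main Q st'"
  shows "tot W Program Q st"
proof (cases "1 < regs st 0 \<and> regs st 1 \<noteq> 0 \<and> regs st 3 \<noteq> 0")
  case True
  then show ?thesis using W unfolding Program_def by (auto intro!: main)
next
  case False
  then show ?thesis using W stop[OF False] unfolding Program_def by auto
qed

lemma run_Program:
  fixes f :: "nat \<Rightarrow> nat \<Rightarrow> nat \<Rightarrow> real"
  assumes f: "\<And>(V :: nat set) E S P. rp_instance V E S P \<Longrightarrow>
    \<exists>E'. reach_preserver E P E' \<and> real (card E') \<le> f (card V) (card P) (card S)"
    and input: "rp_input n es ss P"
  obtains st where "run 3 Program n es ss P = return_spmf st"
    "reach_preserver (set es) P (marked_edges es st)"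
    "real (card (marked_edges es st)) \<le> 5 * f n (card P) (card (set ss))"
    "real (time st) \<le> 1100 * max 1 (real (card (set es)) * real (card (set ss)) * log 2 (real n))"
proof -
  let ?W = "(n + 2) ^ 3"
  let ?I = "input_state n es ss P"
  have inst: "rp_instance {..<n} (set es) (set ss) P" and d: "distinct es" "distinct ss"
    using input by (auto simp: rp_input_def)
  have cards: "card (set es) = length es" "card (set ss) = length ss" using d distinct_card by auto
  have W8: "8 \<le> ?W" using power_mono[of 2 "n + 2" 3] by simp
  have finP: "finite P" using inst finite_subset[of P "set ss \<times> {..<n}"] by (auto simp: rp_instance_def)
  have I: "regs ?I 0 = n" "regs ?I 1 = length es" "regs ?I 2 = length ss" "regs ?I 3 = card P"
    "time ?I = 0" by (simp_all add: input_state_def)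
  have "tot ?W Program (\<lambda>st. reach_preserver (set es) P (marked_edges es st) \<and>
    real (card (marked_edges es st)) \<le> 5 * f n (card P) (card (set ss)) \<and>
    real (time st) \<le> 1100 * max 1 (real (card (set es)) * real (card (set ss)) * log 2 (real n))) ?I"
    (is "tot _ _ ?Q _")
  proof (rule tot_Program)
    show "2 < ?W" using W8 by simp
  next
    fix st :: ram
    assume "\<not> (1 < regs ?I 0 \<and> regs ?I 1 \<noteq> 0 \<and> regs ?I 3 \<noteq> 0)"
      and that: "arrs st = arrs ?I" "time st \<le> time ?I + 20"
    then have False: "\<not> (2 \<le> n \<and> es \<noteq> [] \<and> P \<noteq> {})"
      unfolding I using finP by auto
    have f0: "0 \<le> f n (card P) (card (set ss))" using f[OF inst] by (force intro: order_trans)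
    show "?Q st"
    proof -
      have "arrs st 4 = (\<lambda>_. 0)" using that(1) by (simp add: input_state_def)
      then have "marked_edges es st = {}" by (simp add: marked_edges_def)
      moreover have "reach_preserver (set es) P {}"
      proof -
        have "a = b" if ab: "(a, b) \<in> P" "(a, b) \<in> (set es)\<^sup>*" for a b
        proof (cases "2 \<le> n")
          case True
          then show ?thesis using False ab by auto
        next
          case n: False
          have "a < n" "b < n" using inst ab(1) by (auto simp: rp_instance_def)
          then show ?thesis using n by linarith
        qed
        then show ?thesis by (auto simp: reach_preserver_def)
      qed
      moreover have "real (time st) \<le> 1100 * max 1 x" for x :: real
        using that(2) I(5) max.cobounded1[of 1 x] by linarith
      ultimately show ?thesis using f0 by simp
    qed
  next
    fix st :: ram
    assume g: "1 < regs ?I 0" "regs ?I 1 \<noteq> 0" "regs ?I 3 \<noteq> 0"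
      and st: "arrs st = arrs ?I" "regs st = regs ?I" "time st \<le> time ?I + 20"
    have True: "2 \<le> n \<and> es \<noteq> [] \<and> P \<noteq> {}" using g unfolding I by auto
    then interpret rp_run n es ss P ?W
    proof unfold_locales
      \<comment> \<open>The third power suffices for the word bound because \<open>n + 2\<close> is
        at least 4.\<close>
      have "4 * (n + 2) ^ 2 \<le> (n + 2) * (n + 2) ^ 2" using True by (intro mult_right_mono) auto
      then show "4 * n * n + 16 * n + 16 \<le> ?W" by (simp add: power2_eq_square power3_eq_cube algebra_simps)
    qed (use input True in auto)
    show "tot ?W Main ?Q st"
    proof (rule tot_conseq[OF tot_Main])
      show "env st" using st I by (simp add: env_def)
      have "P \<subseteq> {..<n} \<times> {..<n}" using inst by (auto simp: rp_instance_def)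
      then show "loaded (arrs st)" unfolding st(1) by (auto simp: loaded_def input_state_def)
      show "arrs st a = (\<lambda>_. 0)" if "4 \<le> a" for a using that unfolding st(1) by (simp add: input_state_def)
      fix st' :: ram
      assume s: "solved st' \<and> time st' \<le> time st + 77 + 588 * length es + 87 * length ss + 262 * (length es * length ss)"
      let ?p = "length es * length ss"
      have "ss \<noteq> []" using True inst by (auto simp: rp_instance_def)
      then have "1 \<le> length es" "1 \<le> length ss" using True by (auto simp: Suc_le_eq)
      then have "length es \<le> ?p" "length ss \<le> ?p" "1 \<le> ?p" by auto
      \<comment> \<open>Every term is at most its coefficient times \<open>?p\<close>, and 20 + 77 +
        588 + 87 + 262 = 1034.\<close>
      then have "time st' \<le> 1100 * ?p" using s st(3) I(5) by linarith
      then have "real (time st') \<le> 1100 * real ?p" by (metis of_nat_le_iff of_nat_mult of_nat_numeral)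
      also have "\<dots> \<le> 1100 * (real ?p * log 2 (real n))"
      proof -
        have "1 \<le> log 2 (real n)" using True by (simp add: le_log_iff)
        from mult_left_mono[OF this, of "real ?p"] show ?thesis by simp
      qed
      also have "\<dots> \<le> 1100 * max 1 (real ?p * log 2 (real n))" by simp
      finally show "?Q st'"
        using s solved_preserver(1) solved_preserver(2)[where f = f, OF _ f] True by (simp add: cards)
    qed
  qed
  then show thesis using that unfolding tot_def run_def by blast
qed

theorem theorem6:
  fixes f :: "nat \<Rightarrow> nat \<Rightarrow> nat \<Rightarrow> real"
  assumes "\<And>(V :: nat set) E S P. rp_instance V E S P \<Longrightarrow>
    \<exists>E'. reach_preserver E P E' \<and> real (card E') \<le> f (card V) (card P) (card S)"
  shows "\<exists>prog k.
    2 \<le> k \<and>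
    (\<exists>A::real. \<forall>n es ss P. rp_input n es ss P \<longrightarrow>
      lossless_spmf (run k prog n es ss P) \<and>
      (\<forall>\<sigma> \<in> set_spmf (run k prog n es ss P).
        reach_preserver (set es) P (marked_edges es \<sigma>) \<and>
        real (card (marked_edges es \<sigma>)) \<le> A * f n (card P) (card (set ss)))) \<and>
    (\<forall>c::nat. \<exists>C::real. \<forall>n es ss P. rp_input n es ss P \<longrightarrow>
      measure (measure_spmf (run k prog n es ss P))
        {\<sigma>. real (time \<sigma>)
             \<le> C * max 1 (real (card (set es)) * real (card (set ss)) * log 2 (real n))}
        \<ge> 1 - 1 / real n ^ c)"
proof (intro exI[of _ Program] exI[of _ "3::nat"] conjI allI)
  show "\<exists>A::real. \<forall>n es ss P. rp_input n es ss P \<longrightarrow>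
      lossless_spmf (run 3 Program n es ss P) \<and>
      (\<forall>\<sigma> \<in> set_spmf (run 3 Program n es ss P).
        reach_preserver (set es) P (marked_edges es \<sigma>) \<and>
        real (card (marked_edges es \<sigma>)) \<le> A * f n (card P) (card (set ss)))"
  proof (intro exI[of _ 5] allI impI)
    fix n es ss and P :: "(nat \<times> nat) set"
    assume "rp_input n es ss P"
    from run_Program[where f = f, OF assms this] obtain \<sigma> where "run 3 Program n es ss P = return_spmf \<sigma>"
      "reach_preserver (set es) P (marked_edges es \<sigma>)"
      "real (card (marked_edges es \<sigma>)) \<le> 5 * f n (card P) (card (set ss))" .
    then show "lossless_spmf (run 3 Program n es ss P) \<and>
      (\<forall>\<sigma> \<in> set_spmf (run 3 Program n es ss P).
        reach_preserver (set es) P (marked_edges es \<sigma>) \<and>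
        real (card (marked_edges es \<sigma>)) \<le> 5 * f n (card P) (card (set ss)))" by simp
  qed
  fix c :: nat
  show "\<exists>C::real. \<forall>n es ss P. rp_input n es ss P \<longrightarrow>
      measure (measure_spmf (run 3 Program n es ss P))
        {\<sigma>. real (time \<sigma>)
             \<le> C * max 1 (real (card (set es)) * real (card (set ss)) * log 2 (real n))}
        \<ge> 1 - 1 / real n ^ c"
  proof (intro exI[of _ 1100] allI impI)
    fix n es ss and P :: "(nat \<times> nat) set"
    assume "rp_input n es ss P"
    from run_Program[where f = f, OF assms this] obtain \<sigma> where r: "run 3 Program n es ss P = return_spmf \<sigma>"
      "real (time \<sigma>) \<le> 1100 * max 1 (real (card (set es)) * real (card (set ss)) * log 2 (real n))" .
    \<comment> \<open>The outcome is a point mass, so the time bound holds with probability 1, with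
      one constant for all \<open>c\<close>.\<close>
    then show "1 - 1 / real n ^ c \<le> measure (measure_spmf (run 3 Program n es ss P))
        {\<sigma>. real (time \<sigma>)
             \<le> 1100 * max 1 (real (card (set es)) * real (card (set ss)) * log 2 (real n))}"
      by (simp add: measure_spmf_return_spmf measure_return)
  qed
qed simp

end
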